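(* Let $m\ge1$ and let $k\ge0$ be an integer. If $k$ is odd, the space of modes of wavenumber $k$ of $S^3/D_m^*$ is $\{0\}$. If $k$ is even, consider the polynomials $(\alpha^2\beta^2)^a(\alpha^{2m}+\beta^{2m})^b(\alpha\beta(\alpha^{2m}-\beta^{2m}))^c$ if $m$ is even, or $(\alpha^2\beta^2)^a(\alpha^{2m}-\beta^{2m})^b(\alpha\beta(\alpha^{2m}+\beta^{2m}))^c$ if $m$ is odd, over all integers $a\ge0$, $b\ge0$, $c\in\{0,1\}$ with $4a+2mb+(2m+2)c=k$. These polynomials together with all their siblings (restricted to $S^3$) form a basis of the space of modes of wavenumber $k$ of $S^3/D_m^*$, and this space has dimension $$\left(2\left\lfloor\frac{k/2}{2}\right\rfloor+\left\lfloor\frac{k/2}{m}\right\rfloor-\frac k2+1\right)(k+1).$$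
   Context: Identify $\mathbb R^4$ with $\mathbb C^2$ via $\alpha=x+iy$, $\beta=z+iw$, $S^3=\{|\alpha|^2+|\beta|^2=1\}$. Wirtinger derivatives $\frac{\partial}{\partial\alpha}=\frac12(\partial_x-i\partial_y)$, similarly for $\beta$ with $(z,w)$. $\mathrm{twist}_-=-\bar\beta\frac{\partial}{\partial\alpha}+\bar\alpha\frac{\partial}{\partial\beta}$. For a polynomial $f$ in $\alpha,\beta$ only, homogeneous of degree $k$, its siblings are $\mathrm{twist}_-^j f$, $j=0,\dots,k$. $\gamma\in SU(2)$ acts on $\mathbb C^2$ by $(\alpha,\beta)^T\mapsto\gamma(\alpha,\beta)^T$ and on functions by $(R_\gamma F)(x)=F(\gamma^{-1}x)$. For a finite subgroup $\Gamma\subset SU(2)$, the space of modes of wavenumber $k$ of $S^3/\Gamma$ is the complex vector space of $\Gamma$-invariant $F:S^3\to\mathbb C$ with $\Delta_{S^3}F=-k(k+2)F$. The binary dihedral group $D_m^*$ (order $4m$) is the subgroup of $SU(2)$ generated by $\begin{pmatrix}0&i\\ i&0\end{pmatrix}$ and $\mathrm{diag}(e^{i\pi/m},e^{-i\pi/m})$. *)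

theory Defs
  imports "HOL-Analysis.Analysis" "HOL-Library.Function_Algebras"
begin

text \<open>Points of R^4 = C^2 are vectors x :: complex^2 with alpha = x$1, beta = x$2.
  The norm of complex^2 is sqrt(|alpha|^2+|beta|^2), so S^3 is the unit sphere.\<close>

definition pt :: "complex \<Rightarrow> complex \<Rightarrow> complex^2" where
  "pt a b = (\<chi> i. if i = 1 then a else b)"

definition S3 :: "(complex^2) set" where
  "S3 = {x. norm x = 1}"

definition ex :: "complex^2" where "ex = pt 1 0"
definition ey :: "complex^2" where "ey = pt \<i> 0"
definition ez :: "complex^2" where "ez = pt 0 1"
definition ew :: "complex^2" where "ew = pt 0 \<i>"

definition pd :: "complex^2 \<Rightarrow> (complex^2 \<Rightarrow> complex) \<Rightarrow> complex^2 \<Rightarrow> complex" where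
  "pd v G p = vector_derivative (\<lambda>t::real. G (p + t *\<^sub>R v)) (at 0)"

definition coord_dirs :: "(complex^2) set" where
  "coord_dirs = {ex, ey, ez, ew}"

definition C2_on :: "(complex^2) set \<Rightarrow> (complex^2 \<Rightarrow> complex) \<Rightarrow> bool" where
  "C2_on U G \<longleftrightarrow>
     (\<forall>v\<in>coord_dirs. \<forall>p\<in>U. ((\<lambda>t::real. G (p + t *\<^sub>R v)) has_vector_derivative pd v G p) (at 0)) \<and>
     (\<forall>u\<in>coord_dirs. \<forall>v\<in>coord_dirs. \<forall>p\<in>U.
        ((\<lambda>t::real. pd v G (p + t *\<^sub>R u)) has_vector_derivative pd u (pd v G) p) (at 0)) \<and>
     (\<forall>u\<in>coord_dirs. \<forall>v\<in>coord_dirs. continuous_on U (pd u (pd v G)))"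

definition lap4 :: "(complex^2 \<Rightarrow> complex) \<Rightarrow> complex^2 \<Rightarrow> complex" where
  "lap4 G p = (\<Sum>v\<in>coord_dirs. pd v (pd v G) p)"

definition hext :: "(complex^2 \<Rightarrow> complex) \<Rightarrow> complex^2 \<Rightarrow> complex" where
  "hext F x = F ((1 / norm x) *\<^sub>R x)"

text \<open>Laplace-Beltrami operator of S^3: the Euclidean Laplacian of the 0-homogeneous
  extension, evaluated on S^3.\<close>
definition lapS3 :: "(complex^2 \<Rightarrow> complex) \<Rightarrow> complex^2 \<Rightarrow> complex" where
  "lapS3 F p = lap4 (hext F) p"

text \<open>Functions on S^3 are represented as functions on C^2 vanishing off S^3;
  F is smooth enough (C^2) on S^3 if its homogeneous extension is C^2 on R^4 minus 0.\<close>
definition S3_fun :: "(complex^2 \<Rightarrow> complex) \<Rightarrow> bool" where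
  "S3_fun F \<longleftrightarrow> (\<forall>p. p \<notin> S3 \<longrightarrow> F p = 0) \<and> C2_on (- {0}) (hext F)"

definition restrS3 :: "(complex^2 \<Rightarrow> complex) \<Rightarrow> complex^2 \<Rightarrow> complex" where
  "restrS3 G p = (if p \<in> S3 then G p else 0)"

definition Ract :: "complex^2^2 \<Rightarrow> (complex^2 \<Rightarrow> complex) \<Rightarrow> complex^2 \<Rightarrow> complex" where
  "Ract \<gamma> F x = F (matrix_inv \<gamma> *v x)"

definition mat2 :: "complex \<Rightarrow> complex \<Rightarrow> complex \<Rightarrow> complex \<Rightarrow> complex^2^2" where
  "mat2 a b c d = (\<chi> i. if i = 1 then pt a b else pt c d)"

text \<open>Binary dihedral group D_m^* as the subgroup of SU(2) generated by the two matrices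
  (the group is finite, so the generated subgroup is the closure under products).\<close>
inductive_set binary_dihedral :: "nat \<Rightarrow> (complex^2^2) set" for m :: nat where
  one: "mat 1 \<in> binary_dihedral m"
| gen1: "mat2 0 \<i> \<i> 0 \<in> binary_dihedral m"
| gen2: "mat2 (cis (pi / m)) 0 0 (cis (- pi / m)) \<in> binary_dihedral m"
| mult: "g \<in> binary_dihedral m \<Longrightarrow> h \<in> binary_dihedral m \<Longrightarrow> g ** h \<in> binary_dihedral m"

definition modes :: "(complex^2^2) set \<Rightarrow> nat \<Rightarrow> (complex^2 \<Rightarrow> complex) set" where
  "modes \<Gamma> k = {F. S3_fun F \<and>
      (\<forall>\<gamma>\<in>\<Gamma>. \<forall>p\<in>S3. Ract \<gamma> F p = F p) \<and>
      (\<forall>p\<in>S3. lapS3 F p = - of_nat (k * (k + 2)) * F p)}"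

definition d_alpha :: "(complex^2 \<Rightarrow> complex) \<Rightarrow> complex^2 \<Rightarrow> complex" where
  "d_alpha G p = (pd ex G p - \<i> * pd ey G p) / 2"

definition d_beta :: "(complex^2 \<Rightarrow> complex) \<Rightarrow> complex^2 \<Rightarrow> complex" where
  "d_beta G p = (pd ez G p - \<i> * pd ew G p) / 2"

definition twist_minus :: "(complex^2 \<Rightarrow> complex) \<Rightarrow> complex^2 \<Rightarrow> complex" where
  "twist_minus G p = - cnj (p$2) * d_alpha G p + cnj (p$1) * d_beta G p"

definition dihedral_poly :: "nat \<Rightarrow> nat \<Rightarrow> nat \<Rightarrow> nat \<Rightarrow> complex^2 \<Rightarrow> complex" where
  "dihedral_poly m a b c x =
     (let \<alpha> = x$1; \<beta> = x$2 in
      if even m then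
        (\<alpha>^2 * \<beta>^2)^a * (\<alpha>^(2*m) + \<beta>^(2*m))^b * (\<alpha> * \<beta> * (\<alpha>^(2*m) - \<beta>^(2*m)))^c
      else
        (\<alpha>^2 * \<beta>^2)^a * (\<alpha>^(2*m) - \<beta>^(2*m))^b * (\<alpha> * \<beta> * (\<alpha>^(2*m) + \<beta>^(2*m)))^c)"

definition fscale :: "complex \<Rightarrow> (complex^2 \<Rightarrow> complex) \<Rightarrow> complex^2 \<Rightarrow> complex" where
  "fscale c F = (\<lambda>x. c * F x)"

end

theory Submission
  imports Defs "HOL-Computational_Algebra.Polynomial"
begin

text \<open>
  Right multiplication by the unit quaternions gives three complex structures \<open>J_i, J_j, J_k\<close> on
  \<open>\<complex>\<^sup>2\<close> that commute with \<open>SU(2)\<close>, and the Laplacian of \<open>S\<^sup>3\<close> is the sum of the squared derivatives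
  along their flows. Rotation invariance of the surface measure therefore makes it symmetric, so
  eigenfunctions of different eigenvalues are orthogonal.

  Let \<open>harmonic p q i\<close> be the coefficient of \<open>u\<^sup>i\<close> in \<open>(\<beta> + \<alpha> u)\<^sup>p (cnj \<alpha> - cnj \<beta> u)\<^sup>q\<close>. It is an
  eigenfunction of wavenumber \<open>p + q\<close>, and on \<open>S\<^sup>3\<close> the span of all \<open>harmonic p q i\<close> is closed under
  multiplication by coordinates, hence dense by Stone-Weierstrass; so the eigenfunctions of
  wavenumber \<open>k\<close> are exactly the combinations of the \<open>harmonic p q i\<close> with \<open>p + q = k\<close>.

  Since \<open>twist_minus\<close> maps \<open>harmonic p q i\<close> to \<open>p\<close> times \<open>harmonic (p - 1) (q + 1) i\<close>, and
  \<open>harmonic k 0 i\<close> is a multiple of \<open>\<alpha>\<^sup>i \<beta>\<^sup>k\<^sup>-\<^sup>i\<close>, every eigenfunction is a sum of \<open>j\<close>-th siblings of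
  binary forms \<open>f j\<close> of degree \<open>k\<close>, \<open>j \<le> k\<close>. The \<open>f j\<close> are unique: the \<open>j\<close>-th siblings are separated by
  their weight under scalar multiplication by unit complex numbers, and the opposite ladder operator
  inverts \<open>twist_minus\<close>. As \<open>twist_minus\<close> commutes with \<open>SU(2)\<close>, the modes of \<open>S\<^sup>3 / \<Gamma>\<close> are the sums of
  siblings of \<open>\<Gamma>\<close>-invariant forms.

  For the binary dihedral group the invariant forms of degree \<open>2 n\<close> are spanned by
  \<open>\<alpha>\<^sup>i \<beta>\<^sup>2\<^sup>n\<^sup>-\<^sup>i + (-1)\<^sup>n \<alpha>\<^sup>2\<^sup>n\<^sup>-\<^sup>i \<beta>\<^sup>i\<close> with \<open>i\<close> congruent to \<open>n\<close> modulo \<open>m\<close>. Newton's recursion for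
  power sums expresses these in the given polynomials, which are independent because they vanish to
  different orders at \<open>\<alpha> = 0\<close>.
\<close>

section \<open>Integration over the unit sphere\<close>

lemma nn_integral_lborel_translation:
  fixes a :: "'a::euclidean_space"
  assumes [measurable]: "f \<in> borel_measurable borel"
  shows "(\<integral>\<^sup>+x. f (a + x) \<partial>lborel) = (\<integral>\<^sup>+x. f x \<partial>lborel)"
  by (subst lborel_distr_plus[of a, symmetric]) (simp add: nn_integral_distr)

lemma borel_measurable_orthogonal:
  fixes R :: "'a::euclidean_space \<Rightarrow> 'a"
  assumes "orthogonal_transformation R"
  shows "R \<in> borel_measurable borel"
  using orthogonal_transformation_linear[OF assms]
  by (intro borel_measurable_continuous_onI linear_continuous_on)
      (simp add: linear_conv_bounded_linear)

lemma nn_integral_indicator_ball_orthogonal: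
  fixes R :: "'a::euclidean_space \<Rightarrow> 'a"
  assumes R_orthogonal: "orthogonal_transformation R" and "r \<ge> 0"
  shows "(\<integral>\<^sup>+x. indicator (ball 0 r) (z - R x) \<partial>lborel) = emeasure lborel (ball (0::'a) r)"
proof -
  obtain w where z_eq: "z = R w"
    using orthogonal_transformation_surj[OF R_orthogonal] by (metis surjD)
  then have "z - R x = R (w - x)" for x
    by (simp add: linear_diff[OF orthogonal_transformation_linear[OF R_orthogonal]])
  then have "norm (z - R x) = dist w x" for x
    using R_orthogonal by (simp add: dist_norm orthogonal_transformation)
  then have "(\<integral>\<^sup>+x. indicator (ball 0 r) (z - R x) \<partial>lborel) = (\<integral>\<^sup>+x. indicator (ball w r) x \<partial>lborel)"
    by (simp add: indicator_def)
  then show ?thesis using \<open>r \<ge> 0\<close> by (simp add: emeasure_ball)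
qed

text \<open>The measure of \<open>{(x, y). R x + y \<in> A \<and> \<parallel>y\<parallel> < 1}\<close> is computed in both orders of integration.\<close>

lemma emeasure_lborel_orthogonal_vimage:
  fixes R :: "'a::euclidean_space \<Rightarrow> 'a"
  assumes R_orthogonal: "orthogonal_transformation R" and A_borel [measurable]: "A \<in> sets borel"
  shows "emeasure lborel (R -` A) = emeasure lborel A"
proof -
  let ?B = "ball (0::'a) 1"
  obtain R' where R_R': "\<And>y. R (R' y) = y"
    using orthogonal_transformation_surj[OF R_orthogonal] by (metis surjD)
  have [measurable]: "?B \<in> sets borel" by simp
  have [measurable]: "R \<in> borel_measurable borel"
    by (rule borel_measurable_orthogonal[OF R_orthogonal])
  have vimage_borel: "R -` A \<in> sets borel" using measurable_sets[of R borel borel A] by simp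
  have vimage: "(\<integral>\<^sup>+x. indicator A (R x + y) \<partial>lborel) = emeasure lborel (R -` A)" for y
  proof -
    have "(\<integral>\<^sup>+x. indicator A (R x + y) \<partial>lborel) = (\<integral>\<^sup>+x. indicator A (R (R' y + x)) \<partial>lborel)"
      by (simp add: linear_add[OF orthogonal_transformation_linear[OF R_orthogonal]] R_R' add.commute)
    also have "\<dots> = (\<integral>\<^sup>+x. indicator A (R x) \<partial>lborel)"
      by (rule nn_integral_lborel_translation) simp
    also have "\<dots> = (\<integral>\<^sup>+x. indicator (R -` A) x \<partial>lborel)" by (simp add: indicator_def)
    finally show ?thesis by (simp add: vimage_borel)
  qed
  have "emeasure lborel (R -` A) * emeasure lborel ?B
      = (\<integral>\<^sup>+y. (\<integral>\<^sup>+x. indicator A (R x + y) * indicator ?B y \<partial>lborel) \<partial>lborel)"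
    by (simp add: nn_integral_multc vimage nn_integral_cmult_indicator)
  also have "\<dots> = (\<integral>\<^sup>+x. (\<integral>\<^sup>+y. indicator A (R x + y) * indicator ?B y \<partial>lborel) \<partial>lborel)"
    by (rule lborel_pair.Fubini') measurable
  also have "\<dots> = (\<integral>\<^sup>+x. (\<integral>\<^sup>+z. indicator A z * indicator ?B (z - R x) \<partial>lborel) \<partial>lborel)"
    by (subst nn_integral_lborel_translation[of "\<lambda>z. indicator A z * indicator ?B (z - R x)" "R x"
         for x, symmetric])
       simp_all
  also have "\<dots> = (\<integral>\<^sup>+z. (\<integral>\<^sup>+x. indicator A z * indicator ?B (z - R x) \<partial>lborel) \<partial>lborel)"
    by (rule lborel_pair.Fubini') measurable
  also have "\<dots> = emeasure lborel A * emeasure lborel ?B"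
    by (simp add: nn_integral_cmult nn_integral_indicator_ball_orthogonal[OF R_orthogonal]
         nn_integral_multc)
  finally show ?thesis
    using unit_ball_vol_pos[of "real DIM('a)", THEN less_imp_neq]
    by (simp add: ennreal_mult_cancel_left emeasure_ball mult.commute[of _ "ennreal c" for c])
qed

lemma lborel_distr_orthogonal:
  fixes R :: "'a::euclidean_space \<Rightarrow> 'a"
  assumes "orthogonal_transformation R"
  shows "distr lborel borel R = lborel"
  using borel_measurable_orthogonal[OF assms]
  by (intro measure_eqI) (simp_all add: emeasure_distr emeasure_lborel_orthogonal_vimage[OF assms])

text \<open>Polar coordinates: up to a positive factor, this is integration against the surface measure.\<close>

definition sphere_integral ::
  "('a::euclidean_space \<Rightarrow> 'b::{banach, second_countable_topology}) \<Rightarrow> 'b" where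
  "sphere_integral f = (LINT y:ball 0 1 - {0}|lborel. f (sgn y))"

lemma continuous_on_sgn_comp:
  fixes f :: "'a::real_normed_vector \<Rightarrow> 'b::topological_space"
  assumes "continuous_on (sphere 0 1) f"
  shows "continuous_on (ball 0 1 - {0}) (\<lambda>y. f (sgn y))"
proof -
  have "continuous_on (ball 0 1 - {0}) (sgn :: 'a \<Rightarrow> 'a)"
    unfolding sgn_div_norm[abs_def] by (auto intro!: continuous_intros)
  then show ?thesis by (rule continuous_on_compose2[OF assms]) (auto simp: norm_sgn split: if_splits)
qed

lemma sphere_bound:
  fixes f :: "'a::euclidean_space \<Rightarrow> 'b::real_normed_vector"
  assumes "continuous_on (sphere 0 1) f"
  obtains B where "B > 0" "\<And>x. x \<in> sphere 0 1 \<Longrightarrow> norm (f x) \<le> B"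
  using compact_imp_bounded[OF compact_continuous_image[OF assms compact_sphere]]
  by (auto simp: bounded_pos)

lemma set_integrable_const_punctured_ball:
  "set_integrable lborel (ball (0::'a::euclidean_space) 1 - {0})
      (\<lambda>y. c :: 'b::{banach, second_countable_topology})"
proof -
  have "emeasure lborel (ball (0::'a) 1 - {0}) \<le> emeasure lborel (ball (0::'a) 1)"
    by (rule emeasure_mono) auto
  then have "emeasure lborel (ball (0::'a) 1 - {0}) < \<infinity>"
    using emeasure_lborel_ball_finite[of "0::'a" 1] by (simp add: le_less_trans)
  then show ?thesis unfolding set_integrable_def by (intro integrable_scaleR_left) simp
qed

lemma set_integrable_sphere:
  fixes f :: "'a::euclidean_space \<Rightarrow> 'b::{banach, second_countable_topology}"
  assumes "continuous_on (sphere 0 1) f"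
  shows "set_integrable lborel (ball 0 1 - {0}) (\<lambda>y. f (sgn y))"
  unfolding set_integrable_def
proof -
  obtain B where bound: "\<And>x. x \<in> sphere 0 1 \<Longrightarrow> norm (f x) \<le> B"
    using sphere_bound[OF assms] by blast
  show "integrable lborel (\<lambda>y. indicator (ball 0 1 - {0}) y *\<^sub>R f (sgn y))"
  proof (rule Bochner_Integration.integrable_bound)
    show "integrable lborel (\<lambda>y. indicator (ball (0::'a) 1 - {0}) y *\<^sub>R B)"
      using set_integrable_const_punctured_ball unfolding set_integrable_def .
    show "(\<lambda>y. indicator (ball 0 1 - {0}) y *\<^sub>R f (sgn y)) \<in> borel_measurable lborel"
      using borel_measurable_continuous_on_indicator[OF _ continuous_on_sgn_comp[OF assms]] by simp
    show "AE y in lborel. norm (indicator (ball 0 1 - {0}) y *\<^sub>R f (sgn y))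
        \<le> norm (indicator (ball (0::'a) 1 - {0}) y *\<^sub>R B)"
      using bound
      by (intro AE_I2) (auto simp: indicator_def norm_sgn intro: order_trans[OF _ abs_ge_self])
  qed
qed

lemma sphere_integral_cong:
  "(\<And>x. x \<in> sphere 0 1 \<Longrightarrow> f x = g x) \<Longrightarrow> sphere_integral f = sphere_integral g"
  unfolding sphere_integral_def by (rule set_lebesgue_integral_cong) (auto simp: norm_sgn)

lemma sphere_integral_add:
  assumes "continuous_on (sphere 0 1) f" "continuous_on (sphere 0 1) g"
  shows "sphere_integral (\<lambda>x. f x + g x) = sphere_integral f + sphere_integral g"
  unfolding sphere_integral_def by (intro set_integral_add set_integrable_sphere assms)

lemma sphere_integral_diff:
  assumes "continuous_on (sphere 0 1) f" "continuous_on (sphere 0 1) g"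
  shows "sphere_integral (\<lambda>x. f x - g x) = sphere_integral f - sphere_integral g"
  unfolding sphere_integral_def by (intro set_integral_diff set_integrable_sphere assms)

lemma sphere_integral_mult_right:
  "sphere_integral (\<lambda>x. c * f x) = c * sphere_integral f" for c :: complex
  unfolding sphere_integral_def by (rule set_integral_mult_right)

lemma sphere_integral_orthogonal:
  fixes R :: "'a::euclidean_space \<Rightarrow> 'a" and f :: "'a \<Rightarrow> 'b::{banach, second_countable_topology}"
  assumes R_orthogonal: "orthogonal_transformation R" and f_cont: "continuous_on (sphere 0 1) f"
  shows "sphere_integral (\<lambda>x. f (R x)) = sphere_integral f"
proof -
  have norm: "norm (R x) = norm x" for x using R_orthogonal by (simp add: orthogonal_transformation)
  have sgn: "R (sgn x) = sgn (R x)" for x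
    by (simp add: sgn_div_norm norm linear_scale[OF
         orthogonal_transformation_linear[OF R_orthogonal]])
  have zero: "R x = 0 \<longleftrightarrow> x = 0" for x by (metis norm norm_eq_zero)
  have "sphere_integral f = (\<integral>y. indicator (ball 0 1 - {0}) y *\<^sub>R f (sgn y) \<partial>distr lborel borel R)"
    by (simp add: sphere_integral_def set_lebesgue_integral_def
         lborel_distr_orthogonal[OF R_orthogonal])
  also have "\<dots> = (\<integral>y. indicator (ball 0 1 - {0}) (R y) *\<^sub>R f (sgn (R y)) \<partial>lborel)"
    using borel_measurable_orthogonal[OF R_orthogonal]
      borel_measurable_integrable[OF set_integrable_sphere[OF f_cont, unfolded set_integrable_def]]
    by (intro integral_distr) simp_all
  also have "\<dots> = sphere_integral (\<lambda>x. f (R x))"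
    by (simp add: sphere_integral_def set_lebesgue_integral_def sgn indicator_def norm zero)
  finally show ?thesis ..
qed

lemma norm_sphere_integral_le:
  fixes f :: "'a::euclidean_space \<Rightarrow> 'b::{banach, second_countable_topology}"
  assumes f_cont: "continuous_on (sphere 0 1) f" and bound: "\<And>x. x \<in> sphere 0 1 \<Longrightarrow> norm (f x) \<le> B"
  shows "norm (sphere_integral f) \<le> B * measure lborel (ball (0::'a) 1 - {0})"
proof -
  have "norm (sphere_integral f) \<le> (LINT y:ball 0 1 - {0}|lborel. norm (f (sgn y)))"
    unfolding sphere_integral_def
    by (rule set_integral_norm_bound[OF set_integrable_sphere[OF f_cont]])
  also have "\<dots> \<le> (LINT y:ball (0::'a) 1 - {0}|lborel. B)"
    by (intro set_integral_mono set_integrable_norm set_integrable_sphere f_cont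
         set_integrable_const_punctured_ball bound)
       (auto simp: norm_sgn)
  finally show ?thesis by (simp add: set_lebesgue_integral_def mult.commute)
qed

lemma sphere_integral_dominated_convergence:
  fixes f :: "'a::euclidean_space \<Rightarrow> 'b::{banach, second_countable_topology}"
  assumes f_cont: "continuous_on (sphere 0 1) f" and s_cont: "\<And>n. continuous_on (sphere 0 1) (s n)"
    and lim: "\<And>x. x \<in> sphere 0 1 \<Longrightarrow> (\<lambda>n. s n x) \<longlonglongrightarrow> f x"
    and bound: "\<And>n x. x \<in> sphere 0 1 \<Longrightarrow> norm (s n x) \<le> B"
  shows "(\<lambda>n. sphere_integral (s n)) \<longlonglongrightarrow> sphere_integral f"
proof -
  let ?ind = "indicator (ball 0 1 - {0}) :: 'a \<Rightarrow> real"
  note integrable = set_integrable_sphere[unfolded set_integrable_def]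
  show ?thesis
    unfolding sphere_integral_def set_lebesgue_integral_def
  proof (rule integral_dominated_convergence)
    show "(\<lambda>y. ?ind y *\<^sub>R f (sgn y)) \<in> borel_measurable lborel"
      "(\<lambda>y. ?ind y *\<^sub>R s n (sgn y)) \<in> borel_measurable lborel" for n
      by (intro borel_measurable_integrable integrable f_cont s_cont)+
    show "integrable lborel (\<lambda>y. ?ind y *\<^sub>R B)"
      using set_integrable_const_punctured_ball[where c = B] by (simp add: set_integrable_def)
    show "AE y in lborel. (\<lambda>n. ?ind y *\<^sub>R s n (sgn y)) \<longlonglongrightarrow> ?ind y *\<^sub>R f (sgn y)"
      using lim by (intro AE_I2) (auto simp: indicator_def norm_sgn)
    show "AE y in lborel. norm (?ind y *\<^sub>R s n (sgn y)) \<le> ?ind y *\<^sub>R B" for n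
      using bound by (intro AE_I2) (auto simp: indicator_def norm_sgn)
  qed
qed

lemma sphere_integral_nonneg_eq_0D:
  fixes f :: "'a::euclidean_space \<Rightarrow> real"
  assumes f_cont: "continuous_on (sphere 0 1) f" and nonneg: "\<And>x. x \<in> sphere 0 1 \<Longrightarrow> f x \<ge> 0"
    and zero: "sphere_integral f = 0" and x_in_sphere: "x \<in> sphere 0 1"
  shows "f x = 0"
proof -
  define U where "U = {y \<in> ball 0 1 - {0}. f (sgn y) \<noteq> 0}"
  have "open ((ball 0 1 - {0}) \<inter> (\<lambda>y. f (sgn y)) -` (- {0}))"
    by (rule continuous_open_preimage[OF continuous_on_sgn_comp[OF f_cont]]) auto
  moreover have vimage_eq: "(ball 0 1 - {0}) \<inter> (\<lambda>y. f (sgn y)) -` (- {0}) = U" by (auto simp: U_def)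
  ultimately have "open U" by simp
  have "AE y in lborel. indicator (ball 0 1 - {0}) y *\<^sub>R f (sgn y) = 0"
    using zero set_integrable_sphere[OF f_cont] nonneg
    unfolding sphere_integral_def set_lebesgue_integral_def set_integrable_def
    by (subst (asm) integral_nonneg_eq_0_iff_AE) (auto simp: indicator_def norm_sgn)
  then have "AE y in lborel. y \<notin> U" by eventually_elim (auto simp: U_def indicator_eq_0_iff)
  then have "U \<in> null_sets lborel"
    using \<open>open U\<close> AE_iff_null_sets[of U lborel] by simp
  then have "negligible U" by (simp add: negligible_iff_null_sets null_sets_completionI)
  then have "U = {}" using open_not_negligible[OF \<open>open U\<close>] by blast
  moreover have "(1/2) *\<^sub>R x \<in> ball 0 1 - {0}" "sgn ((1/2) *\<^sub>R x) = x"
    using x_in_sphere by (auto simp: sgn_scaleR sgn_div_norm)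
  ultimately have "f (sgn ((1/2) *\<^sub>R x)) = 0" unfolding U_def by blast
  then show ?thesis using \<open>sgn ((1/2) *\<^sub>R x) = x\<close> by simp
qed

definition sphere_inner :: "('a::euclidean_space \<Rightarrow> complex) \<Rightarrow> ('a \<Rightarrow> complex) \<Rightarrow> complex" where
  "sphere_inner f g = sphere_integral (\<lambda>x. f x * cnj (g x))"

lemma sphere_inner_cong:
  "(\<And>x. x \<in> sphere 0 1 \<Longrightarrow> f x = f' x) \<Longrightarrow> (\<And>x. x \<in> sphere 0 1 \<Longrightarrow> g x = g' x) \<Longrightarrow>
    sphere_inner f g = sphere_inner f' g'"
  unfolding sphere_inner_def by (rule sphere_integral_cong) simp

lemma sphere_inner_zero_left: "sphere_inner (\<lambda>x. 0) g = 0"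
  and sphere_inner_zero_right: "sphere_inner f (\<lambda>x. 0) = 0"
  by (simp_all add: sphere_inner_def sphere_integral_def)

lemma sphere_inner_mult_left: "sphere_inner (\<lambda>x. c * f x) g = c * sphere_inner f g"
  by (simp add: sphere_inner_def mult.assoc sphere_integral_mult_right)

lemma sphere_inner_mult_right: "sphere_inner f (\<lambda>x. c * g x) = cnj c * sphere_inner f g"
  by (simp add: sphere_inner_def mult.left_commute sphere_integral_mult_right)

lemma sphere_inner_add_left:
  assumes "continuous_on (sphere 0 1) f" "continuous_on (sphere 0 1) g" "continuous_on (sphere 0 1) h"
  shows "sphere_inner (\<lambda>x. f x + g x) h = sphere_inner f h + sphere_inner g h"
  unfolding sphere_inner_def distrib_right by (intro sphere_integral_add continuous_intros assms)

lemma sphere_inner_add_right: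
  assumes "continuous_on (sphere 0 1) f" "continuous_on (sphere 0 1) g" "continuous_on (sphere 0 1) h"
  shows "sphere_inner f (\<lambda>x. g x + h x) = sphere_inner f g + sphere_inner f h"
  unfolding sphere_inner_def complex_cnj_add distrib_left
  by (intro sphere_integral_add continuous_intros assms)

lemma sphere_inner_diff_left:
  assumes "continuous_on (sphere 0 1) f" "continuous_on (sphere 0 1) g" "continuous_on (sphere 0 1) h"
  shows "sphere_inner (\<lambda>x. f x - g x) h = sphere_inner f h - sphere_inner g h"
  unfolding sphere_inner_def left_diff_distrib by (intro sphere_integral_diff continuous_intros assms)

lemma sphere_inner_self_eq_0D:
  fixes f :: "'a::euclidean_space \<Rightarrow> complex"
  assumes f_cont: "continuous_on (sphere 0 1) f" and zero: "sphere_inner f f = 0"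
    and x_in_sphere: "x \<in> sphere 0 1"
  shows "f x = 0"
proof -
  have "sphere_inner f f = complex_of_real (sphere_integral (\<lambda>x. (cmod (f x))\<^sup>2))"
    unfolding sphere_inner_def complex_norm_square[symmetric] sphere_integral_def
    by (rule set_integral_complex_of_real)
  then have "sphere_integral (\<lambda>x. (cmod (f x))\<^sup>2) = 0" using zero by simp
  moreover have "continuous_on (sphere 0 1) (\<lambda>x. (cmod (f x))\<^sup>2)" by (intro continuous_intros f_cont)
  ultimately have "(cmod (f x))\<^sup>2 = 0"
    by (intro sphere_integral_nonneg_eq_0D[where f = "\<lambda>x. (cmod (f x))\<^sup>2", OF _ _ _ x_in_sphere])
        simp_all
  then show ?thesis by simp
qed

lemma norm_sphere_inner_self_le:
  fixes f g :: "'a::euclidean_space \<Rightarrow> complex"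
  assumes f_cont: "continuous_on (sphere 0 1) f" and g_cont: "continuous_on (sphere 0 1) g"
    and orthogonal: "sphere_inner f g = 0"
    and bound: "\<And>x. x \<in> sphere 0 1 \<Longrightarrow> norm (f x) \<le> B"
    and close: "\<And>x. x \<in> sphere 0 1 \<Longrightarrow> norm (f x - g x) \<le> e"
  shows "norm (sphere_inner f f) \<le> B * e * measure lborel (ball (0::'a) 1 - {0})"
proof -
  have "sphere_inner f f = sphere_inner f f - sphere_inner f g" using orthogonal by simp
  also have "\<dots> = sphere_integral (\<lambda>x. f x * cnj (f x - g x))"
    unfolding sphere_inner_def complex_cnj_diff right_diff_distrib
    by (intro sphere_integral_diff[symmetric] continuous_intros f_cont g_cont)
  also have "norm \<dots> \<le> B * e * measure lborel (ball (0::'a) 1 - {0})"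
  proof (rule norm_sphere_integral_le)
    show "continuous_on (sphere 0 1) (\<lambda>x. f x * cnj (f x - g x))"
      by (intro continuous_intros f_cont g_cont)
    show "norm (f x * cnj (f x - g x)) \<le> B * e" if "x \<in> sphere 0 1" for x
      unfolding norm_mult complex_mod_cnj
      using bound[OF that] close[OF that]
      by (intro mult_mono) (auto intro: order_trans[OF norm_ge_zero])
  qed
  finally show ?thesis .
qed

section \<open>Derivatives along rotation flows\<close>

lemma has_vector_derivative_shift_0:
  fixes f :: "real \<Rightarrow> 'a::real_normed_vector"
  assumes "((\<lambda>s. f (s + t)) has_vector_derivative d) (at 0)"
  shows "(f has_vector_derivative d) (at t)"
proof -
  have "((\<lambda>u. u - t) has_vector_derivative 1) (at t)"
    by (auto intro!: derivative_eq_intros)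
  moreover have "((\<lambda>s. f (s + t)) has_vector_derivative d) (at (t - t))" using assms by simp
  ultimately have "((\<lambda>s. f (s + t)) \<circ> (\<lambda>u. u - t) has_vector_derivative 1 *\<^sub>R d) (at t)"
    by (rule vector_diff_chain_at)
  then show ?thesis by (simp add: o_def)
qed

lemma has_vector_derivative_tendsto:
  fixes f :: "real \<Rightarrow> 'a::real_normed_vector"
  assumes "(f has_vector_derivative d) (at 0)"
  shows "((\<lambda>t. (f t - f 0) /\<^sub>R t) \<longlongrightarrow> d) (at 0)"
proof -
  have "((\<lambda>t. norm (f t - f 0 - t *\<^sub>R d) / norm t) \<longlongrightarrow> 0) (at 0)"
    using assms by (simp add: has_vector_derivative_def has_derivative_at)
  moreover have "\<forall>\<^sub>F t in at 0. norm (f t - f 0 - t *\<^sub>R d) / norm t = norm ((f t - f 0) /\<^sub>R t - d)"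
  proof (rule eventually_at_filter[THEN iffD2], intro always_eventually allI impI)
    fix t :: real assume "t \<noteq> 0"
    then have "(f t - f 0) /\<^sub>R t - d = (f t - f 0 - t *\<^sub>R d) /\<^sub>R t"
      by (simp add: scaleR_diff_right)
    then show "norm (f t - f 0 - t *\<^sub>R d) / norm t = norm ((f t - f 0) /\<^sub>R t - d)"
      by (simp add: divide_inverse mult.commute)
  qed
  ultimately have "((\<lambda>t. norm ((f t - f 0) /\<^sub>R t - d)) \<longlongrightarrow> 0) (at 0)"
    by (rule Lim_transform_eventually)
  then show ?thesis by (simp add: tendsto_norm_zero_iff LIM_zero_iff)
qed

definition complex_structure :: "('a::real_inner \<Rightarrow> 'a) \<Rightarrow> bool" where
  "complex_structure J \<longleftrightarrow> orthogonal_transformation J \<and> (\<forall>x. J (J x) = - x)"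

definition flow :: "('a::real_vector \<Rightarrow> 'a) \<Rightarrow> real \<Rightarrow> 'a \<Rightarrow> 'a" where
  "flow J t x = cos t *\<^sub>R x + sin t *\<^sub>R J x"

lemma flow_0 [simp]: "flow J 0 x = x"
  by (simp add: flow_def)

lemma flow_has_vector_derivative: "((\<lambda>t. flow J t x) has_vector_derivative J x) (at 0)"
  for x :: "'a::real_normed_vector"
  unfolding flow_def by (auto intro!: derivative_eq_intros)

context
  fixes J :: "'a::real_inner \<Rightarrow> 'a"
  assumes J_structure: "complex_structure J"
begin

lemma linear_complex_structure: "linear J"
  using J_structure by (simp add: complex_structure_def orthogonal_transformation_linear)

lemma complex_structure_twice: "J (J x) = - x"
  using J_structure by (simp add: complex_structure_def)

lemma inner_complex_structure_self: "x \<bullet> J x = 0"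
proof -
  have "J x \<bullet> J (J x) = x \<bullet> J x"
    using J_structure unfolding complex_structure_def orthogonal_transformation_def by blast
  then show ?thesis by (simp add: complex_structure_twice inner_commute)
qed

lemma norm_flow [simp]: "norm (flow J t x) = norm x"
proof -
  have "J x \<bullet> J x = x \<bullet> x"
    using J_structure by (simp add: complex_structure_def orthogonal_transformation_def)
  then have "flow J t x \<bullet> flow J t x = (cos t)\<^sup>2 * (x \<bullet> x) + (sin t)\<^sup>2 * (x \<bullet> x)"
    using inner_complex_structure_self[of x]
    by (simp add: flow_def inner_add inner_commute[of "J x" x] power2_eq_square)
  then have "flow J t x \<bullet> flow J t x = x \<bullet> x" by (simp flip: distrib_right)
  then show ?thesis by (simp add: norm_eq_sqrt_inner)
qed

lemma linear_flow: "linear (flow J t)"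
  unfolding flow_def
  by (intro linear_compose_add linear_compose_scale_right linear_complex_structure linear_ident)

lemma orthogonal_flow: "orthogonal_transformation (flow J t)"
  by (simp add: orthogonal_transformation linear_flow)

lemma flow_add: "flow J (s + t) x = flow J s (flow J t x)"
  by (simp add: flow_def linear_add linear_scale linear_complex_structure complex_structure_twice
      cos_add sin_add algebra_simps)

end

definition has_flow_derivative ::
  "('a::real_inner \<Rightarrow> 'a) \<Rightarrow> ('a \<Rightarrow> 'b::real_normed_vector) \<Rightarrow> ('a \<Rightarrow> 'b) \<Rightarrow> bool" where
  "has_flow_derivative J F F' \<longleftrightarrow>
    (\<forall>x\<in>sphere 0 1. ((\<lambda>t. F (flow J t x)) has_vector_derivative F' x) (at 0))"

lemma has_flow_derivative_at:
  assumes J_structure: "complex_structure J" and F_derivative: "has_flow_derivative J F F'"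
    and x_in_sphere: "x \<in> sphere 0 1"
  shows "((\<lambda>t. F (flow J t x)) has_vector_derivative F' (flow J t x)) (at t)"
proof (rule has_vector_derivative_shift_0)
  have "((\<lambda>s. F (flow J s (flow J t x))) has_vector_derivative F' (flow J t x)) (at 0)"
    using F_derivative x_in_sphere by (simp add: has_flow_derivative_def J_structure)
  then show "((\<lambda>s. F (flow J (s + t) x)) has_vector_derivative F' (flow J t x)) (at 0)"
    by (simp add: flow_add J_structure)
qed

lemma has_flow_derivative_unique:
  assumes J_structure: "complex_structure J" and F_derivative: "has_flow_derivative J F F'"
    and G_derivative: "has_flow_derivative J G G'"
    and agree: "\<And>x. x \<in> sphere 0 1 \<Longrightarrow> F x = G x" and x_in_sphere: "x \<in> sphere 0 1"
  shows "F' x = G' x"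
proof -
  have "((\<lambda>t. F (flow J t x)) has_vector_derivative F' x) (at 0)"
    using F_derivative x_in_sphere by (simp add: has_flow_derivative_def)
  moreover have "((\<lambda>t. F (flow J t x)) has_vector_derivative G' x) (at 0)"
    using G_derivative x_in_sphere by (simp add: has_flow_derivative_def agree J_structure)
  ultimately show ?thesis by (rule vector_derivative_unique_at)
qed

lemma has_flow_derivative_cong:
  assumes "complex_structure J" "has_flow_derivative J F F'"
    and "\<And>x. x \<in> sphere 0 1 \<Longrightarrow> F x = G x"
  shows "has_flow_derivative J G F'"
  using assms by (simp add: has_flow_derivative_def)

lemma has_derivative_imp_has_flow_derivative:
  assumes "\<And>x. (F has_derivative F' x) (at x)"
  shows "has_flow_derivative J F (\<lambda>x. F' x (J x))"
  unfolding has_flow_derivative_def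
proof
  fix x :: 'a
  have "(F has_derivative F' x) (at (flow J 0 x) within range (\<lambda>t. flow J t x))"
    using assms by (simp add: has_derivative_at_withinI)
  from vector_derivative_diff_chain_within[OF flow_has_vector_derivative this]
  show "((\<lambda>t. F (flow J t x)) has_vector_derivative F' x (J x)) (at 0)" by (simp add: o_def)
qed

lemma has_flow_derivative_mult_right:
  "has_flow_derivative J F F' \<Longrightarrow> has_flow_derivative J (\<lambda>x. c * F x) (\<lambda>x. c * F' x)"
  for c :: "'a::real_normed_algebra"
  by (simp add: has_flow_derivative_def has_vector_derivative_mult_right)

lemma has_flow_derivative_add:
  "has_flow_derivative J F F' \<Longrightarrow> has_flow_derivative J G G' \<Longrightarrow>
    has_flow_derivative J (\<lambda>x. F x + G x) (\<lambda>x. F' x + G' x)"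
  by (simp add: has_flow_derivative_def has_vector_derivative_add)

lemma has_flow_derivative_cnj:
  "has_flow_derivative J F F' \<Longrightarrow> has_flow_derivative J (\<lambda>x. cnj (F x)) (\<lambda>x. cnj (F' x))"
  by (simp add: has_flow_derivative_def has_vector_derivative_cnj)

lemma has_flow_derivative_mult:
  fixes F G :: "'a::real_inner \<Rightarrow> 'b::real_normed_algebra"
  assumes "has_flow_derivative J F F'" "has_flow_derivative J G G'"
  shows "has_flow_derivative J (\<lambda>x. F x * G x) (\<lambda>x. F x * G' x + F' x * G x)"
  unfolding has_flow_derivative_def
proof
  fix x :: 'a assume "x \<in> sphere 0 1"
  then have "((\<lambda>t. F (flow J t x)) has_vector_derivative F' x) (at 0)"
    "((\<lambda>t. G (flow J t x)) has_vector_derivative G' x) (at 0)"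
    using assms by (auto simp: has_flow_derivative_def)
  from has_vector_derivative_mult[OF this]
  show "((\<lambda>t. F (flow J t x) * G (flow J t x)) has_vector_derivative F x * G' x + F' x * G x) (at 0)"
    by simp
qed

lemma norm_flow_increment_le:
  assumes J_structure: "complex_structure J" and F_derivative: "has_flow_derivative J F F'"
    and bound: "\<And>x. x \<in> sphere 0 1 \<Longrightarrow> norm (F' x) \<le> B" and x_in_sphere: "x \<in> sphere 0 1"
  shows "norm (F (flow J t x) - F x) \<le> B * \<bar>t\<bar>"
proof -
  have "norm (F (flow J t x) - F (flow J 0 x)) \<le> B * norm (t - 0)"
  proof (rule differentiable_bound[where S = UNIV])
    show "((\<lambda>s. F (flow J s x)) has_derivative (\<lambda>h. h *\<^sub>R F' (flow J s x))) (at s)" for s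
      using has_flow_derivative_at[OF J_structure F_derivative x_in_sphere]
      by (simp add: has_vector_derivative_def)
    have "norm (F' (flow J s x)) \<le> B" for s using bound[of "flow J s x"] x_in_sphere
      by (simp add: J_structure)
    then show "onorm (\<lambda>h. h *\<^sub>R F' (flow J s x)) \<le> B" for s
      by (intro onorm_le) (simp add: mult.commute[of B] mult_left_mono)
  qed auto
  then show ?thesis by simp
qed

text \<open>The difference quotients of \<open>F\<close> along the flow have vanishing integral by rotation invariance.\<close>

lemma sphere_integral_flow_derivative:
  fixes F :: "'a::euclidean_space \<Rightarrow> 'b::{banach, second_countable_topology}"
  assumes J_structure: "complex_structure J" and F_derivative: "has_flow_derivative J F F'"
    and F_cont: "continuous_on (sphere 0 1) F" and F_cont': "continuous_on (sphere 0 1) F'"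
  shows "sphere_integral F' = 0"
proof -
  define h where "h n = inverse (real (Suc n))" for n
  define quotient where "quotient n x = (F (flow J (h n) x) - F x) /\<^sub>R h n" for n x
  have h_null_seq: "h n > 0" "h \<longlonglongrightarrow> 0" for n
    using LIMSEQ_inverse_real_of_nat by (simp_all add: h_def[abs_def])
  have cont_flow: "continuous_on (sphere 0 1) (\<lambda>x. F (flow J t x))" for t
    using linear_flow[OF J_structure] J_structure
    by (intro continuous_on_compose2[OF F_cont] linear_continuous_on)
        (auto simp: linear_conv_bounded_linear)
  have cont_quotient: "continuous_on (sphere 0 1) (quotient n)" for n
    unfolding quotient_def by (intro continuous_intros cont_flow F_cont)
  obtain B where bound: "\<And>x. x \<in> sphere 0 1 \<Longrightarrow> norm (F' x) \<le> B"
    using sphere_bound[OF F_cont'] by blast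
  have "(\<lambda>n. sphere_integral (quotient n)) \<longlonglongrightarrow> sphere_integral F'"
  proof (rule sphere_integral_dominated_convergence[OF F_cont' cont_quotient])
    fix x :: 'a assume x_in_sphere: "x \<in> sphere 0 1"
    have "((\<lambda>t. (F (flow J t x) - F (flow J 0 x)) /\<^sub>R t) \<longlongrightarrow> F' x) (at 0)"
      using F_derivative x_in_sphere
      by (intro has_vector_derivative_tendsto) (simp add: has_flow_derivative_def)
    moreover have "filterlim h (at 0) sequentially"
      by (simp add: filterlim_at h_null_seq(2) less_imp_neq[OF h_null_seq(1), symmetric])
    ultimately show "(\<lambda>n. quotient n x) \<longlonglongrightarrow> F' x"
      unfolding quotient_def flow_0 by (rule filterlim_compose)
    show "norm (quotient n x) \<le> B" for n
      using norm_flow_increment_le[OF J_structure F_derivative bound x_in_sphere, of "h n"]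
          h_null_seq(1)[of n]
      by (simp add: quotient_def pos_divide_le_eq flip: divide_inverse_commute)
  qed
  moreover have "sphere_integral (quotient n) = 0" for n
  proof -
    have "sphere_integral (quotient n)
        = inverse (h n) *\<^sub>R sphere_integral (\<lambda>x. F (flow J (h n) x) - F x)"
      unfolding quotient_def sphere_integral_def by (rule set_integral_scaleR_right)
    also have "\<dots> = 0"
      by (simp add: sphere_integral_diff cont_flow F_cont
           sphere_integral_orthogonal[OF orthogonal_flow[OF J_structure]])
    finally show ?thesis .
  qed
  ultimately show ?thesis by (simp add: LIMSEQ_const_iff)
qed

lemma sphere_inner_flow_derivative:
  fixes F G :: "'a::euclidean_space \<Rightarrow> complex"
  assumes J_structure: "complex_structure J" and F_derivative: "has_flow_derivative J F F'"
    and G_derivative: "has_flow_derivative J G G'"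
    and cont: "continuous_on (sphere 0 1) F" "continuous_on (sphere 0 1) F'"
      "continuous_on (sphere 0 1) G" "continuous_on (sphere 0 1) G'"
  shows "sphere_inner F' G = - sphere_inner F G'"
proof -
  have "0 = sphere_integral (\<lambda>x. F x * cnj (G' x) + F' x * cnj (G x))"
    by (rule sphere_integral_flow_derivative[OF J_structure
          has_flow_derivative_mult[OF F_derivative has_flow_derivative_cnj[OF G_derivative]],
              symmetric])
       (intro continuous_intros cont)+
  also have "\<dots> = sphere_inner F G' + sphere_inner F' G"
    unfolding sphere_inner_def by (intro sphere_integral_add continuous_intros cont)
  finally show ?thesis by (simp add: eq_neg_iff_add_eq_0 add.commute)
qed

lemma sphere_inner_second_flow_derivative:
  fixes F G :: "'a::euclidean_space \<Rightarrow> complex"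
  assumes J_structure: "complex_structure J"
    and F_derivatives: "has_flow_derivative J F F'" "has_flow_derivative J F' F''"
    and G_derivatives: "has_flow_derivative J G G'" "has_flow_derivative J G' G''"

    and cont: "continuous_on (sphere 0 1) F" "continuous_on (sphere 0 1) F'"
        "continuous_on (sphere 0 1) F''"
      "continuous_on (sphere 0 1) G" "continuous_on (sphere 0 1) G'" "continuous_on (sphere 0 1) G''"
  shows "sphere_inner F'' G = sphere_inner F G''"
  using sphere_inner_flow_derivative[OF J_structure F_derivatives(2) G_derivatives(1)]
      sphere_inner_flow_derivative[OF J_structure F_derivatives(1) G_derivatives(2)] cont
  by simp

section \<open>Continuous partial derivatives\<close>

lemma has_derivative_pair_of_partials:
  fixes f :: "'a::real_normed_vector \<Rightarrow> real \<Rightarrow> 'b::real_normed_vector"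
  assumes open_W: "open W" "(a, t) \<in> W"
    and fst: "((\<lambda>u. f u t) has_derivative f') (at a)"
    and snd: "\<And>u s. (u, s) \<in> W \<Longrightarrow> (f u has_vector_derivative g u s) (at s)"
    and cont: "continuous_on W (\<lambda>(u, s). g u s)"
  shows "((\<lambda>(u, s). f u s) has_derivative (\<lambda>(du, ds). f' du + ds *\<^sub>R g a t)) (at (a, t))"
proof -
  obtain X S where open_X_S: "open X" "a \<in> X" "open S" "t \<in> S" and "X \<times> S \<subseteq> W"
    using open_W by (rule open_prod_elim) auto
  moreover obtain e where ball_subset: "e > 0" "ball t e \<subseteq> S"
    using open_X_S(3,4) open_contains_ball by blast
  ultimately have subset: "X \<times> ball t e \<subseteq> W" by blast
  have "((\<lambda>(u, s). f u s) has_derivative (\<lambda>(du, ds). f' du + blinfun_scaleR_left (g a t) ds))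
      (at (a, t) within X \<times> ball t e)"
  proof (rule has_derivative_partialsI)
    show "((\<lambda>u. f u t) has_derivative f') (at a within X)"
      by (rule has_derivative_at_withinI[OF fst])
    show "(f u has_derivative blinfun_scaleR_left (g u s)) (at s within ball t e)"
      if "u \<in> X" "s \<in> ball t e" for u s
    proof -
      have "(u, s) \<in> W" using that subset by blast
      then show ?thesis
        using snd unfolding has_vector_derivative_def blinfun_scaleR_left.rep_eq
        by (blast intro: has_derivative_at_withinI)
    qed
    have "continuous_on (X \<times> ball t e) (\<lambda>p. blinfun_scaleR_left (case p of (u, s) \<Rightarrow> g u s))"
      by (intro bounded_linear.continuous_on[OF bounded_linear_blinfun_scaleR_left]
          continuous_on_subset[OF cont subset])
    then show "continuous (at (a, t) within X \<times> ball t e) (\<lambda>(u, s). blinfun_scaleR_left (g u s))"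
      using open_X_S ball_subset by (simp add: continuous_on_eq_continuous_within case_prod_beta')
  qed (use ball_subset in auto)
  then show ?thesis using open_X_S ball_subset by (simp add: at_within_open[OF _ open_Times])
qed

lemma has_derivative_of_partials_along:
  fixes f :: "'a::euclidean_space \<Rightarrow> 'b::real_normed_vector"
  assumes open_U: "open U" "x \<in> U"
    and partial: "\<And>b y. b \<in> Basis \<Longrightarrow> y \<in> U \<Longrightarrow>
      ((\<lambda>t. f (y + t *\<^sub>R b)) has_vector_derivative g b y) (at 0)"
    and cont: "\<And>b. b \<in> Basis \<Longrightarrow> continuous_on U (g b)"
    and B_subset: "finite B" "B \<subseteq> Basis"
  shows "((\<lambda>h. f (x + (\<Sum>b\<in>B. (h \<bullet> b) *\<^sub>R b))) has_derivative (\<lambda>h. \<Sum>b\<in>B. (h \<bullet> b) *\<^sub>R g b x)) (at 0)"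
  using B_subset
proof (induction B rule: finite_induct)
  case empty
  show ?case by simp
next
  case (insert b B)
  define point where "point u s = x + (\<Sum>c\<in>B. (u \<bullet> c) *\<^sub>R c) + s *\<^sub>R b" for u s
  let ?W = "(\<lambda>(u, s). point u s) -` U"
  have point_cont: "continuous_on A (\<lambda>(u, s). point u s)" for A
    unfolding point_def case_prod_beta' by (intro continuous_intros)
  have b_in_Basis: "b \<in> Basis" using insert.prems by simp
  have "((\<lambda>(u, s). f (point u s)) has_derivative
      (\<lambda>(du, ds). (\<Sum>c\<in>B. (du \<bullet> c) *\<^sub>R g c x) + ds *\<^sub>R g b (point 0 0))) (at (0, 0))"
  proof (rule has_derivative_pair_of_partials)
    show "open ?W" by (rule open_vimage[OF open_U(1) point_cont])
    show "(0, 0) \<in> ?W" using open_U(2) by (simp add: point_def)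
    show "((\<lambda>u. f (point u 0)) has_derivative (\<lambda>du. \<Sum>c\<in>B. (du \<bullet> c) *\<^sub>R g c x)) (at 0)"
      using insert.IH insert.prems by (simp add: point_def)
    show "((\<lambda>s. f (point u s)) has_vector_derivative g b (point u s)) (at s)" if "(u, s) \<in> ?W" for u s
    proof (rule has_vector_derivative_shift_0)
      have "((\<lambda>t. f (point u s + t *\<^sub>R b)) has_vector_derivative g b (point u s)) (at 0)"
        using partial[OF b_in_Basis] that by simp
      moreover have "point u s + t *\<^sub>R b = point u (t + s)" for t
        by (simp add: point_def algebra_simps)
      ultimately show "((\<lambda>t. f (point u (t + s))) has_vector_derivative g b (point u s)) (at 0)"
        by simp
    qed
    have "continuous_on ?W (\<lambda>p. g b (case p of (u, s) \<Rightarrow> point u s))"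
      by (rule continuous_on_compose2[OF cont[OF b_in_Basis] point_cont]) auto
    then show "continuous_on ?W (\<lambda>(u, s). g b (point u s))" by (simp add: case_prod_beta')
  qed
  then have pair: "((\<lambda>(u, s). f (point u s)) has_derivative
      (\<lambda>(du, ds). (\<Sum>c\<in>B. (du \<bullet> c) *\<^sub>R g c x) + ds *\<^sub>R g b x)) (at (0, 0))"
    by (simp add: point_def)
  have "((\<lambda>h. (h, h \<bullet> b)) has_derivative (\<lambda>h. (h, h \<bullet> b))) (at 0)"
    by (auto intro!: derivative_eq_intros)
  from has_derivative_compose[OF this] pair
  have "((\<lambda>h. f (point h (h \<bullet> b))) has_derivative
      (\<lambda>h. (\<Sum>c\<in>B. (h \<bullet> c) *\<^sub>R g c x) + (h \<bullet> b) *\<^sub>R g b x)) (at 0)"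
    by fastforce
  then show ?case using insert.hyps by (simp add: point_def algebra_simps)
qed

lemma has_derivative_of_partials:
  fixes f :: "'a::euclidean_space \<Rightarrow> 'b::real_normed_vector"
  assumes "open U" "x \<in> U"
    and "\<And>b y. b \<in> Basis \<Longrightarrow> y \<in> U \<Longrightarrow>
      ((\<lambda>t. f (y + t *\<^sub>R b)) has_vector_derivative g b y) (at 0)"
    and "\<And>b. b \<in> Basis \<Longrightarrow> continuous_on U (g b)"
  shows "(f has_derivative (\<lambda>h. \<Sum>b\<in>Basis. (h \<bullet> b) *\<^sub>R g b x)) (at x)"
proof -
  have "((\<lambda>h. f (x + h)) has_derivative (\<lambda>h. \<Sum>b\<in>Basis. (h \<bullet> b) *\<^sub>R g b x)) (at 0)"
    using has_derivative_of_partials_along[OF assms finite_Basis subset_refl]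
    by (simp add: euclidean_representation)
  then have "((\<lambda>h. f (x + h)) has_derivative (\<lambda>h. \<Sum>b\<in>Basis. (h \<bullet> b) *\<^sub>R g b x)) (at (- x + x))"
    by simp
  moreover have "((\<lambda>y. - x + y) has_derivative (\<lambda>h. h)) (at x)"
    by (auto intro!: derivative_eq_intros)
  ultimately have "((\<lambda>y. f (x + (- x + y))) has_derivative (\<lambda>h. \<Sum>b\<in>Basis. (h \<bullet> b) *\<^sub>R g b x)) (at x)"
    by (rule has_derivative_compose[rotated])
  then show ?thesis by simp
qed

section \<open>Functions on the three-sphere\<close>

interpretation fs: vector_space fscale
  by unfold_locales (auto simp: fscale_def fun_eq_iff algebra_simps)

lemma subspace_funI:
  assumes "(\<lambda>x. 0) \<in> V" "\<And>c f g. f \<in> V \<Longrightarrow> g \<in> V \<Longrightarrow> (\<lambda>x. c * f x + g x) \<in> V"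
  shows "fs.subspace V"
proof (rule fs.subspaceI)
  show "0 \<in> V" using assms(1) by (simp add: zero_fun_def)
  show "f + g \<in> V" if "f \<in> V" "g \<in> V" for f g
    using assms(2)[OF that, of 1] by (simp add: plus_fun_def)
  show "fscale c f \<in> V" if "f \<in> V" for c f
    using assms(2)[OF that assms(1), of c] by (simp add: fscale_def)
qed

lemma subspace_funD:
  assumes "fs.subspace V"
  shows "(\<lambda>x. 0) \<in> V" and "f \<in> V \<Longrightarrow> (\<lambda>x. c * f x) \<in> V"
    and "f \<in> V \<Longrightarrow> g \<in> V \<Longrightarrow> (\<lambda>x. f x + g x) \<in> V"
    and "f \<in> V \<Longrightarrow> g \<in> V \<Longrightarrow> (\<lambda>x. f x - g x) \<in> V"
  using fs.subspace_0[OF assms] fs.subspace_scale[OF assms, of f c] fs.subspace_add[OF assms, of f g]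
    fs.subspace_diff[OF assms, of f g]
  by (simp_all add: zero_fun_def fscale_def plus_fun_def fun_diff_def)

lemma subspace_fun_sum:
  assumes "fs.subspace V" "\<And>s. s \<in> S \<Longrightarrow> f s \<in> V"
  shows "(\<lambda>x. \<Sum>s\<in>S. f s x) \<in> V"
  using assms(2)
  by (induction S rule: infinite_finite_induct) (auto intro: subspace_funD[OF assms(1)])

lemma span_fun_induct [consumes 1, case_names zero step]:
  assumes f_in_span: "f \<in> fs.span B" and zero: "P (\<lambda>x. 0)"
    and step: "\<And>c g f. g \<in> B \<Longrightarrow> f \<in> fs.span B \<Longrightarrow> P f \<Longrightarrow> P (\<lambda>x. c * g x + f x)"
  shows "P f"
proof -
  have "f \<in> fs.span B \<and> P f"
    using f_in_span
  proof (induction rule: fs.span_induct_alt)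
    case base
    show ?case using zero fs.span_zero[of B] by (simp add: zero_fun_def)
  next
    case (step c g f)
    then have "fscale c g + f \<in> fs.span B" by (simp only: fs.span_add fs.span_scale fs.span_base)
    moreover have "fscale c g + f = (\<lambda>x. c * g x + f x)" by (simp add: fun_eq_iff fscale_def)
    ultimately show ?case using step assms(3)[of g f c] by simp
  qed
  then show ?thesis by blast
qed

lemma sum_fscale: "(\<Sum>a\<in>A. fscale (c a) (g a)) = (\<lambda>x. \<Sum>a\<in>A. c a * g a x)"
  by (induction A rule: infinite_finite_induct) (auto simp: fscale_def)

lemma pt_nth [simp]: "pt a b $ 1 = a" "pt a b $ 2 = b"
  by (simp_all add: pt_def)

lemma vec2_eq_iff: "x = y \<longleftrightarrow> x$1 = y$1 \<and> x$2 = y$2" for x y :: "'a^2"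
  by (simp add: vec_eq_iff forall_2)

lemma inner_complex_vec2: "x \<bullet> y = x$1 \<bullet> y$1 + x$2 \<bullet> y$2" for x y :: "complex^2"
  by (simp add: inner_vec_def sum_2)

lemma S3_eq_sphere: "S3 = sphere 0 1"
  by (auto simp: S3_def)

lemma S3_nonzero: "x \<in> S3 \<Longrightarrow> x \<noteq> 0"
  by (auto simp: S3_def)

lemma S3_sum_squares:
  assumes "x \<in> S3"
  shows "x$1 * cnj (x$1) + x$2 * cnj (x$2) = 1"
proof -
  have "x \<bullet> x = 1" using assms by (simp add: S3_def norm_eq_1)
  then have "complex_of_real ((cmod (x$1))\<^sup>2 + (cmod (x$2))\<^sup>2) = 1"
    by (simp add: inner_complex_vec2 power2_norm_eq_inner)
  then show ?thesis by (simp only: of_real_add complex_norm_square)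
qed

lemma coord_dirs_eq_Basis: "coord_dirs = Basis"
proof -
  have "axis 1 u = pt u 0" "axis 2 u = pt 0 u" for u :: complex
    by (simp_all add: vec2_eq_iff axis_def)
  then show ?thesis
    unfolding coord_dirs_def Basis_vec_def ex_def ey_def ez_def ew_def
    by (auto simp: UNIV_2 Basis_complex_def)
qed

lemma sum_Basis_complex2: "(\<Sum>b\<in>(Basis :: (complex^2) set). f b) = f ex + f ey + f ez + f ew"
proof -
  have "distinct [ex, ey, ez, ew]"
    by (simp add: ex_def ey_def ez_def ew_def vec2_eq_iff complex_eq_iff)
  then show ?thesis
    unfolding coord_dirs_eq_Basis[symmetric] coord_dirs_def by (simp add: add.assoc)
qed

lemma inner_coord_dirs:
  "x \<bullet> ex = Re (x$1)" "x \<bullet> ey = Im (x$1)" "x \<bullet> ez = Re (x$2)" "x \<bullet> ew = Im (x$2)"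
  by (simp_all add: ex_def ey_def ez_def ew_def inner_complex_vec2 inner_complex_def)

lemma linear_complex2_expand:
  fixes f :: "complex^2 \<Rightarrow> 'a::real_vector"
  assumes "linear f"
  shows "f x = Re (x$1) *\<^sub>R f ex + Im (x$1) *\<^sub>R f ey + Re (x$2) *\<^sub>R f ez + Im (x$2) *\<^sub>R f ew"
proof -
  have "f x = f (\<Sum>b\<in>Basis. (x \<bullet> b) *\<^sub>R b)" by (simp add: euclidean_representation)
  then show ?thesis
    using assms by (simp add: sum_Basis_complex2 inner_coord_dirs linear_add linear_scale)
qed

lemma pd_eqI: "((\<lambda>t. G (p + t *\<^sub>R v)) has_vector_derivative d) (at 0) \<Longrightarrow> pd v G p = d"
  unfolding pd_def by (rule vector_derivative_at)

lemma has_vector_derivative_line_cong: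
  fixes f g :: "'a::real_normed_vector \<Rightarrow> 'b::real_normed_vector"
  assumes "((\<lambda>t. f (p + t *\<^sub>R v)) has_vector_derivative d) (at 0)" "open U" "p \<in> U"
    and "\<And>x. x \<in> U \<Longrightarrow> f x = g x"
  shows "((\<lambda>t. g (p + t *\<^sub>R v)) has_vector_derivative d) (at 0)"
proof (rule has_vector_derivative_transform_within_open[OF assms(1)])
  show "open ((\<lambda>t. p + t *\<^sub>R v) -` U)"
    by (intro open_vimage assms continuous_intros)
qed (use assms in auto)

lemma C2_onI:
  assumes open_U: "open U"
    and derivative: "\<And>v p. v \<in> coord_dirs \<Longrightarrow> p \<in> U \<Longrightarrow>
      ((\<lambda>t. G (p + t *\<^sub>R v)) has_vector_derivative G' v p) (at 0)"
    and second_derivative: "\<And>u v p. u \<in> coord_dirs \<Longrightarrow> v \<in> coord_dirs \<Longrightarrow> p \<in> U \<Longrightarrow>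
      ((\<lambda>t. G' v (p + t *\<^sub>R u)) has_vector_derivative G'' u v p) (at 0)"
    and cont: "\<And>u v. u \<in> coord_dirs \<Longrightarrow> v \<in> coord_dirs \<Longrightarrow> continuous_on U (G'' u v)"
  shows "C2_on U G"
    and "u \<in> coord_dirs \<Longrightarrow> v \<in> coord_dirs \<Longrightarrow> p \<in> U \<Longrightarrow> pd u (pd v G) p = G'' u v p"
proof -
  have partial: "G' v p = pd v G p" if "v \<in> coord_dirs" "p \<in> U" for v p
    using pd_eqI[OF derivative[OF that]] by simp
  have pd_derivative: "((\<lambda>t. pd v G (p + t *\<^sub>R u)) has_vector_derivative G'' u v p) (at 0)"
    if "u \<in> coord_dirs" "v \<in> coord_dirs" "p \<in> U" for u v p
    by (rule has_vector_derivative_line_cong[OF second_derivative[OF that] open_U that(3) partial[OF that(2)]])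
  have pd_pd_eq: "G'' u v p = pd u (pd v G) p" if "u \<in> coord_dirs" "v \<in> coord_dirs" "p \<in> U" for u v p
    using pd_eqI[OF pd_derivative[OF that]] by simp
  show "C2_on U G"
    unfolding C2_on_def
  proof (intro conjI ballI)
    fix u v assume "u \<in> coord_dirs" "v \<in> coord_dirs"
    then show "continuous_on U (pd u (pd v G))"
      using cont[of u v] pd_pd_eq[of u v] by (auto intro: continuous_on_eq)
  qed (use derivative partial pd_derivative pd_pd_eq in force)+
  show "u \<in> coord_dirs \<Longrightarrow> v \<in> coord_dirs \<Longrightarrow> p \<in> U \<Longrightarrow> pd u (pd v G) p = G'' u v p"
    using pd_pd_eq by simp
qed

lemma C2_onD:
  assumes "C2_on U G" "v \<in> coord_dirs"
  shows "p \<in> U \<Longrightarrow> ((\<lambda>t. G (p + t *\<^sub>R v)) has_vector_derivative pd v G p) (at 0)"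
    and "u \<in> coord_dirs \<Longrightarrow> p \<in> U \<Longrightarrow>
      ((\<lambda>t. pd v G (p + t *\<^sub>R u)) has_vector_derivative pd u (pd v G) p) (at 0)"
    and "u \<in> coord_dirs \<Longrightarrow> continuous_on U (pd u (pd v G))"
  using assms by (auto simp: C2_on_def)

lemma C2_on_cong:
  assumes open_U: "open U" and F_C2: "C2_on U F" and agree: "\<And>x. x \<in> U \<Longrightarrow> F x = G x"
  shows "C2_on U G"
  using has_vector_derivative_line_cong[OF C2_onD(1)[OF F_C2] open_U _ agree] C2_onD(2,3)[OF F_C2]
  by (intro C2_onI(1)[OF open_U, of G "\<lambda>v. pd v F" "\<lambda>u v. pd u (pd v F)"])

lemma C2_on_linear_combination:
  assumes open_U: "open U" and F_C2: "C2_on U F" and G_C2: "C2_on U G"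
  shows "C2_on U (\<lambda>x. a * F x + G x)"
    and "p \<in> U \<Longrightarrow> lap4 (\<lambda>x. a * F x + G x) p = a * lap4 F p + lap4 G p"
proof -
  have derivative: "((\<lambda>t. a * F (p + t *\<^sub>R v) + G (p + t *\<^sub>R v))
      has_vector_derivative a * pd v F p + pd v G p) (at 0)"
    if "v \<in> coord_dirs" "p \<in> U" for v p
    by (intro has_vector_derivative_add has_vector_derivative_mult_right C2_onD(1)[OF F_C2]
         C2_onD(1)[OF G_C2] that)
  have second_derivative: "((\<lambda>t. a * pd v F (p + t *\<^sub>R u) + pd v G (p + t *\<^sub>R u)) has_vector_derivative
      a * pd u (pd v F) p + pd u (pd v G) p) (at 0)"
    if "u \<in> coord_dirs" "v \<in> coord_dirs" "p \<in> U" for u v p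
    by (intro has_vector_derivative_add has_vector_derivative_mult_right C2_onD(2)[OF F_C2]
         C2_onD(2)[OF G_C2] that)
  have cont: "continuous_on U (\<lambda>p. a * pd u (pd v F) p + pd u (pd v G) p)"
    if "u \<in> coord_dirs" "v \<in> coord_dirs" for u v
    by (intro continuous_intros C2_onD(3)[OF F_C2] C2_onD(3)[OF G_C2] that)
  show "C2_on U (\<lambda>x. a * F x + G x)"
    by (rule C2_onI(1)[OF open_U derivative second_derivative cont])
  show "lap4 (\<lambda>x. a * F x + G x) p = a * lap4 F p + lap4 G p" if "p \<in> U"
    using C2_onI(2)[OF open_U derivative second_derivative cont _ _ that]
    by (simp add: lap4_def sum.distrib sum_distrib_left)
qed

definition gradient_form :: "(complex^2 \<Rightarrow> complex) \<Rightarrow> complex^2 \<Rightarrow> complex^2 \<Rightarrow> complex" where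
  "gradient_form G x v = (\<Sum>b\<in>Basis. (v \<bullet> b) *\<^sub>R pd b G x)"

definition hessian_form :: "(complex^2 \<Rightarrow> complex) \<Rightarrow> complex^2 \<Rightarrow> complex^2 \<Rightarrow> complex" where
  "hessian_form G x v = (\<Sum>b\<in>Basis. (v \<bullet> b) *\<^sub>R (\<Sum>u\<in>Basis. (v \<bullet> u) *\<^sub>R pd u (pd b G) x))"

context
  fixes U :: "(complex^2) set" and G :: "complex^2 \<Rightarrow> complex"
  assumes open_U: "open U" and G_C2: "C2_on U G"
begin

lemma C2_on_pd_has_derivative:
  assumes "b \<in> Basis" "x \<in> U"
  shows "(pd b G has_derivative (\<lambda>h. \<Sum>u\<in>Basis. (h \<bullet> u) *\<^sub>R pd u (pd b G) x)) (at x)"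
  using C2_onD(2,3)[OF G_C2] assms
  by (intro has_derivative_of_partials[OF open_U]) (auto simp: coord_dirs_eq_Basis)

lemma C2_on_continuous_pd: "b \<in> Basis \<Longrightarrow> continuous_on U (pd b G)"
  using C2_on_pd_has_derivative has_derivative_continuous
  by (blast intro: continuous_at_imp_continuous_on)

lemma C2_on_has_derivative:
  assumes "x \<in> U"
  shows "(G has_derivative gradient_form G x) (at x)"
  unfolding gradient_form_def[abs_def] using C2_onD(1)[OF G_C2] assms
  by (intro has_derivative_of_partials[OF open_U] C2_on_continuous_pd) (auto simp: coord_dirs_eq_Basis)

lemma C2_on_continuous: "continuous_on U G"
  using C2_on_has_derivative has_derivative_continuous
  by (blast intro: continuous_at_imp_continuous_on)

lemma C2_on_curve:
  assumes c_curve: "(c has_vector_derivative c') (at t)" and "c t \<in> U"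
  shows "((\<lambda>s. G (c s)) has_vector_derivative gradient_form G (c t) c') (at t)"
  using vector_derivative_diff_chain_within[OF c_curve
       has_derivative_at_withinI[OF C2_on_has_derivative[OF assms(2)]]]
  by (simp add: o_def)

lemma C2_on_gradient_curve:
  assumes linear_A: "linear A" and c_curve: "(c has_vector_derivative A (c t)) (at t)"
    and c_in_U: "c t \<in> U"
  shows "((\<lambda>s. gradient_form G (c s) (A (c s))) has_vector_derivative
    gradient_form G (c t) (A (A (c t))) + hessian_form G (c t) (A (c t))) (at t)"
proof -
  have weight: "((\<lambda>s. A (c s) \<bullet> b) has_real_derivative A (A (c t)) \<bullet> b) (at t)" for b
  proof -
    have "bounded_linear (\<lambda>x. A x \<bullet> b)"
      using linear_A by (intro bounded_linear_compose[OF bounded_linear_inner_left])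
        (simp add: linear_conv_bounded_linear)
    from bounded_linear.has_vector_derivative[OF this c_curve]
    show ?thesis by (simp add: has_real_derivative_iff_has_vector_derivative)
  qed
  have partial: "((\<lambda>s. pd b G (c s)) has_vector_derivative
      (\<Sum>u\<in>Basis. (A (c t) \<bullet> u) *\<^sub>R pd u (pd b G) (c t))) (at t)" if "b \<in> Basis" for b
    using vector_derivative_diff_chain_within[OF c_curve
         has_derivative_at_withinI[OF C2_on_pd_has_derivative[OF that c_in_U]]]
    by (simp add: o_def)
  have "((\<lambda>s. gradient_form G (c s) (A (c s))) has_vector_derivative
    (\<Sum>b\<in>Basis. (A (c t) \<bullet> b) *\<^sub>R (\<Sum>u\<in>Basis. (A (c t) \<bullet> u) *\<^sub>R pd u (pd b G) (c t)) +
       (A (A (c t)) \<bullet> b) *\<^sub>R pd b G (c t))) (at t)"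
    unfolding gradient_form_def
    by (intro has_vector_derivative_sum has_vector_derivative_scaleR weight partial)
  then show ?thesis by (simp add: sum.distrib add.commute gradient_form_def hessian_form_def)
qed

end

lemma hext_S3: "x \<in> S3 \<Longrightarrow> hext F x = F x"
  by (simp add: hext_def S3_def)

lemma hext_scaleR: "c > 0 \<Longrightarrow> hext F (c *\<^sub>R x) = hext F x"
  by (simp add: hext_def)

context
  fixes F :: "complex^2 \<Rightarrow> complex"
  assumes F_S3_fun: "S3_fun F"
begin

lemma S3_fun_C2_hext: "C2_on (- {0}) (hext F)"
  using F_S3_fun by (simp add: S3_fun_def)

lemma S3_fun_continuous: "continuous_on S3 F"
proof -
  have "continuous_on S3 (hext F)"
    using C2_on_continuous[OF _ S3_fun_C2_hext] S3_nonzero by (auto intro: continuous_on_subset)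
  then show ?thesis by (rule continuous_on_eq) (simp add: hext_S3)
qed

lemma hext_radial_derivatives:
  assumes "x \<noteq> 0"
  shows "gradient_form (hext F) x x = 0" and "hessian_form (hext F) x x = 0"
proof -
  note C2_hext = open_Compl[OF closed_singleton[of 0]] S3_fun_C2_hext
  have ray: "((\<lambda>t. exp t *\<^sub>R y) has_vector_derivative y) (at 0)" for y :: "complex^2"
    by (auto intro!: derivative_eq_intros)
  have first: "gradient_form (hext F) y y = 0" if "y \<noteq> 0" for y
    using C2_on_curve[OF C2_hext ray[of y]] that
    by (intro vector_derivative_unique_at[OF _ has_vector_derivative_const[of "hext F y"]])
       (simp add: hext_scaleR)
  show "gradient_form (hext F) x x = 0" by (rule first[OF assms])
  have "((\<lambda>t. gradient_form (hext F) (exp t *\<^sub>R x) (exp t *\<^sub>R x)) has_vector_derivative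
      gradient_form (hext F) x x + hessian_form (hext F) x x) (at 0)"
    using C2_on_gradient_curve[OF C2_hext linear_ident, of "\<lambda>t. exp t *\<^sub>R x" 0] ray[of x] assms by simp
  then have "((\<lambda>t. 0) has_vector_derivative hessian_form (hext F) x x) (at (0::real))"
    using assms by (simp add: first)
  then show "hessian_form (hext F) x x = 0"
    by (rule vector_derivative_unique_at[OF _ has_vector_derivative_const])
qed

lemma S3_fun_flow_derivative:
  assumes J_structure: "complex_structure J"
  shows "has_flow_derivative J F (\<lambda>x. gradient_form (hext F) x (J x))"
    and "has_flow_derivative J (\<lambda>x. gradient_form (hext F) x (J x)) (\<lambda>x. hessian_form (hext F) x (J x))"
    and "continuous_on S3 (\<lambda>x. gradient_form (hext F) x (J x))"
    and "continuous_on S3 (\<lambda>x. hessian_form (hext F) x (J x))"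
proof -
  note C2_hext = open_Compl[OF closed_singleton[of 0]] S3_fun_C2_hext
  show "has_flow_derivative J F (\<lambda>x. gradient_form (hext F) x (J x))"
    unfolding has_flow_derivative_def
  proof
    fix x :: "complex^2" assume x_in_sphere: "x \<in> sphere 0 1"
    then have "x \<noteq> 0" by auto
    then have "((\<lambda>t. hext F (flow J t x))
        has_vector_derivative gradient_form (hext F) x (J x)) (at 0)"
      using C2_on_curve[OF C2_hext flow_has_vector_derivative[of J x]] by simp
    then show "((\<lambda>t. F (flow J t x)) has_vector_derivative gradient_form (hext F) x (J x)) (at 0)"
      using x_in_sphere by (simp add: hext_S3 S3_eq_sphere J_structure)
  qed
  show "has_flow_derivative J (\<lambda>x. gradient_form (hext F) x (J x)) (\<lambda>x. hessian_form (hext F) x (J x))"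
    unfolding has_flow_derivative_def
  proof
    fix x :: "complex^2" assume x_in_sphere: "x \<in> sphere 0 1"
    then have "x \<noteq> 0" by auto
    then have "gradient_form (hext F) x (- x) = 0"
      using hext_radial_derivatives(1)[of x] by (simp add: gradient_form_def sum_negf)
    then show "((\<lambda>t. gradient_form (hext F) (flow J t x) (J (flow J t x))) has_vector_derivative
        hessian_form (hext F) x (J x)) (at 0)"
      using C2_on_gradient_curve[OF C2_hext linear_complex_structure[OF J_structure],
          of "\<lambda>t. flow J t x" 0]
        flow_has_vector_derivative[of J x] \<open>x \<noteq> 0\<close>
      by (simp add: complex_structure_twice[OF J_structure])
  qed
  have J_cont: "continuous_on S3 J"
    using linear_complex_structure[OF J_structure]
    by (simp add: linear_continuous_on linear_conv_bounded_linear)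
  have subset: "S3 \<subseteq> - {0}" using S3_nonzero by auto
  show "continuous_on S3 (\<lambda>x. gradient_form (hext F) x (J x))" unfolding gradient_form_def
    by (intro continuous_intros J_cont continuous_on_subset[OF C2_on_continuous_pd[OF C2_hext] subset])
  show "continuous_on S3 (\<lambda>x. hessian_form (hext F) x (J x))" unfolding hessian_form_def
    by (intro continuous_intros J_cont continuous_on_subset[OF C2_onD(3)[OF C2_hext(2)] subset])
       (simp_all add: coord_dirs_eq_Basis)
qed

end

section \<open>The Laplacian of the three-sphere\<close>

definition J_i :: "complex^2 \<Rightarrow> complex^2" where
  "J_i x = pt (\<i> * x$1) (\<i> * x$2)"

definition J_j :: "complex^2 \<Rightarrow> complex^2" where
  "J_j x = pt (- cnj (x$2)) (cnj (x$1))"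

definition J_k :: "complex^2 \<Rightarrow> complex^2" where
  "J_k x = pt (- \<i> * cnj (x$2)) (\<i> * cnj (x$1))"

lemma complex_structure_J:
  "complex_structure J_i" "complex_structure J_j" "complex_structure J_k"
  unfolding complex_structure_def orthogonal_transformation_def
  by (intro conjI linearI allI;
      simp add: J_i_def J_j_def J_k_def vec2_eq_iff inner_complex_vec2 inner_complex_def
        complex_eq_iff algebra_simps)+

lemma lapS3_eq_hessian_forms:
  assumes F_S3_fun: "S3_fun F" and x_in_S3: "x \<in> S3"
  shows "lapS3 F x = hessian_form (hext F) x (J_i x) + hessian_form (hext F) x (J_j x)
    + hessian_form (hext F) x (J_k x)"
proof -
  define H where "H u b = pd u (pd b (hext F)) x" for u b
  define r where "r = (complex_of_real (Re (x$1)))\<^sup>2 + (complex_of_real (Im (x$1)))\<^sup>2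
    + (complex_of_real (Re (x$2)))\<^sup>2 + (complex_of_real (Im (x$2)))\<^sup>2"
  have "(Re (x$1))\<^sup>2 + (Im (x$1))\<^sup>2 + (Re (x$2))\<^sup>2 + (Im (x$2))\<^sup>2 = x \<bullet> x"
    by (simp add: inner_complex_vec2 inner_complex_def power2_eq_square)
  also have "\<dots> = 1" using x_in_S3 by (simp add: S3_def norm_eq_1)
  finally have "r = 1"
    unfolding r_def of_real_power[symmetric] of_real_add[symmetric] by simp
  then have "lapS3 F x = r * (H ex ex + H ey ey + H ez ez + H ew ew)"
    by (simp add: lapS3_def lap4_def coord_dirs_eq_Basis sum_Basis_complex2 H_def)
  also have "\<dots> = hessian_form (hext F) x x + hessian_form (hext F) x (J_i x)
      + hessian_form (hext F) x (J_j x) + hessian_form (hext F) x (J_k x)"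
    unfolding hessian_form_def H_def[symmetric] r_def
    by (simp add: sum_Basis_complex2 inner_coord_dirs J_i_def J_j_def J_k_def scaleR_conv_of_real)
        algebra
  finally show ?thesis
    using hext_radial_derivatives(2)[OF F_S3_fun S3_nonzero[OF x_in_S3]] by simp
qed

lemma lapS3_eqI:
  assumes F_S3_fun: "S3_fun F" and x_in_S3: "x \<in> S3"
    and derivatives_i: "has_flow_derivative J_i F Fi" "has_flow_derivative J_i Fi Fii"
    and derivatives_j: "has_flow_derivative J_j F Fj" "has_flow_derivative J_j Fj Fjj"
    and derivatives_k: "has_flow_derivative J_k F Fk" "has_flow_derivative J_k Fk Fkk"
  shows "lapS3 F x = Fii x + Fjj x + Fkk x"
proof -
  have "hessian_form (hext F) x (J x) = F'' x"
    if J_structure: "complex_structure J"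
        and derivatives: "has_flow_derivative J F F'" "has_flow_derivative J F' F''"
    for J F' F''
    using has_flow_derivative_unique[OF J_structure
         S3_fun_flow_derivative(1)[OF F_S3_fun J_structure] derivatives(1)] x_in_S3
    by (intro has_flow_derivative_unique[OF J_structure
         S3_fun_flow_derivative(2)[OF F_S3_fun J_structure] derivatives(2)])
       (auto simp: S3_eq_sphere)
  then show ?thesis
    using lapS3_eq_hessian_forms[OF F_S3_fun x_in_S3] complex_structure_J derivatives_i
        derivatives_j derivatives_k by metis
qed

lemma sphere_inner_lapS3:
  assumes F_S3_fun: "S3_fun F" and G_S3_fun: "S3_fun G"
  shows "sphere_inner (lapS3 F) G = sphere_inner F (lapS3 G)"
proof -
  note F_cont = S3_fun_continuous[OF F_S3_fun, unfolded S3_eq_sphere]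
    and G_cont = S3_fun_continuous[OF G_S3_fun, unfolded S3_eq_sphere]
  note F_derivatives = S3_fun_flow_derivative[OF F_S3_fun, unfolded S3_eq_sphere]
    and G_derivatives = S3_fun_flow_derivative[OF G_S3_fun, unfolded S3_eq_sphere]
  note lap = lapS3_eq_hessian_forms[unfolded S3_eq_sphere]
  note J = complex_structure_J
  let ?F = "\<lambda>J x. hessian_form (hext F) x (J x)" and ?G = "\<lambda>J x. hessian_form (hext G) x (J x)"
  have swap: "sphere_inner (?F J) G = sphere_inner F (?G J)" if "complex_structure J" for J
    by (rule sphere_inner_second_flow_derivative[OF that
          F_derivatives(1,2) G_derivatives(1,2) F_cont F_derivatives(3,4) G_cont G_derivatives(3,4)])
       (rule that)+
  have "sphere_inner (lapS3 F) G = sphere_inner (\<lambda>x. ?F J_i x + ?F J_j x + ?F J_k x) G"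
    by (rule sphere_inner_cong) (simp_all add: lap[OF F_S3_fun])
  also have "\<dots> = sphere_inner (?F J_i) G + sphere_inner (?F J_j) G + sphere_inner (?F J_k) G"
    using F_derivatives(4)[OF J(1)] F_derivatives(4)[OF J(2)] F_derivatives(4)[OF J(3)] G_cont
    by (simp add: sphere_inner_add_left continuous_on_add)
  also have "\<dots> = sphere_inner F (?G J_i) + sphere_inner F (?G J_j) + sphere_inner F (?G J_k)"
    by (simp add: swap J)
  also have "\<dots> = sphere_inner F (\<lambda>x. ?G J_i x + ?G J_j x + ?G J_k x)"
    using G_derivatives(4)[OF J(1)] G_derivatives(4)[OF J(2)] G_derivatives(4)[OF J(3)] F_cont
    by (simp add: sphere_inner_add_right continuous_on_add)
  also have "\<dots> = sphere_inner F (lapS3 G)"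
    by (rule sphere_inner_cong) (simp_all add: lap[OF G_S3_fun])
  finally show ?thesis .
qed

definition eigenspace :: "nat \<Rightarrow> (complex^2 \<Rightarrow> complex) set" where
  "eigenspace k = {F. S3_fun F \<and> (\<forall>x\<in>S3. lapS3 F x = - of_nat (k * (k + 2)) * F x)}"

lemma eigenspace_continuous: "F \<in> eigenspace k \<Longrightarrow> continuous_on (sphere 0 1) F"
  using S3_fun_continuous by (simp add: eigenspace_def S3_eq_sphere)

lemma eigenspace_outside_S3: "F \<in> eigenspace k \<Longrightarrow> x \<notin> S3 \<Longrightarrow> F x = 0"
  by (simp add: eigenspace_def S3_fun_def)

lemma subspace_eigenspace: "fs.subspace (eigenspace k)"
proof -
  have closed: "(\<lambda>x. a * F x + G x) \<in> eigenspace k" if F_eigen: "F \<in> eigenspace k"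
      and G_eigen: "G \<in> eigenspace k" for a F G
  proof -
    have "hext (\<lambda>x. a * F x + G x) = (\<lambda>x. a * hext F x + hext G x)" by (simp add: hext_def[abs_def])
    moreover have C2_hext: "C2_on (- {0}) (hext F)" "C2_on (- {0}) (hext G)"
      using F_eigen G_eigen by (auto simp: eigenspace_def S3_fun_C2_hext)
    ultimately have "S3_fun (\<lambda>x. a * F x + G x)"
      and "\<And>x. x \<in> S3 \<Longrightarrow> lapS3 (\<lambda>x. a * F x + G x) x = a * lapS3 F x + lapS3 G x"
      using F_eigen G_eigen S3_nonzero C2_on_linear_combination[OF open_Compl[OF closed_singleton]
           C2_hext, where a = a]
      by (auto simp: eigenspace_def S3_fun_def lapS3_def)
    then show ?thesis
      using F_eigen G_eigen
      by (simp add: eigenspace_def distrib_left mult.left_commute del: of_nat_mult of_nat_add)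
  qed
  have "pd v (\<lambda>x. 0) = (\<lambda>x. 0)" for v by (auto intro!: pd_eqI)
  then have "(\<lambda>x. 0) \<in> eigenspace k"
    by (simp add: eigenspace_def S3_fun_def C2_on_def lapS3_def lap4_def hext_def[abs_def])
  then show ?thesis using closed by (rule subspace_funI)
qed

lemma sphere_inner_eigenspaces:
  assumes F_eigen: "F \<in> eigenspace k" and G_eigen: "G \<in> eigenspace l" and "k \<noteq> l"
  shows "sphere_inner F G = 0"
proof -
  have "strict_mono (\<lambda>n::nat. n * (n + 2))" by (intro strict_monoI mult_strict_mono) auto
  then have "k * (k + 2) \<noteq> l * (l + 2)" using \<open>k \<noteq> l\<close> by (metis strict_mono_eq)
  then have distinct: "complex_of_nat (k * (k + 2)) \<noteq> of_nat (l * (l + 2))"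
    by (simp only: of_nat_eq_iff) simp
  have "- of_nat (k * (k + 2)) * sphere_inner F G = sphere_inner (lapS3 F) G"
    unfolding sphere_inner_mult_left[symmetric]
    using F_eigen by (intro sphere_inner_cong) (auto simp: eigenspace_def S3_eq_sphere)
  also have "\<dots> = sphere_inner F (lapS3 G)"
    using F_eigen G_eigen by (intro sphere_inner_lapS3) (auto simp: eigenspace_def)
  also have "\<dots> = sphere_inner F (\<lambda>x. - of_nat (l * (l + 2)) * G x)"
    using G_eigen by (intro sphere_inner_cong) (auto simp: eigenspace_def S3_eq_sphere)
  also have "\<dots> = - of_nat (l * (l + 2)) * sphere_inner F G"
    by (simp only: sphere_inner_mult_right complex_cnj_minus complex_cnj_of_nat)
  finally show ?thesis using distinct by (metis mult_right_cancel neg_equal_iff_equal)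
qed

section \<open>Harmonic polynomials\<close>

definition lform :: "complex^2 \<Rightarrow> complex poly" where
  "lform x = [:x$2, x$1:]"

definition cnj_lform :: "complex^2 \<Rightarrow> complex poly" where
  "cnj_lform x = [:cnj (x$1), - cnj (x$2):]"

definition harmonic :: "nat \<Rightarrow> nat \<Rightarrow> nat \<Rightarrow> complex^2 \<Rightarrow> complex" where
  "harmonic p q i x = coeff (lform x ^ p * cnj_lform x ^ q) i"

lemma lform_J:
  "lform (J_i x) = smult \<i> (lform x)" "cnj_lform (J_i x) = - smult \<i> (cnj_lform x)"
  "lform (J_j x) = cnj_lform x" "cnj_lform (J_j x) = - lform x"
  "lform (J_k x) = smult \<i> (cnj_lform x)" "cnj_lform (J_k x) = smult \<i> (lform x)"
  by (simp_all add: lform_def cnj_lform_def J_i_def J_j_def J_k_def)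

lemma harmonic_0_0: "harmonic 0 0 i x = (if i = 0 then 1 else 0)"
  by (simp add: harmonic_def)

lemma harmonic_Suc:
  "harmonic (Suc p) q i x = x$2 * harmonic p q i x +
      (if i = 0 then 0 else x$1 * harmonic p q (i - 1) x)"
  "harmonic p (Suc q) i x
    = cnj (x$1) * harmonic p q i x - (if i = 0 then 0 else cnj (x$2) * harmonic p q (i - 1) x)"
proof -
  have "lform x ^ Suc p * cnj_lform x ^ q = lform x * (lform x ^ p * cnj_lform x ^ q)"
    by (simp add: mult.assoc)
  then show "harmonic (Suc p) q i x
      = x$2 * harmonic p q i x + (if i = 0 then 0 else x$1 * harmonic p q (i - 1) x)"
    by (cases i) (simp_all add: harmonic_def lform_def)
  have "lform x ^ p * cnj_lform x ^ Suc q = cnj_lform x * (lform x ^ p * cnj_lform x ^ q)"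
    by (simp add: mult_ac)
  then show "harmonic p (Suc q) i x
      = cnj (x$1) * harmonic p q i x - (if i = 0 then 0 else cnj (x$2) * harmonic p q (i - 1) x)"
    by (cases i) (simp_all add: harmonic_def cnj_lform_def)
qed

lemma harmonic_eq_0: "i > p + q \<Longrightarrow> harmonic p q i x = 0"
proof -
  assume i_gt: "i > p + q"
  have "degree (lform x ^ p * cnj_lform x ^ q) \<le> degree (lform x ^ p) + degree (cnj_lform x ^ q)"
    by (rule degree_mult_le)
  also have "\<dots> \<le> degree (lform x) * p + degree (cnj_lform x) * q"
    by (intro add_mono degree_power_le)
  also have "\<dots> \<le> 1 * p + 1 * q"
    by (intro add_mono mult_right_mono) (auto simp: lform_def cnj_lform_def)
  finally show ?thesis unfolding harmonic_def using i_gt by (intro coeff_eq_0) simp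
qed

lemma has_derivative_coeff_mult:
  fixes A B :: "'b::real_normed_vector \<Rightarrow> 'a::{comm_semiring_0,real_normed_field} poly"
  assumes "\<And>i. ((\<lambda>x. coeff (A x) i) has_derivative (\<lambda>v. coeff (A' v) i)) (at x)"
    and "\<And>i. ((\<lambda>x. coeff (B x) i) has_derivative (\<lambda>v. coeff (B' v) i)) (at x)"
  shows "((\<lambda>x. coeff (A x * B x) i) has_derivative (\<lambda>v. coeff (A x * B' v + A' v * B x) i)) (at x)"
  unfolding coeff_mult coeff_add sum.distrib[symmetric]
  by (intro has_derivative_sum has_derivative_mult assms)

lemma has_derivative_coeff_power:
  fixes A :: "'b::real_normed_vector \<Rightarrow> 'a::{comm_semiring_0,real_normed_field} poly"
  assumes coeff_A: "\<And>i. ((\<lambda>x. coeff (A x) i) has_derivative (\<lambda>v. coeff (A' v) i)) (at x)"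
  shows "((\<lambda>x. coeff (A x ^ n) i) has_derivative
      (\<lambda>v. coeff (of_nat n * A' v * A x ^ (n - 1)) i)) (at x)"
proof (induction n arbitrary: i)
  case 0
  then show ?case by simp
next
  case (Suc n)
  have "((\<lambda>x. coeff (A x * A x ^ n) i) has_derivative
    (\<lambda>v. coeff (A x * (of_nat n * A' v * A x ^ (n - 1)) + A' v * A x ^ n) i)) (at x)"
    by (rule has_derivative_coeff_mult[OF coeff_A Suc])
  moreover have "A x * (of_nat n * A' v * A x ^ (n - 1)) + A' v * A x ^ n
      = of_nat (Suc n) * A' v * A x ^ n" for v
    by (cases n) (simp_all add: algebra_simps)
  ultimately show ?case by (simp only: power_Suc diff_Suc_1)
qed

lemma has_derivative_coeff_lform:
  "((\<lambda>x. coeff (lform x) i) has_derivative (\<lambda>v. coeff (lform v) i)) (at x)"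
  "((\<lambda>x. coeff (cnj_lform x) i) has_derivative (\<lambda>v. coeff (cnj_lform v) i)) (at x)"
proof -
  have "bounded_linear (\<lambda>x. cnj (x $ j))" for j :: 2
    by (intro bounded_linear_compose[OF bounded_linear_cnj] bounded_linear_vec_nth)
  then show "((\<lambda>x. coeff (lform x) i) has_derivative (\<lambda>v. coeff (lform v) i)) (at x)"
    "((\<lambda>x. coeff (cnj_lform x) i) has_derivative (\<lambda>v. coeff (cnj_lform v) i)) (at x)"
    by (intro bounded_linear_imp_has_derivative;
        cases i; cases "i - 1"; simp add: lform_def cnj_lform_def bounded_linear_vec_nth
            bounded_linear_minus)+
qed

definition harmonic_derivative :: "nat \<Rightarrow> nat \<Rightarrow> nat \<Rightarrow> complex^2 \<Rightarrow> complex^2 \<Rightarrow> complex" where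
  "harmonic_derivative p q i x v =
      of_nat p * coeff (lform v * (lform x ^ (p - 1) * cnj_lform x ^ q)) i
    + of_nat q * coeff (cnj_lform v * (lform x ^ p * cnj_lform x ^ (q - 1))) i"

lemma coeff_of_nat_mult: "coeff (of_nat n * p) i = of_nat n * coeff p i"
  by (simp add: of_nat_poly)

lemma harmonic_has_derivative: "(harmonic p q i has_derivative harmonic_derivative p q i x) (at x)"
proof -
  have "((\<lambda>x. coeff (lform x ^ p * cnj_lform x ^ q) i) has_derivative
      (\<lambda>v. coeff (lform x ^ p * (of_nat q * cnj_lform v * cnj_lform x ^ (q - 1))
        + of_nat p * lform v * lform x ^ (p - 1) * cnj_lform x ^ q) i)) (at x)"
    by (intro has_derivative_coeff_mult has_derivative_coeff_power has_derivative_coeff_lform)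
  moreover have "lform x ^ p * (of_nat q * cnj_lform v * cnj_lform x ^ (q - 1))
      + of_nat p * lform v * lform x ^ (p - 1) * cnj_lform x ^ q
    = of_nat p * (lform v * (lform x ^ (p - 1) * cnj_lform x ^ q))
      + of_nat q * (cnj_lform v * (lform x ^ p * cnj_lform x ^ (q - 1)))" for v
    by (simp add: algebra_simps)
  ultimately show ?thesis
    by (simp only: harmonic_def[abs_def] harmonic_derivative_def[abs_def] coeff_add coeff_of_nat_mult)
qed

lemma harmonic_derivative_J:
  "harmonic_derivative p q i x (J_i x) = \<i> * (of_nat p - of_nat q) * harmonic p q i x"
  "harmonic_derivative p q i x (J_j x)
    = of_nat p * harmonic (p - 1) (q + 1) i x + - of_nat q * harmonic (p + 1) (q - 1) i x"
  "harmonic_derivative p q i x (J_k x)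
    = \<i> * of_nat p * harmonic (p - 1) (q + 1) i x + \<i> * of_nat q * harmonic (p + 1) (q - 1) i x"
proof -
  have restore: "of_nat p * coeff (lform x * (lform x ^ (p - 1) * cnj_lform x ^ q)) i
      = of_nat p * harmonic p q i x"
    "of_nat q * coeff (cnj_lform x * (lform x ^ p * cnj_lform x ^ (q - 1))) i
        = of_nat q * harmonic p q i x"
    by (cases p; simp add: harmonic_def mult.assoc) (cases q; simp add: harmonic_def mult_ac)
  have shift: "coeff (cnj_lform x * (lform x ^ (p - 1) * cnj_lform x ^ q)) i
      = harmonic (p - 1) (q + 1) i x"
    "coeff (lform x * (lform x ^ p * cnj_lform x ^ (q - 1))) i = harmonic (p + 1) (q - 1) i x"
    by (simp_all add: harmonic_def mult_ac)
  have "harmonic_derivative p q i x (J_i x)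
      = \<i> * (of_nat p * coeff (lform x * (lform x ^ (p - 1) * cnj_lform x ^ q)) i)
        - \<i> * (of_nat q * coeff (cnj_lform x * (lform x ^ p * cnj_lform x ^ (q - 1))) i)"
    by (simp add: harmonic_derivative_def lform_J)
  also have "\<dots> = \<i> * (of_nat p - of_nat q) * harmonic p q i x"
    unfolding restore by (simp add: algebra_simps)
  finally show "harmonic_derivative p q i x (J_i x) = \<i> * (of_nat p - of_nat q) * harmonic p q i x" .
  show "harmonic_derivative p q i x (J_j x)
      = of_nat p * harmonic (p - 1) (q + 1) i x + - of_nat q * harmonic (p + 1) (q - 1) i x"
    by (simp only: harmonic_derivative_def lform_J mult_minus_left coeff_minus mult_minus_right shift)
  show "harmonic_derivative p q i x (J_k x)
      = \<i> * of_nat p * harmonic (p - 1) (q + 1) i x + \<i> * of_nat q * harmonic (p + 1) (q - 1) i x"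
    by (simp only: harmonic_derivative_def lform_J mult_smult_left coeff_smult shift)
        (simp only: mult_ac)
qed

lemma harmonic_has_flow_derivative:
  "has_flow_derivative J_i (harmonic p q i) (\<lambda>x. \<i> * (of_nat p - of_nat q) * harmonic p q i x)"
  "has_flow_derivative J_j (harmonic p q i)
    (\<lambda>x. of_nat p * harmonic (p - 1) (q + 1) i x + - of_nat q * harmonic (p + 1) (q - 1) i x)"
  "has_flow_derivative J_k (harmonic p q i)
    (\<lambda>x. \<i> * of_nat p * harmonic (p - 1) (q + 1) i x + \<i> * of_nat q * harmonic (p + 1) (q - 1) i x)"
  using has_derivative_imp_has_flow_derivative[OF harmonic_has_derivative[of p q i]]
  by (simp_all only: harmonic_derivative_J[symmetric])

inductive rational_fun :: "(complex^2 \<Rightarrow> complex) \<Rightarrow> bool" where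
  const: "rational_fun (\<lambda>x. c)"
| coord: "rational_fun (\<lambda>x. x $ j)"
| cnj_coord: "rational_fun (\<lambda>x. cnj (x $ j))"
| inverse_norm: "rational_fun (\<lambda>x. of_real (inverse (norm x)))"
| add: "rational_fun f \<Longrightarrow> rational_fun g \<Longrightarrow> rational_fun (\<lambda>x. f x + g x)"
| mult: "rational_fun f \<Longrightarrow> rational_fun g \<Longrightarrow> rational_fun (\<lambda>x. f x * g x)"

lemma rational_fun_continuous: "rational_fun f \<Longrightarrow> continuous_on (- {0}) f"
  by (induction rule: rational_fun.induct) (auto intro!: continuous_intros)

lemma rational_fun_harmonic: "rational_fun (harmonic p q i)"
proof -
  have shifted: "rational_fun (\<lambda>x. c * (if i = 0 then 0 else f x * g x))"
    if "rational_fun f" "rational_fun g" for c f g and i :: nat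
    using that by (cases "i = 0") (auto intro: rational_fun.intros)
  show ?thesis
  proof (induction p arbitrary: i)
    case 0
    show ?case
    proof (induction q arbitrary: i)
      case 0
      show ?case by (simp add: harmonic_0_0[abs_def] rational_fun.const)
    next
      case (Suc q)
      have "rational_fun (\<lambda>x. cnj (x$1) * harmonic 0 q i x
          + -1 * (if i = 0 then 0 else cnj (x$2) * harmonic 0 q (i - 1) x))"
        by (intro rational_fun.add rational_fun.mult rational_fun.cnj_coord Suc shifted)
      then show ?case by (simp add: harmonic_Suc(2)[abs_def])
    qed
  next
    case (Suc p)
    have "rational_fun (\<lambda>x. x$2 * harmonic p q i x
        + 1 * (if i = 0 then 0 else x$1 * harmonic p q (i - 1) x))"
      by (intro rational_fun.add rational_fun.mult rational_fun.coord Suc shifted)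
    then show ?case by (simp add: harmonic_Suc(1)[abs_def])
  qed
qed

lemma rational_fun_inner: "rational_fun (\<lambda>x. complex_of_real (x \<bullet> v))"
proof -
  have "complex_of_real (x \<bullet> v)
      = (1/2) * (x$1 * cnj (v$1) + cnj (x$1) * v$1 + x$2 * cnj (v$2) + cnj (x$2) * v$2)" for x
    by (simp add: inner_complex_vec2 inner_complex_def complex_eq_iff)
  then show ?thesis by (simp only:) (intro rational_fun.intros)
qed

lemma has_real_derivative_inverse_norm:
  fixes x :: "'a::real_inner"
  assumes "x \<noteq> 0"
  shows "((\<lambda>t. inverse (norm (x + t *\<^sub>R v))) has_real_derivative
      - (x \<bullet> v * inverse (norm x) ^ 3)) (at 0)"
proof -
  have "((\<lambda>t. x + t *\<^sub>R v) has_vector_derivative v) (at 0)"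
    by (auto intro!: derivative_eq_intros)
  moreover have "(norm has_derivative (\<lambda>h. h \<bullet> sgn x))
      (at (x + 0 *\<^sub>R v) within range (\<lambda>t. x + t *\<^sub>R v))"
    using has_derivative_norm[OF assms] by (simp add: has_derivative_at_withinI)
  ultimately have "((\<lambda>t. norm (x + t *\<^sub>R v)) has_real_derivative v \<bullet> sgn x) (at 0)"
    using vector_derivative_diff_chain_within
    by (fastforce simp: o_def has_real_derivative_iff_has_vector_derivative)
  from DERIV_inverse_fun[OF this] assms show ?thesis
    by (simp add: sgn_div_norm inner_commute power2_eq_square power3_eq_cube mult_ac)
qed

lemma has_vector_derivative_inverse_norm:
  fixes x v :: "'a::real_inner"
  assumes "x \<noteq> 0"
  shows "((\<lambda>t. complex_of_real (inverse (norm (x + t *\<^sub>R v)))) has_vector_derivative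
      (-1) * (complex_of_real (x \<bullet> v) * complex_of_real (inverse (norm x)) ^ 3)) (at 0)"
  by (rule has_vector_derivative_eq_rhs[OF
        has_vector_derivative_of_real[OF has_real_derivative_inverse_norm[OF assms]]]) simp

lemma rational_fun_has_partial_derivative:
  assumes "rational_fun f"
  shows "\<exists>f'. rational_fun f' \<and>
      (\<forall>x. x \<noteq> 0 \<longrightarrow> ((\<lambda>t. f (x + t *\<^sub>R v)) has_vector_derivative f' x) (at 0))"
  using assms
proof (induction rule: rational_fun.induct)
  case (const c)
  show ?case by (intro exI[of _ "\<lambda>x. 0"]) (auto intro: rational_fun.const)
next
  case (coord j)
  show ?case by (intro exI[of _ "\<lambda>x. v $ j"])
      (auto intro!: rational_fun.const derivative_eq_intros)
next
  case (cnj_coord j)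
  show ?case by (intro exI[of _ "\<lambda>x. cnj (v $ j)"])
      (auto intro!: rational_fun.const derivative_eq_intros)
next
  case inverse_norm
  let ?r = "\<lambda>x::complex^2. complex_of_real (inverse (norm x))"
  have "rational_fun (\<lambda>x. (-1) * (complex_of_real (x \<bullet> v) * ?r x ^ 3))"
    unfolding power3_eq_cube
    by (intro rational_fun.mult rational_fun.const rational_fun_inner rational_fun.inverse_norm)
  then show ?case using has_vector_derivative_inverse_norm by blast
next
  case (add f g)
  then obtain f' g' where "rational_fun f'" "rational_fun g'"
    "\<forall>x. x \<noteq> 0 \<longrightarrow> ((\<lambda>t. f (x + t *\<^sub>R v)) has_vector_derivative f' x) (at 0)"
    "\<forall>x. x \<noteq> 0 \<longrightarrow> ((\<lambda>t. g (x + t *\<^sub>R v)) has_vector_derivative g' x) (at 0)" by blast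
  then show ?case
    by (intro exI[of _ "\<lambda>x. f' x + g' x"])
       (auto intro!: rational_fun.add has_vector_derivative_add)
next
  case (mult f g)
  then obtain f' g' where derivatives: "rational_fun f'" "rational_fun g'"
    "\<forall>x. x \<noteq> 0 \<longrightarrow> ((\<lambda>t. f (x + t *\<^sub>R v)) has_vector_derivative f' x) (at 0)"
    "\<forall>x. x \<noteq> 0 \<longrightarrow> ((\<lambda>t. g (x + t *\<^sub>R v)) has_vector_derivative g' x) (at 0)" by blast
  have "((\<lambda>t. f (x + t *\<^sub>R v) * g (x + t *\<^sub>R v))
      has_vector_derivative f x * g' x + f' x * g x) (at 0)"
    if "x \<noteq> 0" for x
    using has_vector_derivative_mult[OF derivatives(3)[rule_format, OF that]
         derivatives(4)[rule_format, OF that]] by simp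
  moreover have "rational_fun (\<lambda>x. f x * g' x + f' x * g x)"
    by (intro rational_fun.add rational_fun.mult derivatives mult.hyps)
  ultimately show ?case by blast
qed

lemma rational_fun_C2_on:
  assumes "rational_fun f"
  shows "C2_on (- {0}) f"
proof -
  have "\<exists>g. \<forall>v. rational_fun (g v) \<and>
      (\<forall>x. x \<noteq> 0 \<longrightarrow> ((\<lambda>t. f (x + t *\<^sub>R v)) has_vector_derivative g v x) (at 0))"
    if "rational_fun f" for f
    using rational_fun_has_partial_derivative[OF that] by metis
  note partials = this
  obtain f' where partial: "\<And>v. rational_fun (f' v)"
    "\<And>v x. x \<noteq> 0 \<Longrightarrow> ((\<lambda>t. f (x + t *\<^sub>R v)) has_vector_derivative f' v x) (at 0)"
    using partials[OF assms] by blast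
  have "\<forall>v. \<exists>g. \<forall>u. rational_fun (g u) \<and>
      (\<forall>x. x \<noteq> 0 \<longrightarrow> ((\<lambda>t. f' v (x + t *\<^sub>R u)) has_vector_derivative g u x) (at 0))"
    using partials[OF partial(1)] by blast
  from choice[OF this] obtain g where second_partial: "\<And>u v. rational_fun (g v u)"
    "\<And>u v x. x \<noteq> 0 \<Longrightarrow> ((\<lambda>t. f' v (x + t *\<^sub>R u)) has_vector_derivative g v u x) (at 0)"
    by blast
  show ?thesis
    by (rule C2_onI(1)[where G' = f' and G'' = "\<lambda>u v. g v u"])
       (use partial second_partial rational_fun_continuous in \<open>auto simp: open_Compl\<close>)
qed

lemma rational_fun_normalize:
  assumes "rational_fun f"
  shows "\<exists>g. rational_fun g \<and> (\<forall>x. x \<noteq> 0 \<longrightarrow> f ((1 / norm x) *\<^sub>R x) = g x)"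
  using assms
proof (induction rule: rational_fun.induct)
  case (const c)
  show ?case by (intro exI[of _ "\<lambda>x. c"]) (simp add: rational_fun.const)
next
  case (coord j)
  have "rational_fun (\<lambda>x. of_real (inverse (norm x)) * x $ j)" by (intro rational_fun.intros)
  then show ?case
    by (intro exI[of _ "\<lambda>x. of_real (inverse (norm x)) * x $ j"])
       (simp add: scaleR_conv_of_real[where 'a = complex] divide_inverse)
next
  case (cnj_coord j)
  have "rational_fun (\<lambda>x. of_real (inverse (norm x)) * cnj (x $ j))" by (intro rational_fun.intros)
  then show ?case
    by (intro exI[of _ "\<lambda>x. of_real (inverse (norm x)) * cnj (x $ j)"])
       (simp add: scaleR_conv_of_real[where 'a = complex] divide_inverse)
next
  case inverse_norm
  show ?case by (intro exI[of _ "\<lambda>x. 1"]) (simp add: rational_fun.const)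
next
  case (add f g)
  then obtain f' g' where "rational_fun f'" "rational_fun g'"
    "\<forall>x. x \<noteq> 0 \<longrightarrow> f ((1 / norm x) *\<^sub>R x) = f' x"
    "\<forall>x. x \<noteq> 0 \<longrightarrow> g ((1 / norm x) *\<^sub>R x) = g' x" by blast
  then show ?case by (intro exI[of _ "\<lambda>x. f' x + g' x"]) (simp add: rational_fun.add)
next
  case (mult f g)
  then obtain f' g' where "rational_fun f'" "rational_fun g'"
    "\<forall>x. x \<noteq> 0 \<longrightarrow> f ((1 / norm x) *\<^sub>R x) = f' x"
    "\<forall>x. x \<noteq> 0 \<longrightarrow> g ((1 / norm x) *\<^sub>R x) = g' x" by blast
  then show ?case by (intro exI[of _ "\<lambda>x. f' x * g' x"]) (simp add: rational_fun.mult)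
qed

lemma S3_fun_restrS3:
  assumes "rational_fun f"
  shows "S3_fun (restrS3 f)"
proof -
  obtain g where g_rational: "rational_fun g" "\<And>x. x \<noteq> 0 \<Longrightarrow> f ((1 / norm x) *\<^sub>R x) = g x"
    using rational_fun_normalize[OF assms] by blast
  have "C2_on (- {0}) (hext (restrS3 f))"
    by (rule C2_on_cong[OF _ rational_fun_C2_on[OF g_rational(1)]])
       (auto simp: hext_def restrS3_def S3_def g_rational(2) open_Compl)
  then show ?thesis by (simp add: S3_fun_def restrS3_def)
qed

text \<open>The second flow derivatives add up to the Casimir eigenvalue of the
  \<open>(p + q + 1)\<close>-dimensional representation of \<open>su(2)\<close>.\<close>

lemma restrS3_harmonic_in_eigenspace: "restrS3 (harmonic p q i) \<in> eigenspace (p + q)"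
proof -
  let ?F = "restrS3 (harmonic p q i)"
  have S3_fun: "S3_fun ?F" by (rule S3_fun_restrS3[OF rational_fun_harmonic])
  have restr: "has_flow_derivative J ?F F'"
    if "complex_structure J" "has_flow_derivative J (harmonic p q i) F'" for J F'
    by (rule has_flow_derivative_cong[OF that]) (simp add: restrS3_def S3_eq_sphere)
  note first = harmonic_has_flow_derivative and J = complex_structure_J
  note closed = has_flow_derivative_add has_flow_derivative_mult_right
  have "lapS3 ?F x = - of_nat ((p + q) * (p + q + 2)) * ?F x" if x_in_S3: "x \<in> S3" for x
  proof -
    have pred: "of_nat p * harmonic (p - 1 + 1) q i x = of_nat p * harmonic p q i x"
      "of_nat q * harmonic p (q - 1 + 1) i x = of_nat q * harmonic p q i x"
      by (cases p; simp) (cases q; simp)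
    have "lapS3 ?F x = - (of_nat p - of_nat q)\<^sup>2 * harmonic p q i x
        - 2 * of_nat (q + 1) * (of_nat p * harmonic (p - 1 + 1) q i x)
        - 2 * of_nat (p + 1) * (of_nat q * harmonic p (q - 1 + 1) i x)"
      by (subst lapS3_eqI[OF S3_fun x_in_S3
            restr[OF J(1) first(1)] closed(2)[OF first(1)]
            restr[OF J(2) first(2)] closed(1)[OF closed(2)[OF first(2)] closed(2)[OF first(2)]]
            restr[OF J(3) first(3)] closed(1)[OF closed(2)[OF first(3)] closed(2)[OF first(3)]]])
         (simp add: algebra_simps power2_eq_square)
    also have "\<dots> = - of_nat ((p + q) * (p + q + 2)) * harmonic p q i x"
      unfolding pred by (simp add: algebra_simps power2_eq_square)
    finally show ?thesis using x_in_S3 by (simp add: restrS3_def)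
  qed
  then show ?thesis using S3_fun by (simp add: eigenspace_def)
qed

section \<open>Multiplication by coordinates\<close>

lemma S3_smult_lform:
  assumes "x \<in> S3"
  shows "smult (x$1) (cnj_lform x) + smult (cnj (x$2)) (lform x) = 1"
  using S3_sum_squares[OF assms] by (simp add: lform_def cnj_lform_def mult.commute pCons_one)

lemma pderiv_lform_power: "pderiv (lform x ^ n) = of_nat n * smult (x$1) (lform x ^ (n - 1))"

    and pderiv_cnj_lform_power: "pderiv (cnj_lform x ^ n) =
        - (of_nat n * smult (cnj (x$2)) (cnj_lform x ^ (n - 1)))"
  by (simp_all add: pderiv_power lform_def cnj_lform_def pderiv_pCons of_nat_poly mult.commute)

lemma coord1_mult_harmonic:
  assumes x_in_S3: "x \<in> S3"
  shows "of_nat (p + q + 1) * (x$1 * harmonic p q i x)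
    = of_nat (i + 1) * harmonic (p + 1) q (i + 1) x + of_nat q * harmonic p (q - 1) i x"
proof -
  let ?A = "lform x" and ?B = "cnj_lform x"
  have "pderiv (?A ^ (p + 1) * ?B ^ q) + of_nat q * (?A ^ p * ?B ^ (q - 1))
      = of_nat (p + 1) * smult (x$1) (?A ^ p * ?B ^ q)
        - of_nat q * smult (cnj (x$2)) (?A ^ (p + 1) * ?B ^ (q - 1))
        + of_nat q * ((smult (x$1) ?B + smult (cnj (x$2)) ?A) * (?A ^ p * ?B ^ (q - 1)))"
    unfolding pderiv_mult pderiv_lform_power pderiv_cnj_lform_power S3_smult_lform[OF x_in_S3]
    by (simp add: algebra_simps)
  also have "\<dots> = of_nat (p + q + 1) * smult (x$1) (?A ^ p * ?B ^ q)"
    by (cases q) (simp_all add: algebra_simps smult_add_right)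
  finally have "coeff (pderiv (?A ^ (p + 1) * ?B ^ q) + of_nat q * (?A ^ p * ?B ^ (q - 1))) i
      = coeff (of_nat (p + q + 1) * smult (x$1) (?A ^ p * ?B ^ q)) i" by simp
  then show ?thesis
    unfolding coeff_add coeff_pderiv coeff_of_nat_mult coeff_smult harmonic_def Suc_eq_plus1
    by (rule sym)
qed

lemma cnj_coord2_mult_harmonic:
  assumes x_in_S3: "x \<in> S3"
  shows "of_nat (p + q + 1) * (cnj (x$2) * harmonic p q i x)
    = of_nat p * harmonic (p - 1) q i x - of_nat (i + 1) * harmonic p (q + 1) (i + 1) x"
proof -
  let ?A = "lform x" and ?B = "cnj_lform x"
  have "of_nat p * (?A ^ (p - 1) * ?B ^ q) - pderiv (?A ^ p * ?B ^ (q + 1))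
      = of_nat p * ((smult (x$1) ?B + smult (cnj (x$2)) ?A) * (?A ^ (p - 1) * ?B ^ q))
        - (of_nat p * smult (x$1) (?A ^ (p - 1) * ?B ^ (q + 1))
            - of_nat (q + 1) * smult (cnj (x$2)) (?A ^ p * ?B ^ q))"
    unfolding pderiv_mult pderiv_lform_power pderiv_cnj_lform_power S3_smult_lform[OF x_in_S3]
    by (simp add: algebra_simps)
  also have "\<dots> = of_nat (p + q + 1) * smult (cnj (x$2)) (?A ^ p * ?B ^ q)"
    by (cases p) (simp_all add: algebra_simps smult_add_right)
  finally have "coeff (of_nat p * (?A ^ (p - 1) * ?B ^ q) - pderiv (?A ^ p * ?B ^ (q + 1))) i
      = coeff (of_nat (p + q + 1) * smult (cnj (x$2)) (?A ^ p * ?B ^ q)) i" by simp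
  then show ?thesis
    unfolding coeff_diff coeff_pderiv coeff_of_nat_mult coeff_smult harmonic_def Suc_eq_plus1
    by (rule sym)
qed

definition harmonic_space :: "(complex^2 \<Rightarrow> complex) set" where
  "harmonic_space = fs.span (range (\<lambda>(p, q, i). restrS3 (harmonic p q i)))"

lemma subspace_harmonic_space: "fs.subspace harmonic_space"
  by (simp add: harmonic_space_def)

lemma harmonic_in_space: "restrS3 (harmonic p q i) \<in> harmonic_space"
  unfolding harmonic_space_def by (rule fs.span_base) (auto intro: image_eqI[of _ _ "(p, q, i)"])

definition preserves_harmonic_space :: "(complex^2 \<Rightarrow> complex) \<Rightarrow> bool" where
  "preserves_harmonic_space g \<longleftrightarrow> (\<forall>f\<in>harmonic_space. (\<lambda>x. g x * f x) \<in> harmonic_space)"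

lemma preserves_harmonic_spaceI:
  assumes "\<And>p q i. (\<lambda>x. g x * restrS3 (harmonic p q i) x) \<in> harmonic_space"
  shows "preserves_harmonic_space g"
proof -
  let ?V = "{f. (\<lambda>x. g x * f x) \<in> harmonic_space}"
  note closed = subspace_funD[OF subspace_harmonic_space]
  have "fs.subspace ?V"
  proof (rule subspace_funI)
    show "(\<lambda>x. 0) \<in> ?V" by (simp add: closed(1))
    show "(\<lambda>x. c * f x + h x) \<in> ?V" if "f \<in> ?V" "h \<in> ?V" for c f h
      using closed(3)[OF closed(2), of "\<lambda>x. g x * f x" "\<lambda>x. g x * h x" c] that
      by (simp add: distrib_left mult.left_commute)
  qed
  then have "harmonic_space \<subseteq> ?V"
    unfolding harmonic_space_def using assms
    by (intro fs.span_minimal) (auto simp: harmonic_space_def)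
  then show ?thesis by (auto simp: preserves_harmonic_space_def)
qed

lemma preserves_harmonic_space_const: "preserves_harmonic_space (\<lambda>x. c)"
  by (simp add: preserves_harmonic_space_def subspace_funD[OF subspace_harmonic_space])

lemma preserves_harmonic_space_add:
  "preserves_harmonic_space f \<Longrightarrow> preserves_harmonic_space g \<Longrightarrow> preserves_harmonic_space (\<lambda>x. f x + g x)"
  by (simp add: preserves_harmonic_space_def distrib_right subspace_funD[OF subspace_harmonic_space])

lemma preserves_harmonic_space_mult:
  "preserves_harmonic_space f \<Longrightarrow> preserves_harmonic_space g \<Longrightarrow> preserves_harmonic_space (\<lambda>x. f x * g x)"
  by (simp add: preserves_harmonic_space_def mult.assoc)

lemma preserves_harmonic_space_coord1: "preserves_harmonic_space (\<lambda>x. x$1)"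
proof (rule preserves_harmonic_spaceI)
  fix p q i
  have "complex_of_nat (p + q + 1) \<noteq> 0" by (metis Suc_eq_plus1 of_nat_neq_0)
  then have "(\<lambda>x. x$1 * restrS3 (harmonic p q i) x)
    = (\<lambda>x. of_nat (i + 1) / of_nat (p + q + 1) * restrS3 (harmonic (p + 1) q (i + 1)) x
      + of_nat q / of_nat (p + q + 1) * restrS3 (harmonic p (q - 1) i) x)"
    using coord1_mult_harmonic[of _ p q i]
    by (intro ext) (auto simp: restrS3_def field_simps simp del: of_nat_add of_nat_Suc)
  then show "(\<lambda>x. x$1 * restrS3 (harmonic p q i) x) \<in> harmonic_space"
    by (simp only: subspace_funD[OF subspace_harmonic_space] harmonic_in_space)
qed

lemma preserves_harmonic_space_cnj_coord2: "preserves_harmonic_space (\<lambda>x. cnj (x$2))"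
proof (rule preserves_harmonic_spaceI)
  fix p q i
  have "complex_of_nat (p + q + 1) \<noteq> 0" by (metis Suc_eq_plus1 of_nat_neq_0)
  then have "(\<lambda>x. cnj (x$2) * restrS3 (harmonic p q i) x)
    = (\<lambda>x. of_nat p / of_nat (p + q + 1) * restrS3 (harmonic (p - 1) q i) x
      - of_nat (i + 1) / of_nat (p + q + 1) * restrS3 (harmonic p (q + 1) (i + 1)) x)"
    using cnj_coord2_mult_harmonic[of _ p q i]
    by (intro ext) (auto simp: restrS3_def field_simps simp del: of_nat_add of_nat_Suc)
  then show "(\<lambda>x. cnj (x$2) * restrS3 (harmonic p q i) x) \<in> harmonic_space"
    by (simp only: subspace_funD[OF subspace_harmonic_space] harmonic_in_space)
qed

lemma preserves_harmonic_space_coord2: "preserves_harmonic_space (\<lambda>x. x$2)"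
proof (rule preserves_harmonic_spaceI)
  fix p q i
  have "(\<lambda>x. x$2 * restrS3 (harmonic p q i) x) = (\<lambda>x. restrS3 (harmonic (Suc p) q i) x
    - (if i = 0 then \<lambda>x. 0 else (\<lambda>x. x$1 * restrS3 (harmonic p q (i - 1)) x)) x)"
    by (intro ext) (auto simp: restrS3_def harmonic_Suc(1))
  moreover have "(\<lambda>x. x$1 * restrS3 (harmonic p q (i - 1)) x) \<in> harmonic_space"
    using preserves_harmonic_space_coord1 harmonic_in_space
    by (simp add: preserves_harmonic_space_def)
  ultimately show "(\<lambda>x. x$2 * restrS3 (harmonic p q i) x) \<in> harmonic_space"
    by (cases "i = 0") (simp_all add: subspace_funD[OF subspace_harmonic_space] harmonic_in_space)
qed

lemma preserves_harmonic_space_cnj_coord1: "preserves_harmonic_space (\<lambda>x. cnj (x$1))"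
proof (rule preserves_harmonic_spaceI)
  fix p q i
  have "(\<lambda>x. cnj (x$1) * restrS3 (harmonic p q i) x) = (\<lambda>x. restrS3 (harmonic p (Suc q) i) x
    + (if i = 0 then \<lambda>x. 0 else (\<lambda>x. cnj (x$2) * restrS3 (harmonic p q (i - 1)) x)) x)"
    by (intro ext) (auto simp: restrS3_def harmonic_Suc(2))
  moreover have "(\<lambda>x. cnj (x$2) * restrS3 (harmonic p q (i - 1)) x) \<in> harmonic_space"
    using preserves_harmonic_space_cnj_coord2 harmonic_in_space
    by (simp add: preserves_harmonic_space_def)
  ultimately show "(\<lambda>x. cnj (x$1) * restrS3 (harmonic p q i) x) \<in> harmonic_space"
    by (cases "i = 0") (simp_all add: subspace_funD[OF subspace_harmonic_space] harmonic_in_space)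
qed

lemmas preserves_harmonic_space_intros =
  preserves_harmonic_space_const preserves_harmonic_space_add preserves_harmonic_space_mult
  preserves_harmonic_space_coord1 preserves_harmonic_space_coord2
  preserves_harmonic_space_cnj_coord1 preserves_harmonic_space_cnj_coord2

lemma preserves_harmonic_space_linear:
  assumes "bounded_linear (f :: complex^2 \<Rightarrow> real)"
  shows "preserves_harmonic_space (\<lambda>x. of_real (f x))"
proof -
  have "complex_of_real (f x) =
      (of_real (f ex) / 2) * (x$1 + cnj (x$1)) + (- \<i> * of_real (f ey) / 2) * (x$1 + (-1) * cnj (x$1))
    + ((of_real (f ez) / 2) * (x$2 + cnj (x$2))
      + (- \<i> * of_real (f ew) / 2) * (x$2 + (-1) * cnj (x$2)))" for x
    by (subst linear_complex2_expand[OF bounded_linear.linear[OF assms]]) (simp add: complex_eq_iff)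
  then show ?thesis
    by (rule ssubst[OF ext]) (intro preserves_harmonic_space_intros)
qed

lemma restrS3_polynomial_in_harmonic_space:
  fixes g :: "complex^2 \<Rightarrow> complex"
  assumes "polynomial_function g"
  shows "restrS3 g \<in> harmonic_space"
proof -
  have real: "preserves_harmonic_space (\<lambda>x. of_real (h x))" if "real_polynomial_function h" for h
    using that
    by induction (simp_all add: preserves_harmonic_space_linear preserves_harmonic_space_intros)
  have "real_polynomial_function (\<lambda>x. Re (g x))" "real_polynomial_function (\<lambda>x. Im (g x))"
    using assms bounded_linear_Re bounded_linear_Im by (auto simp: polynomial_function_def o_def)
  then have "preserves_harmonic_space (\<lambda>x. of_real (Re (g x)) + \<i> * of_real (Im (g x)))"
    by (intro preserves_harmonic_space_intros real)
  then have "(\<lambda>x. g x * restrS3 (harmonic 0 0 0) x) \<in> harmonic_space"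
    using harmonic_in_space by (simp add: preserves_harmonic_space_def flip: complex_eq)
  moreover have "(\<lambda>x. g x * restrS3 (harmonic 0 0 0) x) = restrS3 g"
    by (auto simp: restrS3_def harmonic_0_0)
  ultimately show ?thesis by simp
qed

section \<open>Completeness of the harmonic polynomials\<close>

lemma span_orthogonal:
  assumes D_cont: "continuous_on (sphere 0 1) D" and f_in_span: "f \<in> fs.span B"
    and generators: "\<And>g. g \<in> B \<Longrightarrow> continuous_on (sphere 0 1) g" "\<And>g. g \<in> B \<Longrightarrow> sphere_inner D g = 0"
  shows "continuous_on (sphere 0 1) f" and "sphere_inner D f = 0"
proof -
  have "fs.subspace {f. continuous_on (sphere 0 1) f \<and> sphere_inner D f = 0}"
    by (rule subspace_funI)
       (auto simp: sphere_inner_zero_right sphere_inner_add_right D_cont sphere_inner_mult_right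
          continuous_on_mult_left intro!: continuous_intros)
  then have "fs.span B \<subseteq> {f. continuous_on (sphere 0 1) f \<and> sphere_inner D f = 0}"
    using generators by (intro fs.span_minimal) auto
  then show "continuous_on (sphere 0 1) f" and "sphere_inner D f = 0" using f_in_span by auto
qed

lemma continuous_on_span:
  assumes "\<And>g. g \<in> B \<Longrightarrow> continuous_on (sphere 0 1) g" "f \<in> fs.span B"
  shows "continuous_on (sphere 0 1) f"
  using span_orthogonal(1)[of "\<lambda>x. 0"] assms by (simp add: sphere_inner_zero_left)

lemma orthogonal_projection_step:
  fixes f r :: "'a::euclidean_space \<Rightarrow> complex"
  assumes f_cont: "continuous_on (sphere 0 1) f" and r_cont: "continuous_on (sphere 0 1) r"
  obtains c where "sphere_inner (\<lambda>x. f x - c * r x) r = 0"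
    and "\<And>g. continuous_on (sphere 0 1) g \<Longrightarrow> sphere_inner f g = 0 \<Longrightarrow> sphere_inner r g = 0 \<Longrightarrow>
      sphere_inner (\<lambda>x. f x - c * r x) g = 0"
proof -
  define c where "c = sphere_inner f r / sphere_inner r r"
  have inner_diff: "sphere_inner (\<lambda>x. f x - c * r x) g = sphere_inner f g - c * sphere_inner r g"
    if "continuous_on (sphere 0 1) g" for g
    using f_cont r_cont that
    by (simp add: sphere_inner_diff_left sphere_inner_mult_left continuous_on_mult_left)
  have "sphere_inner (\<lambda>x. f x - c * r x) r = 0"
  proof (cases "sphere_inner r r = 0")
    case True
    then have "r x = 0" if "x \<in> sphere 0 1" for x
      using sphere_inner_self_eq_0D[OF r_cont _ that] by simp
    then have "sphere_inner f r = sphere_inner f (\<lambda>x. 0)" by (intro sphere_inner_cong) auto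
    then show ?thesis using inner_diff[OF r_cont] True by (simp add: sphere_inner_zero_right)
  next
    case False
    then show ?thesis using inner_diff[OF r_cont] by (simp add: c_def)
  qed
  then show thesis using inner_diff by (intro that[of c]) auto
qed

lemma orthogonal_projection_insert:
  assumes D_orthogonal: "continuous_on (sphere 0 1) D" "\<And>g. g \<in> B \<Longrightarrow> sphere_inner D g = 0"
    and B_cont: "\<And>g. g \<in> insert b B \<Longrightarrow> continuous_on (sphere 0 1) g"
    and b'_projection: "b' \<in> fs.span B" "\<And>g. g \<in> B \<Longrightarrow> sphere_inner (\<lambda>x. b x - b' x) g = 0"
  obtains c where "\<And>g. g \<in> insert b B \<Longrightarrow> sphere_inner (\<lambda>x. D x - c * (b x - b' x)) g = 0"
proof -
  have b'_cont: "continuous_on (sphere 0 1) b'"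
    by (rule continuous_on_span[OF B_cont b'_projection(1)]) simp
  have diff_cont: "continuous_on (sphere 0 1) (\<lambda>x. b x - b' x)"
    by (rule continuous_on_diff[OF B_cont b'_cont]) simp
  obtain c where orthogonal_diff: "sphere_inner (\<lambda>x. D x - c * (b x - b' x)) (\<lambda>x. b x - b' x) = 0"
    and orthogonal: "\<And>g. continuous_on (sphere 0 1) g \<Longrightarrow> sphere_inner D g = 0 \<Longrightarrow>
      sphere_inner (\<lambda>x. b x - b' x) g = 0 \<Longrightarrow> sphere_inner (\<lambda>x. D x - c * (b x - b' x)) g = 0"
    by (rule orthogonal_projection_step[OF D_orthogonal(1) diff_cont]) (rule that)
  have orthogonal_B: "sphere_inner (\<lambda>x. D x - c * (b x - b' x)) g = 0" if "g \<in> B" for g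
    using that by (intro orthogonal B_cont D_orthogonal(2) b'_projection(2)) simp_all
  have cont: "continuous_on (sphere 0 1) (\<lambda>x. D x - c * (b x - b' x))"
    by (intro continuous_intros D_orthogonal(1) diff_cont)
  have "sphere_inner (\<lambda>x. D x - c * (b x - b' x)) b' = 0"
    by (rule span_orthogonal(2)[OF cont b'_projection(1) B_cont orthogonal_B]) simp_all
  then have "sphere_inner (\<lambda>x. D x - c * (b x - b' x)) (\<lambda>x. (b x - b' x) + b' x) = 0"
    using orthogonal_diff by (simp only: sphere_inner_add_right[OF cont diff_cont b'_cont] add_0)
  then show thesis using orthogonal_B by (intro that[of c]) auto
qed

lemma orthogonal_projection_exists:
  assumes "finite B" "\<And>g. g \<in> B \<Longrightarrow> continuous_on (sphere 0 1) g" "continuous_on (sphere 0 1) F"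
  shows "\<exists>f\<in>fs.span B. \<forall>g\<in>B. sphere_inner (\<lambda>x. F x - f x) g = 0"
  using assms
proof (induction B arbitrary: F rule: finite_induct)
  case empty
  then show ?case by (auto intro: fs.span_zero)
next
  case (insert b B)
  obtain f where f_projection: "f \<in> fs.span B" "\<And>g. g \<in> B \<Longrightarrow> sphere_inner (\<lambda>x. F x - f x) g = 0"
    using insert.IH[of F] insert.prems by auto
  obtain b' where b'_projection: "b' \<in> fs.span B" "\<And>g. g \<in> B \<Longrightarrow> sphere_inner (\<lambda>x. b x - b' x) g = 0"
    using insert.IH[of b] insert.prems(1) by auto
  have "continuous_on (sphere 0 1) f"
    using continuous_on_span[OF _ f_projection(1)] insert.prems(1) by simp
  then have "continuous_on (sphere 0 1) (\<lambda>x. F x - f x)" by (intro continuous_intros insert.prems(2))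
  then obtain c where
    "\<And>g. g \<in> insert b B \<Longrightarrow> sphere_inner (\<lambda>x. F x - f x - c * (b x - b' x)) g = 0"
    using orthogonal_projection_insert[OF _ f_projection(2) insert.prems(1) b'_projection] by blast
  moreover have "(\<lambda>x. F x - (f + fscale c (b - b')) x) = (\<lambda>x. F x - f x - c * (b x - b' x))"
    by (simp add: fscale_def diff_diff_eq)
  moreover have "f + fscale c (b - b') \<in> fs.span (insert b B)"
  proof -
    have "fs.span B \<subseteq> fs.span (insert b B)" by (rule fs.span_mono) auto
    then have "f \<in> fs.span (insert b B)" "b' \<in> fs.span (insert b B)"
      using f_projection(1) b'_projection(1) by auto
    then show ?thesis by (simp add: fs.span_add fs.span_scale fs.span_diff fs.span_base)
  qed
  ultimately show ?case by (intro bexI[of _ "f + fscale c (b - b')"]) simp_all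
qed

lemma harmonic_space_dense:
  assumes D_cont: "continuous_on (sphere 0 1) D" and x_in_S3: "x \<in> S3"
    and orthogonal: "\<And>p q i. sphere_inner D (restrS3 (harmonic p q i)) = 0"
  shows "D x = 0"
proof -
  obtain B where D_bound: "B > 0" "\<And>x. x \<in> sphere 0 1 \<Longrightarrow> norm (D x) \<le> B"
    using sphere_bound[OF D_cont] by blast
  define V where "V = measure lborel (ball (0::complex^2) 1 - {0})"
  have bound: "norm (sphere_inner D D) \<le> e * (B * V)" if e_pos: "e > 0" for e
  proof -
    obtain g where g_polynomial: "polynomial_function g"
    and close: "\<And>x. x \<in> sphere 0 1 \<Longrightarrow> norm (D x - g x) < e"
      using Stone_Weierstrass_polynomial_function[OF compact_sphere D_cont e_pos] by blast
    have "sphere_inner D (restrS3 g) = 0"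
      using restrS3_polynomial_in_harmonic_space[OF g_polynomial] unfolding harmonic_space_def
      by (rule span_orthogonal(2)[OF D_cont])
         (auto simp: orthogonal intro: eigenspace_continuous restrS3_harmonic_in_eigenspace)
    moreover have "sphere_inner D (restrS3 g) = sphere_inner D g"
      by (rule sphere_inner_cong) (simp_all add: restrS3_def S3_eq_sphere)
    ultimately have "norm (sphere_inner D D) \<le> B * e * V"
      unfolding V_def using D_bound close
      by (intro norm_sphere_inner_self_le[OF D_cont
           continuous_on_polymonial_function[OF g_polynomial]])
         (auto intro: less_imp_le)
    then show ?thesis by (simp add: mult_ac)
  qed
  have "norm (sphere_inner D D) \<le> 0"
  proof (rule field_le_epsilon)
    fix e :: real assume e_pos: "e > 0"
    have "V \<ge> 0" by (simp add: V_def)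
    then have pos: "B * V + 1 > 0" using D_bound(1) by (simp add: add_nonneg_pos)
    then have "norm (sphere_inner D D) \<le> e / (B * V + 1) * (B * V)" using e_pos by (intro bound) simp
    also have "\<dots> \<le> e" using e_pos pos by (simp add: field_simps)
    finally show "norm (sphere_inner D D) \<le> 0 + e" by simp
  qed
  then show ?thesis using sphere_inner_self_eq_0D[OF D_cont] x_in_S3 by (simp add: S3_eq_sphere)
qed

lemma eigenspace_orthogonal_harmonic_eq_0:
  assumes D_eigen: "D \<in> eigenspace k"
    and orthogonal: "\<And>j i. j \<le> k \<Longrightarrow> i \<le> k \<Longrightarrow> sphere_inner D (restrS3 (harmonic (k - j) j i)) = 0"
  shows "D x = 0"
proof (cases "x \<in> S3")
  case True
  have "sphere_inner D (restrS3 (harmonic p q i)) = 0" for p q i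
  proof (cases "p + q = k")
    case False
    then show ?thesis
      by (intro sphere_inner_eigenspaces[OF D_eigen restrS3_harmonic_in_eigenspace]) simp
  next
    case degree: True
    show ?thesis
    proof (cases "i \<le> k")
      case True
      then show ?thesis using orthogonal[of q i] degree by auto
    next
      case False
      then have "restrS3 (harmonic p q i) = (\<lambda>x. 0)"
        using degree by (auto simp: restrS3_def harmonic_eq_0)
      then show ?thesis by (simp add: sphere_inner_zero_right)
    qed
  qed
  then show ?thesis by (rule harmonic_space_dense[OF eigenspace_continuous[OF D_eigen] True])
qed (rule eigenspace_outside_S3[OF D_eigen])

theorem eigenspace_eq_span_harmonic:
  "eigenspace k = fs.span ((\<lambda>(j, i). restrS3 (harmonic (k - j) j i)) ` ({..k} \<times> {..k}))"
    (is "_ = fs.span ?B")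
proof
  have generators: "?B \<subseteq> eigenspace k"
  proof clarify
    fix j i assume "j \<le> k"
    then show "restrS3 (harmonic (k - j) j i) \<in> eigenspace k"
      using restrS3_harmonic_in_eigenspace[of "k - j" j i] by simp
  qed
  then show span_subset: "fs.span ?B \<subseteq> eigenspace k"
    by (rule fs.span_minimal) (rule subspace_eigenspace)
  show "eigenspace k \<subseteq> fs.span ?B"
  proof
    fix F assume F_eigen: "F \<in> eigenspace k"
    have "\<exists>f\<in>fs.span ?B. \<forall>g\<in>?B. sphere_inner (\<lambda>x. F x - f x) g = 0"
      using generators F_eigen by (intro orthogonal_projection_exists eigenspace_continuous) auto
    then obtain f where f_in_span: "f \<in> fs.span ?B"
      and orthogonal: "\<And>g. g \<in> ?B \<Longrightarrow> sphere_inner (\<lambda>x. F x - f x) g = 0"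
      by blast
    have "(\<lambda>x. F x - f x) \<in> eigenspace k"
      using subspace_funD(4)[OF subspace_eigenspace F_eigen] f_in_span span_subset by auto
    then have "F x - f x = 0" for x
      by (rule eigenspace_orthogonal_harmonic_eq_0) (rule orthogonal, force)
    then have "F = f" by (simp add: fun_eq_iff)
    then show "F \<in> fs.span ?B" using f_in_span by simp
  qed
qed

section \<open>Siblings\<close>

lemma pd_eq_derivative: "(G has_derivative D) (at p) \<Longrightarrow> pd v G p = D v"
proof (rule pd_eqI)
  assume "(G has_derivative D) (at p)"
  then have "(G has_derivative D) (at (p + 0 *\<^sub>R v) within range (\<lambda>t. p + t *\<^sub>R v))"
    by (simp add: has_derivative_at_withinI)
  moreover have "((\<lambda>t. p + t *\<^sub>R v) has_vector_derivative v) (at 0)"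
    by (auto intro!: derivative_eq_intros)
  ultimately show "((\<lambda>t. G (p + t *\<^sub>R v)) has_vector_derivative D v) (at 0)"
    using vector_derivative_diff_chain_within by (fastforce simp: o_def)
qed

text \<open>\<open>twist_minus\<close> and \<open>twist_plus\<close> are the ladder operators of the \<open>su(2)\<close> spanned by the
  derivatives along \<open>J_i\<close>, \<open>J_j\<close> and \<open>J_k\<close>.\<close>

lemma twist_minus_eq_derivative:
  assumes "(G has_derivative D) (at p)"
  shows "twist_minus G p = (D (J_j p) - \<i> * D (J_k p)) / 2"
proof -
  have "linear D" using assms by (rule has_derivative_linear)
  note expand = linear_complex2_expand[OF this]
  show ?thesis
    unfolding twist_minus_def d_alpha_def d_beta_def pd_eq_derivative[OF assms]
      expand[of "J_j p"] expand[of "J_k p"]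
    by (simp add: J_j_def J_k_def scaleR_conv_of_real complex_eq_iff algebra_simps
         add_divide_distrib diff_divide_distrib)
qed

definition twist_plus :: "(complex^2 \<Rightarrow> complex) \<Rightarrow> complex^2 \<Rightarrow> complex" where
  "twist_plus G p = (pd (J_j p) G p + \<i> * pd (J_k p) G p) / 2"

lemma twist_minus_harmonic:
  "twist_minus (harmonic p q i) = (\<lambda>x. of_nat p * harmonic (p - 1) (q + 1) i x)"
  by (rule ext)
     (simp add: twist_minus_eq_derivative[OF harmonic_has_derivative] harmonic_derivative_J
          algebra_simps)

lemma twist_plus_harmonic:
  "twist_plus (harmonic p q i) = (\<lambda>x. - of_nat q * harmonic (p + 1) (q - 1) i x)"
  by (rule ext)
     (simp add: twist_plus_def pd_eq_derivative[OF harmonic_has_derivative] harmonic_derivative_J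
          algebra_simps)

definition bihom :: "nat \<Rightarrow> nat \<Rightarrow> (complex^2 \<Rightarrow> complex) set" where
  "bihom p q = fs.span (range (harmonic p q))"

lemma subspace_bihom: "fs.subspace (bihom p q)"
  by (simp add: bihom_def)

lemmas bihom_closed = subspace_funD[OF subspace_bihom]

lemma harmonic_in_bihom: "harmonic p q i \<in> bihom p q"
  by (simp add: bihom_def fs.span_base)

lemma bihom_induct [consumes 1, case_names zero step]:
  assumes "f \<in> bihom p q" and "P (\<lambda>x. 0)"
    and "\<And>c i f. f \<in> bihom p q \<Longrightarrow> P f \<Longrightarrow> P (\<lambda>x. c * harmonic p q i x + f x)"
  shows "P f"
  using assms(1) unfolding bihom_def
  by (induction rule: span_fun_induct) (use assms(2,3) in \<open>auto simp: bihom_def\<close>)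

lemma bihom_differentiable: "f \<in> bihom p q \<Longrightarrow> f differentiable (at x)"
proof (induction rule: bihom_induct)
  case (step c i f)
  have "harmonic p q i differentiable (at x)"
    unfolding differentiable_def by (rule exI) (rule harmonic_has_derivative)
  with step.IH show ?case by simp
qed simp

lemma bihom_smult: "f \<in> bihom p q \<Longrightarrow> f (w *s x) = w ^ p * cnj w ^ q * f x"
proof (induction rule: bihom_induct)
  case (step c i f)
  have "lform (w *s x) = smult w (lform x)" "cnj_lform (w *s x) = smult (cnj w) (cnj_lform x)"
    by (simp_all add: lform_def cnj_lform_def)
  then have "lform (w *s x) ^ p * cnj_lform (w *s x) ^ q
      = smult (w ^ p * cnj w ^ q) (lform x ^ p * cnj_lform x ^ q)"
    by (simp add: smult_power mult.commute)
  then have "harmonic p q i (w *s x) = w ^ p * cnj w ^ q * harmonic p q i x"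
    by (simp add: harmonic_def)
  then show ?case by (simp add: step.IH algebra_simps)
qed simp

lemma smult_S3_cases:
  obtains w y where "y \<in> S3" "x = w *s y"
proof (cases "x = 0")
  case True
  have "ex \<in> S3" by (simp add: S3_def ex_def norm_eq_1 inner_complex_vec2)
  with True show ?thesis by (intro that[of ex 0]) (auto simp: vec2_eq_iff)
next
  case False
  then show ?thesis
    by (intro that[of "sgn x" "of_real (norm x)"])
       (simp_all add: S3_def norm_sgn vec_eq_iff sgn_div_norm scaleR_conv_of_real[where 'a = complex])
qed

lemma bihom_eq_0I:
  assumes f_bihom: "f \<in> bihom p q" and zero: "\<And>x. x \<in> S3 \<Longrightarrow> f x = 0"
  shows "f x = 0"
  by (rule smult_S3_cases[of x]) (simp add: bihom_smult[OF f_bihom] zero)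

lemma pd_combination:
  assumes "f differentiable (at x)" "g differentiable (at x)"
  shows "pd v (\<lambda>x. c * f x + g x) x = c * pd v f x + pd v g x"
proof -
  obtain Df Dg where derivatives: "(f has_derivative Df) (at x)" "(g has_derivative Dg) (at x)"
    using assms by (auto simp: differentiable_def)
  then have "((\<lambda>x. c * f x + g x) has_derivative (\<lambda>h. c * Df h + Dg h)) (at x)"
    by (intro has_derivative_add has_derivative_mult_right)
  from pd_eq_derivative[OF this] show ?thesis
    by (simp add: pd_eq_derivative[OF derivatives(1)] pd_eq_derivative[OF derivatives(2)])
qed

lemma twist_combination:
  assumes "f \<in> bihom p q" "g \<in> bihom p q"
  shows "twist_minus (\<lambda>x. c * f x + g x) = (\<lambda>x. c * twist_minus f x + twist_minus g x)"
    and "twist_plus (\<lambda>x. c * f x + g x) = (\<lambda>x. c * twist_plus f x + twist_plus g x)"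
  unfolding twist_minus_def d_alpha_def d_beta_def twist_plus_def
    pd_combination[OF assms[THEN bihom_differentiable]]
  by (simp_all add: fun_eq_iff field_simps)

lemma twist_mult:
  assumes "f \<in> bihom p q"
  shows "twist_minus (\<lambda>x. c * f x) = (\<lambda>x. c * twist_minus f x)"
    and "twist_plus (\<lambda>x. c * f x) = (\<lambda>x. c * twist_plus f x)"
  using twist_combination[OF assms assms, of "c - 1"] by (simp_all add: algebra_simps)

lemma twist_0: "twist_minus (\<lambda>x. 0) = (\<lambda>x. 0)" "twist_plus (\<lambda>x. 0) = (\<lambda>x. 0)"
  using twist_mult[OF bihom_closed(1), of 0] by simp_all

lemma twist_minus_bihom: "f \<in> bihom p q \<Longrightarrow> twist_minus f \<in> bihom (p - 1) (q + 1)"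
proof (induction rule: bihom_induct)
  case zero
  show ?case by (simp add: twist_0 bihom_closed)
next
  case (step c i f)
  then show ?case
    unfolding twist_combination(1)[OF harmonic_in_bihom step.hyps] twist_minus_harmonic
    by (intro bihom_closed harmonic_in_bihom)
qed

lemma twist_plus_twist_minus:
  "f \<in> bihom p q \<Longrightarrow> twist_plus (twist_minus f) = (\<lambda>x. - of_nat (p * (q + 1)) * f x)"
proof (induction rule: bihom_induct)
  case zero
  show ?case by (simp add: twist_0)
next
  case (step c i f)
  have "twist_plus (twist_minus (harmonic p q i)) = (\<lambda>x. - of_nat (p * (q + 1)) * harmonic p q i x)"
    unfolding twist_minus_harmonic twist_mult(2)[OF harmonic_in_bihom] twist_plus_harmonic
    by (cases p) (simp_all add: algebra_simps)
  note harmonic = this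
  show ?case
    unfolding twist_combination(1)[OF harmonic_in_bihom step.hyps]
      twist_combination(2)[OF twist_minus_bihom[OF harmonic_in_bihom] twist_minus_bihom[OF step.hyps]]
      step.IH harmonic
    by (simp only: distrib_left mult.left_commute)
qed

lemma twist_minus_power_bihom: "f \<in> bihom p q \<Longrightarrow> (twist_minus ^^ j) f \<in> bihom (p - j) (q + j)"
proof (induction j)
  case (Suc j)
  then show ?case using twist_minus_bihom[OF Suc.IH] by simp
qed simp

lemma twist_minus_power_combination:
  assumes f_bihom: "f \<in> bihom p q" and g_bihom: "g \<in> bihom p q"
  shows "(twist_minus ^^ j) (\<lambda>x. c * f x + g x)
      = (\<lambda>x. c * (twist_minus ^^ j) f x + (twist_minus ^^ j) g x)"
proof (induction j)
  case (Suc j)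
  then show ?case
    by (simp add: twist_combination(1)[OF twist_minus_power_bihom[OF f_bihom]
         twist_minus_power_bihom[OF g_bihom]])
qed simp

lemma twist_minus_power_0: "(twist_minus ^^ j) (\<lambda>x. 0) = (\<lambda>x. 0)"
  by (induction j) (simp_all add: twist_0)

lemma twist_minus_power_sum:
  assumes "finite S" "\<And>s. s \<in> S \<Longrightarrow> f s \<in> bihom p q"
  shows "(twist_minus ^^ j) (\<lambda>x. \<Sum>s\<in>S. c s * f s x) = (\<lambda>x. \<Sum>s\<in>S. c s * (twist_minus ^^ j) (f s) x)"
  using assms
proof (induction rule: finite_induct)
  case empty
  show ?case by (simp add: twist_minus_power_0)
next
  case (insert s S)
  have "(\<lambda>x. \<Sum>s\<in>S. c s * f s x) \<in> bihom p q"
    using insert.prems by (intro subspace_fun_sum[OF subspace_bihom] bihom_closed) auto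
  then show ?case
    using insert twist_minus_power_combination[of "f s" p q "\<lambda>x. \<Sum>s\<in>S. c s * f s x"] by simp
qed

lemma twist_minus_power_harmonic:
  assumes "j \<le> k"
  shows "(twist_minus ^^ j) (harmonic k 0 i) = (\<lambda>x. fact k / fact (k - j) * harmonic (k - j) j i x)"
  using assms
proof (induction j)
  case (Suc j)
  then have "(twist_minus ^^ Suc j) (harmonic k 0 i)
      = twist_minus (\<lambda>x. fact k / fact (k - j) * harmonic (k - j) j i x)" by simp
  also have "\<dots> = (\<lambda>x. fact k / fact (k - j) * (of_nat (k - j) * harmonic (k - j - 1) (j + 1) i x))"
    unfolding twist_mult(1)[OF harmonic_in_bihom] twist_minus_harmonic ..
  finally have "(twist_minus ^^ Suc j) (harmonic k 0 i)
      = (\<lambda>x. fact k / fact (k - j) * (of_nat (k - j) * harmonic (k - j - 1) (j + 1) i x))" .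
  moreover have "fact (k - j) = of_nat (k - j) * (fact (k - Suc j) :: complex)"
    using Suc.prems by (simp add: fact_reduce)
  ultimately show ?case using Suc.prems by (simp add: fun_eq_iff)
qed simp

lemma twist_minus_power_eq_0D:
  assumes f_bihom: "f \<in> bihom k 0" and "j \<le> k" "(twist_minus ^^ j) f = (\<lambda>x. 0)"
  shows "f = (\<lambda>x. 0)"
  using assms(2,3)
proof (induction j)
  case (Suc j)
  have "twist_plus (twist_minus ((twist_minus ^^ j) f)) = (\<lambda>x. 0)"
    using Suc.prems by (simp add: twist_0)
  then have "(\<lambda>x. - of_nat ((k - j) * (0 + j + 1)) * (twist_minus ^^ j) f x) = (\<lambda>x. 0)"
    unfolding twist_plus_twist_minus[OF twist_minus_power_bihom[OF f_bihom]] .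
  then have "(twist_minus ^^ j) f = (\<lambda>x. 0)"
    using Suc.prems by (simp add: fun_eq_iff del: of_nat_mult of_nat_add of_nat_Suc)
  then show ?case using Suc by simp
qed simp

definition binary_forms :: "nat \<Rightarrow> (complex^2 \<Rightarrow> complex) set" where
  "binary_forms k = fs.span ((\<lambda>i x. x$1 ^ i * x$2 ^ (k - i)) ` {..k})"

lemma subspace_binary_forms: "fs.subspace (binary_forms k)"
  by (simp add: binary_forms_def)

lemmas binary_forms_closed = subspace_funD[OF subspace_binary_forms]

lemma monomial_in_binary_forms: "(\<lambda>x. x$1 ^ i * x$2 ^ j) \<in> binary_forms (i + j)"
  unfolding binary_forms_def by (rule fs.span_base) (auto intro!: image_eqI[of _ _ i])

lemma harmonic_eq_monomial:
  "i \<le> k \<Longrightarrow> harmonic k 0 i = (\<lambda>x. of_nat (k choose i) * (x$1 ^ i * x$2 ^ (k - i)))"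
  by (simp add: fun_eq_iff harmonic_def lform_def coeff_linear_poly_power mult.assoc)

lemma binary_forms_eq_bihom: "binary_forms k = bihom k 0"
proof
  have "(\<lambda>x. x$1 ^ i * x$2 ^ (k - i)) = (\<lambda>x. 1 / of_nat (k choose i) * harmonic k 0 i x)"
    if "i \<le> k" for i
    using that by (simp add: harmonic_eq_monomial fun_eq_iff)
  then show "binary_forms k \<subseteq> bihom k 0"
    unfolding binary_forms_def
    by (intro fs.span_minimal subspace_bihom image_subsetI)
        (simp only: atMost_iff bihom_closed harmonic_in_bihom)
  have "harmonic k 0 i \<in> binary_forms k" for i
  proof (cases "i \<le> k")
    case True
    then show ?thesis
      using binary_forms_closed(2)[OF monomial_in_binary_forms[of i "k - i"],
          of "of_nat (k choose i)"]
      by (simp add: harmonic_eq_monomial)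
  next
    case False
    then have "harmonic k 0 i = (\<lambda>x. 0)" by (simp add: fun_eq_iff harmonic_eq_0)
    then show ?thesis by (simp add: binary_forms_closed)
  qed
  then show "bihom k 0 \<subseteq> binary_forms k"
    unfolding bihom_def by (intro fs.span_minimal subspace_binary_forms) auto
qed

lemma restrS3_bihom_in_eigenspace: "f \<in> bihom p q \<Longrightarrow> restrS3 f \<in> eigenspace (p + q)"
proof (induction rule: bihom_induct)
  case zero
  have "restrS3 (\<lambda>x. 0) = (\<lambda>x. 0)" by (simp add: fun_eq_iff restrS3_def)
  then show ?case by (simp add: subspace_funD[OF subspace_eigenspace])
next
  case (step c i f)
  have "restrS3 (\<lambda>x. c * harmonic p q i x + f x) = (\<lambda>x. c * restrS3 (harmonic p q i) x + restrS3 f x)"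
    by (simp add: fun_eq_iff restrS3_def)
  with step.IH show ?case
    by (simp add: subspace_funD[OF subspace_eigenspace] restrS3_harmonic_in_eigenspace)
qed

lemma sibling_in_eigenspace:
  assumes "f \<in> binary_forms k" "j \<le> k"
  shows "restrS3 ((twist_minus ^^ j) f) \<in> eigenspace k"
  using restrS3_bihom_in_eigenspace[OF twist_minus_power_bihom[of f k 0 j]] assms
  by (simp add: binary_forms_eq_bihom)

lemma infinite_unit_circle: "infinite (sphere (0::complex) 1)"
proof
  assume "finite (sphere (0::complex) 1)"
  moreover have "connected (sphere (0::complex) 1)" by (rule connected_sphere) simp
  ultimately obtain a where "sphere (0::complex) 1 = {a}"
    using connected_finite_iff_sing by (metis sphere_eq_empty zero_le_one linorder_not_less)
  moreover have "1 \<in> sphere (0::complex) 1" "-1 \<in> sphere (0::complex) 1" by auto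
  ultimately show False by (metis one_neq_neg_one singletonD)
qed

lemma weights_separate:
  fixes c :: "nat \<Rightarrow> complex"
  assumes sum: "\<And>w. cmod w = 1 \<Longrightarrow> (\<Sum>j\<le>k. w ^ (k - j) * cnj w ^ j * c j) = 0" and j_le: "j \<le> k"
  shows "c j = 0"
proof -
  define P where "P = (\<Sum>j\<le>k. monom (c j) (2 * (k - j)))"
  have "poly P w = 0" if w_in_sphere: "w \<in> sphere 0 1" for w
  proof -
    have unit: "w * cnj w = 1" using w_in_sphere complex_norm_square[of w] by simp
    have "w ^ k * (w ^ (k - j) * cnj w ^ j) = w ^ (2 * (k - j))" if "j \<le> k" for j
    proof -
      have "w ^ k * (w ^ (k - j) * cnj w ^ j) = w ^ (k - j) * w ^ (k - j) * (w * cnj w) ^ j"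
        using that power_add[of w "k - j" j] by (simp add: power_mult_distrib mult_ac)
      then show ?thesis by (simp add: unit mult_2 power_add)
    qed
    then have "poly P w = w ^ k * (\<Sum>j\<le>k. w ^ (k - j) * cnj w ^ j * c j)"
      unfolding P_def poly_sum sum_distrib_left
      by (intro sum.cong) (simp_all add: poly_monom mult.assoc[symmetric] mult.commute[of "c _"])
    then show ?thesis using sum[of w] w_in_sphere by simp
  qed
  then have "sphere 0 1 \<subseteq> {w. poly P w = 0}" by auto
  then have "P = 0" using infinite_unit_circle poly_roots_finite finite_subset by metis
  then have "0 = coeff P (2 * (k - j))" by simp
  also have "\<dots> = (\<Sum>i\<le>k. if i = j then c i else 0)"
    unfolding P_def coeff_sum using j_le by (intro sum.cong) auto
  finally show ?thesis using j_le by simp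
qed

definition sibling_sum :: "nat \<Rightarrow> (nat \<Rightarrow> complex^2 \<Rightarrow> complex) \<Rightarrow> complex^2 \<Rightarrow> complex" where
  "sibling_sum k f = restrS3 (\<lambda>x. \<Sum>j\<le>k. (twist_minus ^^ j) (f j) x)"

lemma sibling_sum_eq_0D:
  assumes "\<And>j. f j \<in> binary_forms k" and zero: "\<And>x. x \<in> S3 \<Longrightarrow> sibling_sum k f x = 0" and j_le: "j \<le> k"
  shows "f j = (\<lambda>x. 0)"
proof -
  have f_bihom: "f j \<in> bihom k 0" for j using assms(1) by (simp add: binary_forms_eq_bihom)
  have "(twist_minus ^^ j) (f j) x = 0" if x_in_S3: "x \<in> S3" for x
  proof (rule weights_separate[OF _ j_le])
    fix w :: complex assume norm_w: "cmod w = 1"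
    have "w *s x \<in> S3"
      using x_in_S3 norm_w by (simp add: S3_def norm_vec_def L2_set_def norm_mult)
    then have "0 = (\<Sum>j\<le>k. (twist_minus ^^ j) (f j) (w *s x))"
      using zero[of "w *s x"] by (simp add: sibling_sum_def restrS3_def)
    also have "\<dots> = (\<Sum>j\<le>k. w ^ (k - j) * cnj w ^ j * (twist_minus ^^ j) (f j) x)"
      using bihom_smult[OF twist_minus_power_bihom[OF f_bihom]] by simp
    finally show "(\<Sum>j\<le>k. w ^ (k - j) * cnj w ^ j * (twist_minus ^^ j) (f j) x) = 0" ..
  qed
  then have "(twist_minus ^^ j) (f j) = (\<lambda>x. 0)"
    using bihom_eq_0I[OF twist_minus_power_bihom[OF f_bihom]] by blast
  then show ?thesis by (rule twist_minus_power_eq_0D[OF f_bihom j_le])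
qed

lemma sibling_sum_combination:
  assumes "\<And>j. f j \<in> binary_forms k" "\<And>j. g j \<in> binary_forms k"
  shows "sibling_sum k (\<lambda>j x. c * f j x + g j x) = (\<lambda>x. c * sibling_sum k f x + sibling_sum k g x)"
proof -
  have "(twist_minus ^^ j) (\<lambda>x. c * f j x + g j x)
      = (\<lambda>x. c * (twist_minus ^^ j) (f j) x + (twist_minus ^^ j) (g j) x)" for j
    using assms by (intro twist_minus_power_combination) (simp_all add: binary_forms_eq_bihom)
  then show ?thesis
    by (simp add: sibling_sum_def fun_eq_iff restrS3_def sum.distrib sum_distrib_left)
qed

lemma sibling_sum_single:
  assumes "j \<le> k"
  shows "sibling_sum k (\<lambda>l. if l = j then f else (\<lambda>x. 0)) = restrS3 ((twist_minus ^^ j) f)"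
proof -
  have "(\<Sum>l\<le>k. (twist_minus ^^ l) (if l = j then f else (\<lambda>x. 0)) x)
      = (\<Sum>l\<le>k. if l = j then (twist_minus ^^ j) f x else 0)" for x
    by (intro sum.cong) (auto simp: twist_minus_power_0)
  then show ?thesis using assms by (simp add: sibling_sum_def)
qed

lemma subspace_sibling_sums:
  assumes subspace_V: "fs.subspace V" "V \<subseteq> binary_forms k"
  shows "fs.subspace {sibling_sum k f | f. \<forall>j. f j \<in> V}" (is "fs.subspace ?S")
proof (rule subspace_funI)
  have "sibling_sum k (\<lambda>j x. 0) = (\<lambda>x. 0)"
    by (simp add: sibling_sum_def twist_minus_power_0 restrS3_def fun_eq_iff)
  then show "(\<lambda>x. 0) \<in> ?S"
    by (intro CollectI exI[of _ "\<lambda>j x. 0"]) (simp add: subspace_funD[OF subspace_V(1)])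
  fix c u v assume "u \<in> ?S" "v \<in> ?S"
  then obtain f g where u_eq: "u = sibling_sum k f" "\<And>j. f j \<in> V"
      and v_eq: "v = sibling_sum k g" "\<And>j. g j \<in> V"
    by auto
  moreover have "sibling_sum k (\<lambda>j x. c * f j x + g j x)
      = (\<lambda>x. c * sibling_sum k f x + sibling_sum k g x)"
    using u_eq v_eq subspace_V(2) by (intro sibling_sum_combination) auto
  ultimately show "(\<lambda>x. c * u x + v x) \<in> ?S"
    by (intro CollectI exI[of _ "\<lambda>j x. c * f j x + g j x"])
        (simp add: subspace_funD[OF subspace_V(1)])
qed

theorem eigenspace_eq_sibling_sums:
  "eigenspace k = {sibling_sum k f | f. \<forall>j. f j \<in> binary_forms k}" (is "_ = ?V")
proof
  have subspace: "fs.subspace ?V"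
    by (rule subspace_sibling_sums[OF subspace_binary_forms subset_refl])
  have "restrS3 (harmonic (k - j) j i) \<in> ?V" if "j \<le> k" for j i
  proof -
    define f where "f l = (if l = j then harmonic k 0 i else (\<lambda>x. 0))" for l
    have "restrS3 (harmonic (k - j) j i) = (\<lambda>x. fact (k - j) / fact k * sibling_sum k f x)"
      unfolding f_def sibling_sum_single[OF that]
      by (simp add: twist_minus_power_harmonic[OF that] fun_eq_iff restrS3_def)
    moreover have "sibling_sum k f \<in> ?V"
      by (intro CollectI exI[of _ f]) (simp add: f_def binary_forms_eq_bihom harmonic_in_bihom
           bihom_closed)
    ultimately show ?thesis by (simp only: subspace_funD(2)[OF subspace])
  qed
  then show "eigenspace k \<subseteq> ?V"
    unfolding eigenspace_eq_span_harmonic by (intro fs.span_minimal subspace) auto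
  have "sibling_sum k f = (\<lambda>x. \<Sum>j\<le>k. restrS3 ((twist_minus ^^ j) (f j)) x)" for f
    by (simp add: fun_eq_iff sibling_sum_def restrS3_def)
  then show "?V \<subseteq> eigenspace k"
    by (auto intro!: subspace_fun_sum[OF subspace_eigenspace] sibling_in_eigenspace)
qed

section \<open>Group actions\<close>

lemma matrix_inv_eqI:
  fixes A B :: "'a::field^'n^'n"
  assumes "A ** B = mat 1"
  shows "matrix_inv A = B"
proof -
  have left_inverse: "B ** A = mat 1" using assms by (simp add: matrix_left_right_inverse)
  have "A ** matrix_inv A = mat 1 \<and> matrix_inv A ** A = mat 1"
    unfolding matrix_inv_def by (rule someI[of _ B]) (use assms left_inverse in blast)
  then have "B ** (A ** matrix_inv A) = B" by simp
  then show ?thesis by (simp add: matrix_mul_assoc left_inverse)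
qed

lemma mat2_mult_vec: "mat2 a b c d *v x = pt (a * x$1 + b * x$2) (c * x$1 + d * x$2)"
  by (simp add: mat2_def matrix_vector_mult_def vec2_eq_iff sum_2)

lemma mat2_mult: "mat2 a b c d ** mat2 a' b' c' d'
    = mat2 (a * a' + b * c') (a * b' + b * d') (c * a' + d * c') (c * b' + d * d')"
  by (simp add: mat2_def matrix_matrix_mult_def vec2_eq_iff sum_2)

lemma mat2_one: "mat 1 = mat2 1 0 0 1"
  by (simp add: mat2_def mat_def vec2_eq_iff)

definition SU2 :: "(complex^2^2) set" where
  "SU2 = {mat2 a b (- cnj b) (cnj a) | a b. a * cnj a + b * cnj b = 1}"

lemma SU2_inverse:
  assumes "A \<in> SU2"
  shows "A ** matrix_inv A = mat 1" and "matrix_inv A ** A = mat 1" and "matrix_inv A \<in> SU2"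
proof -
  obtain a b where A_eq: "A = mat2 a b (- cnj b) (cnj a)" and det: "a * cnj a + b * cnj b = 1"
    using assms by (auto simp: SU2_def)
  have "A ** mat2 (cnj a) (- b) (cnj b) a = mat 1"
    using det by (simp add: A_eq mat2_mult mat2_one mult.commute add.commute)
  then have inv: "matrix_inv A = mat2 (cnj a) (- b) (cnj b) a" by (rule matrix_inv_eqI)
  show right: "A ** matrix_inv A = mat 1" unfolding inv by fact
  then show "matrix_inv A ** A = mat 1" by (simp add: matrix_left_right_inverse)
  show "matrix_inv A \<in> SU2"
    unfolding SU2_def inv using det
    by (intro CollectI exI[of _ "cnj a"] exI[of _ "- b"]) (simp add: mult.commute)
qed

lemma SU2_mult:
  assumes "A \<in> SU2" "B \<in> SU2"
  shows "A ** B \<in> SU2"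
proof -
  obtain a b c d where A_eq: "A = mat2 a b (- cnj b) (cnj a)" "a * cnj a + b * cnj b = 1"
    and B_eq: "B = mat2 c d (- cnj d) (cnj c)" "c * cnj c + d * cnj d = 1"
    using assms by (auto simp: SU2_def)
  define u v where "u = a * c - b * cnj d" and "v = a * d + b * cnj c"
  have "A ** B = mat2 u v (- cnj v) (cnj u)"
    by (simp add: A_eq(1) B_eq(1) mat2_mult u_def v_def algebra_simps)
  moreover have "u * cnj u + v * cnj v = (a * cnj a + b * cnj b) * (c * cnj c + d * cnj d)"
    by (simp add: u_def v_def algebra_simps)
  ultimately show ?thesis using A_eq(2) B_eq(2) by (auto simp: SU2_def)
qed

lemma SU2_commute_J:
  assumes "A \<in> SU2"
  shows "A *v J_j x = J_j (A *v x)" and "A *v J_k x = J_k (A *v x)"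
proof -
  obtain a b where A_eq: "A = mat2 a b (- cnj b) (cnj a)" using assms by (auto simp: SU2_def)
  show "A *v J_j x = J_j (A *v x)" and "A *v J_k x = J_k (A *v x)"
    unfolding A_eq by (simp_all add: mat2_mult_vec J_j_def J_k_def vec2_eq_iff algebra_simps)
qed

lemma SU2_vec_in_S3:
  assumes "A \<in> SU2" "x \<in> S3"
  shows "A *v x \<in> S3"
proof -
  obtain a b where A_eq: "A = mat2 a b (- cnj b) (cnj a)" and det: "a * cnj a + b * cnj b = 1"
    using assms(1) by (auto simp: SU2_def)
  let ?y = "A *v x"
  have "complex_of_real ((cmod (?y$1))\<^sup>2 + (cmod (?y$2))\<^sup>2) = ?y$1 * cnj (?y$1) + ?y$2 * cnj (?y$2)"
    by (simp only: of_real_add complex_norm_square)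
  also have "\<dots> = (a * cnj a + b * cnj b) * (x$1 * cnj (x$1) + x$2 * cnj (x$2))"
    by (simp add: A_eq mat2_mult_vec algebra_simps)
  finally have "(cmod (?y$1))\<^sup>2 + (cmod (?y$2))\<^sup>2 = 1"
    unfolding det S3_sum_squares[OF assms(2)] by (simp only: mult_1 of_real_eq_1_iff)
  then show ?thesis by (simp add: S3_def norm_eq_1 inner_complex_vec2 power2_norm_eq_inner)
qed

lemma Ract_eq_iff:
  assumes "A \<in> SU2"
  shows "Ract A f = f \<longleftrightarrow> (\<forall>x. f (A *v x) = f x)"
proof
  assume "Ract A f = f"
  then have "f (matrix_inv A *v (A *v x)) = f (A *v x)" for x by (simp add: Ract_def fun_eq_iff)
  then show "\<forall>x. f (A *v x) = f x"
    by (simp add: matrix_vector_mul_assoc SU2_inverse[OF assms])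
next
  assume "\<forall>x. f (A *v x) = f x"
  then have "f (A *v (matrix_inv A *v x)) = f (matrix_inv A *v x)" for x by blast
  then show "Ract A f = f"
    by (simp add: Ract_def fun_eq_iff matrix_vector_mul_assoc SU2_inverse[OF assms])
qed

lemma twist_minus_Ract:
  assumes A_SU2: "A \<in> SU2" and f_differentiable: "\<And>x. f differentiable (at x)"
  shows "twist_minus (Ract A f) = Ract A (twist_minus f)"
proof
  fix x
  let ?B = "matrix_inv A"
  obtain D where f_derivative: "(f has_derivative D) (at (?B *v x))"
    using f_differentiable by (auto simp: differentiable_def)
  have "((\<lambda>x. ?B *v x) has_derivative (\<lambda>x. ?B *v x)) (at x)"
    by (intro bounded_linear_imp_has_derivative) (simp flip: linear_conv_bounded_linear)
  from has_derivative_compose[OF this f_derivative]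
  have "(Ract A f has_derivative (\<lambda>v. D (?B *v v))) (at x)" by (simp add: Ract_def[abs_def])
  then show "twist_minus (Ract A f) x = Ract A (twist_minus f) x"
    by (simp add: twist_minus_eq_derivative[OF f_derivative] twist_minus_eq_derivative Ract_def
        SU2_commute_J[OF SU2_inverse(3)[OF A_SU2]])
qed

lemma twist_minus_power_Ract:
  assumes A_SU2: "A \<in> SU2" and f_bihom: "f \<in> bihom p q"
  shows "(twist_minus ^^ j) (Ract A f) = Ract A ((twist_minus ^^ j) f)"
  by (induction j) (simp_all add: twist_minus_Ract[OF A_SU2]
       bihom_differentiable[OF twist_minus_power_bihom[OF f_bihom]])

lemma binary_forms_induct [consumes 1, case_names zero step]:
  assumes "f \<in> binary_forms k" and "P (\<lambda>x. 0)"
    and "\<And>c i f. i \<le> k \<Longrightarrow> P f \<Longrightarrow> P (\<lambda>x. c * (x$1 ^ i * x$2 ^ (k - i)) + f x)"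
  shows "P f"
  using assms(1) unfolding binary_forms_def
  by (induction rule: span_fun_induct) (use assms(2,3) in auto)

lemma binary_forms_mult:
  assumes "f \<in> binary_forms k" "g \<in> binary_forms l"
  shows "(\<lambda>x. f x * g x) \<in> binary_forms (k + l)"
  using assms(1)
proof (induction rule: binary_forms_induct)
  case zero
  show ?case by (simp add: binary_forms_closed)
next
  case (step c i f)
  have "(\<lambda>x. x$1 ^ i * x$2 ^ (k - i) * g x) \<in> binary_forms (k + l)"
    using assms(2)
  proof (induction rule: binary_forms_induct)
    case zero
    show ?case by (simp add: binary_forms_closed)
  next
    case (step d j g)
    have "(\<lambda>x. x$1 ^ (i + j) * x$2 ^ (k - i + (l - j))) \<in> binary_forms (k + l)"
      using monomial_in_binary_forms[of "i + j" "k - i + (l - j)"] \<open>i \<le> k\<close> \<open>j \<le> l\<close> by simp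
    from binary_forms_closed(3)[OF binary_forms_closed(2)[OF this] step.IH, of d]
    show ?case by (simp add: power_add algebra_simps)
  qed
  from binary_forms_closed(3)[OF binary_forms_closed(2)[OF this] step.IH, of c]
  show ?case by (simp add: algebra_simps)
qed

lemma binary_forms_power:
  assumes "f \<in> binary_forms k"
  shows "(\<lambda>x. f x ^ n) \<in> binary_forms (n * k)"
proof (induction n)
  case 0
  show ?case using monomial_in_binary_forms[of 0 0] by simp
next
  case (Suc n)
  then show ?case using binary_forms_mult[OF assms Suc] by simp
qed

lemma Ract_binary_forms:
  assumes A_SU2: "A \<in> SU2" and f_form: "f \<in> binary_forms k"
  shows "Ract A f \<in> binary_forms k"
proof -
  obtain a b c d where inverse_eq: "matrix_inv A = mat2 a b c d"
    using SU2_inverse(3)[OF A_SU2] by (auto simp: SU2_def)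
  have linear: "(\<lambda>x. a * x$1 + b * x$2) \<in> binary_forms 1" for a b
    using binary_forms_closed(3)[OF binary_forms_closed(2) binary_forms_closed(2),
        of "\<lambda>x. x$1" 1 "\<lambda>x. x$2" a b]
      monomial_in_binary_forms[of 1 0] monomial_in_binary_forms[of 0 1] by simp
  show ?thesis
    using f_form
  proof (induction rule: binary_forms_induct)
    case zero
    show ?case by (simp add: Ract_def[abs_def] binary_forms_closed)
  next
    case (step e i f)
    have "(\<lambda>x. (a * x$1 + b * x$2) ^ i * (c * x$1 + d * x$2) ^ (k - i)) \<in> binary_forms k"
      using binary_forms_mult[OF binary_forms_power[OF linear[of a b]]
           binary_forms_power[OF linear[of c d]], of i "k - i"]
        \<open>i \<le> k\<close> by simp
    from binary_forms_closed(3)[OF binary_forms_closed(2)[OF this] step.IH, of e]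
    show ?case by (simp add: Ract_def[abs_def] inverse_eq mat2_mult_vec)
  qed
qed

definition invariant_forms :: "(complex^2^2) set \<Rightarrow> nat \<Rightarrow> (complex^2 \<Rightarrow> complex) set" where
  "invariant_forms \<Gamma> k = {f \<in> binary_forms k. \<forall>\<gamma>\<in>\<Gamma>. Ract \<gamma> f = f}"

lemma subspace_invariant_forms: "fs.subspace (invariant_forms \<Gamma> k)"
  by (rule subspace_funI) (auto simp: invariant_forms_def binary_forms_closed Ract_def fun_eq_iff)

lemma Ract_sibling_sum:
  assumes A_SU2: "A \<in> SU2" and f_form: "\<And>j. f j \<in> binary_forms k" and x_in_S3: "x \<in> S3"
  shows "Ract A (sibling_sum k f) x = sibling_sum k (\<lambda>j. Ract A (f j)) x"
proof -
  have "(twist_minus ^^ j) (Ract A (f j)) = Ract A ((twist_minus ^^ j) (f j))" for j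
    using f_form by (intro twist_minus_power_Ract[OF A_SU2]) (simp add: binary_forms_eq_bihom)
  moreover have "matrix_inv A *v x \<in> S3" by (rule SU2_vec_in_S3[OF SU2_inverse(3)[OF A_SU2] x_in_S3])
  ultimately show ?thesis using x_in_S3 by (simp add: sibling_sum_def restrS3_def Ract_def)
qed

lemma invariant_sibling_sumD:
  assumes A_SU2: "A \<in> SU2" and f_form: "\<And>j. f j \<in> binary_forms k" and j_le: "j \<le> k"
    and invariant: "\<And>x. x \<in> S3 \<Longrightarrow> Ract A (sibling_sum k f) x = sibling_sum k f x"
  shows "Ract A (f j) = f j"
proof -
  let ?d = "\<lambda>j x. - 1 * f j x + Ract A (f j) x"
  have Ract_f_form: "Ract A (f j) \<in> binary_forms k" for j by (rule Ract_binary_forms[OF A_SU2 f_form])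
  have "sibling_sum k ?d x = 0" if "x \<in> S3" for x
    using invariant[OF that] Ract_sibling_sum[OF A_SU2 f_form that]
    unfolding sibling_sum_combination[of f k "\<lambda>j. Ract A (f j)", OF f_form Ract_f_form] by simp
  moreover have "?d j \<in> binary_forms k" for j by (intro binary_forms_closed f_form Ract_f_form)
  ultimately have "?d j = (\<lambda>x. 0)" using j_le by (intro sibling_sum_eq_0D)
  then show ?thesis by (simp add: fun_eq_iff)
qed

theorem modes_eq_sibling_sums:
  assumes \<Gamma>_SU2: "\<Gamma> \<subseteq> SU2"
  shows "modes \<Gamma> k = {sibling_sum k f | f. \<forall>j. f j \<in> invariant_forms \<Gamma> k}"
proof (intro set_eqI iffI)
  have modes: "modes \<Gamma> k = {F \<in> eigenspace k. \<forall>\<gamma>\<in>\<Gamma>. \<forall>x\<in>S3. Ract \<gamma> F x = F x}"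
    by (auto simp: modes_def eigenspace_def)
  fix F
  show "F \<in> {sibling_sum k f | f. \<forall>j. f j \<in> invariant_forms \<Gamma> k}" if F_mode: "F \<in> modes \<Gamma> k"
  proof -
    obtain f where f_form: "\<And>j. f j \<in> binary_forms k" and F_eq: "F = sibling_sum k f"
      using F_mode by (auto simp: modes eigenspace_eq_sibling_sums)
    define g where "g j = (if j \<le> k then f j else (\<lambda>x. 0))" for j
    have "Ract \<gamma> (f j) = f j" if "\<gamma> \<in> \<Gamma>" "j \<le> k" for \<gamma> j
      using F_mode that \<Gamma>_SU2 by (intro invariant_sibling_sumD[OF _ f_form]) (auto simp: modes F_eq)
    then have "g j \<in> invariant_forms \<Gamma> k" for j
      using f_form by (auto simp: g_def invariant_forms_def binary_forms_closed Ract_def[abs_def])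
    moreover have "F = sibling_sum k g" by (simp add: F_eq sibling_sum_def g_def)
    ultimately show ?thesis by blast
  qed
  show "F \<in> modes \<Gamma> k" if F_in_sums: "F \<in> {sibling_sum k f | f. \<forall>j. f j \<in> invariant_forms \<Gamma> k}"
  proof -
    obtain f where "\<And>j. f j \<in> invariant_forms \<Gamma> k"
      and F_eq: "F = sibling_sum k f" using F_in_sums by auto
    then have f_invariant: "\<And>j. f j \<in> binary_forms k" "\<And>j \<gamma>. \<gamma> \<in> \<Gamma> \<Longrightarrow> Ract \<gamma> (f j) = f j"
      by (auto simp: invariant_forms_def)
    then have "Ract \<gamma> F x = F x" if "\<gamma> \<in> \<Gamma>" "x \<in> S3" for \<gamma> x
      using Ract_sibling_sum[of \<gamma> f k x] that \<Gamma>_SU2 by (auto simp: F_eq)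
    then show ?thesis using f_invariant(1) by (auto simp: modes eigenspace_eq_sibling_sums F_eq)
  qed
qed

lemma (in vector_space) span_family_eq:
  assumes "finite I"
  shows "span (g ` I) = range (\<lambda>c. \<Sum>i\<in>I. scale (c i) (g i))"
  using assms
proof (induction I rule: finite_induct)
  case (insert j I)
  have split: "(\<Sum>i\<in>insert j I. scale (c i) (g i)) = scale (c j) (g j) + (\<Sum>i\<in>I. scale (c i) (g i))"
      for c
    using insert.hyps by simp
  show ?case
  proof (intro set_eqI iffI)
    fix x assume "x \<in> span (g ` insert j I)"
    then obtain a c where "x - scale a (g j) = (\<Sum>i\<in>I. scale (c i) (g i))"
      using insert.IH by (auto simp: span_breakdown_eq)
    moreover have "(\<Sum>i\<in>I. scale (c i) (g i)) = (\<Sum>i\<in>I. scale ((c(j := a)) i) (g i))"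
      using insert.hyps by (intro sum.cong) auto
    ultimately have "x = (\<Sum>i\<in>insert j I. scale ((c(j := a)) i) (g i))"
      unfolding split by (simp add: algebra_simps)
    then show "x \<in> range (\<lambda>c. \<Sum>i\<in>insert j I. scale (c i) (g i))"
      by (rule range_eqI[where x = "c(j := a)"])
  next
    fix x assume "x \<in> range (\<lambda>c. \<Sum>i\<in>insert j I. scale (c i) (g i))"
    then obtain c where "x = (\<Sum>i\<in>insert j I. scale (c i) (g i))" by blast
    then show "x \<in> span (g ` insert j I)" by (simp only: span_sum span_scale span_base imageI)
  qed
qed simp

lemma (in vector_space) independent_family_iff:
  assumes finite_I: "finite I"
  shows "inj_on g I \<and> independent (g ` I) \<longleftrightarrow>
    (\<forall>c. (\<Sum>i\<in>I. scale (c i) (g i)) = 0 \<longrightarrow> (\<forall>i\<in>I. c i = 0))" (is "?L \<longleftrightarrow> ?R")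
proof
  assume independent: ?L
  show ?R
  proof (intro allI impI ballI)
    fix c i assume "(\<Sum>i\<in>I. scale (c i) (g i)) = 0" and i_in_I: "i \<in> I"
    then have "(\<Sum>v\<in>g ` I. scale (c (inv_into I g v)) v) = 0"
      using independent by (subst sum.reindex) auto
    then have "c (inv_into I g (g i)) = 0"
      using independent finite_I i_in_I independentD[of "g ` I" "g ` I" "\<lambda>v. c (inv_into I g v)"
           "g i"] by blast
    then show "c i = 0" using independent i_in_I by simp
  qed
next
  assume only_trivial: ?R
  have inj: "inj_on g I"
  proof (rule inj_onI, rule ccontr)
    fix i j assume collision: "i \<in> I" "j \<in> I" "g i = g j" "i \<noteq> j"
    define c where "c s = (if s = i then (1 :: 'a) else if s = j then - 1 else 0)" for s
    have "(\<Sum>s\<in>I. scale (c s) (g s)) = (\<Sum>s\<in>{i, j}. scale (c s) (g s))"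
      using finite_I collision by (intro sum.mono_neutral_right) (auto simp: c_def)
    also have "\<dots> = 0" using collision by (simp add: c_def)
    finally have "\<forall>s\<in>I. c s = 0" using only_trivial by blast
    then show False using collision(1) by (auto simp: c_def)
  qed
  moreover have "independent (g ` I)"
  proof (rule independent_if_scalars_zero)
    fix u v assume "(\<Sum>v\<in>g ` I. scale (u v) v) = 0" "v \<in> g ` I"
    then show "u v = 0"
      using only_trivial[rule_format, of "\<lambda>i. u (g i)"] by (auto simp: sum.reindex[OF inj])
  qed (use finite_I in simp)
  ultimately show ?L by blast
qed

lemmas span_fun_family_eq = fs.span_family_eq[unfolded sum_fscale]

lemma independent_fun_family_iff:
  assumes "finite I"
  shows "inj_on g I \<and> \<not> fs.dependent (g ` I) \<longleftrightarrow>
    (\<forall>c. (\<forall>x. (\<Sum>i\<in>I. c i * g i x) = 0) \<longrightarrow> (\<forall>i\<in>I. c i = 0))"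
  unfolding fs.independent_family_iff[OF assms] sum_fscale by (simp add: fun_eq_iff)

definition sibling :: "('i \<Rightarrow> complex^2 \<Rightarrow> complex) \<Rightarrow> 'i \<times> nat \<Rightarrow> complex^2 \<Rightarrow> complex" where
  "sibling f = (\<lambda>(s, j). restrS3 ((twist_minus ^^ j) (f s)))"

lemma sibling_sum_family:
  assumes finite_S: "finite S" and f_form: "\<And>s. s \<in> S \<Longrightarrow> f s \<in> binary_forms k"
  shows "sibling_sum k (\<lambda>j x. \<Sum>s\<in>S. c (s, j) * f s x) = (\<lambda>x. \<Sum>i\<in>S \<times> {..k}. c i * sibling f i x)"
proof -
  have "f s \<in> bihom k 0" if "s \<in> S" for s using f_form[OF that] by (simp add: binary_forms_eq_bihom)
  from twist_minus_power_sum[OF finite_S this]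
  have "sibling_sum k (\<lambda>j x. \<Sum>s\<in>S. c (s, j) * f s x)
      = restrS3 (\<lambda>x. \<Sum>j\<le>k. \<Sum>s\<in>S. c (s, j) * (twist_minus ^^ j) (f s) x)"
    by (simp add: sibling_sum_def)
  also have "\<dots> = (\<lambda>x. \<Sum>s\<in>S. \<Sum>j\<le>k. c (s, j) * sibling f (s, j) x)"
    by (subst sum.swap) (simp add: fun_eq_iff restrS3_def sibling_def)
  finally show ?thesis by (simp add: sum.cartesian_product case_prod_beta')
qed

theorem siblings_independent:
  assumes finite_S: "finite S" and f_form: "\<And>s. s \<in> S \<Longrightarrow> f s \<in> binary_forms k"
    and independent: "inj_on f S" "\<not> fs.dependent (f ` S)"
  shows "inj_on (sibling f) (S \<times> {..k}) \<and> \<not> fs.dependent (sibling f ` (S \<times> {..k}))"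
proof -
  have "\<forall>i\<in>S \<times> {..k}. c i = 0" if zero: "\<forall>x. (\<Sum>i\<in>S \<times> {..k}. c i * sibling f i x) = 0" for c
  proof -
    let ?h = "\<lambda>j x. \<Sum>s\<in>S. c (s, j) * f s x"
    have "?h j \<in> binary_forms k" for j
      using f_form by (intro subspace_fun_sum[OF subspace_binary_forms] binary_forms_closed)
    moreover have "sibling_sum k ?h x = 0" for x
      using zero sibling_sum_family[of S f k c] finite_S f_form by (simp add: fun_eq_iff)
    ultimately have "?h j = (\<lambda>x. 0)" if "j \<le> k" for j using that by (intro sibling_sum_eq_0D)
    then have forms_0: "\<forall>x. ?h j x = 0" if "j \<le> k" for j using that by (simp add: fun_eq_iff)
    have coefficients_0: "\<forall>s\<in>S. d s = 0" if "\<forall>x. (\<Sum>s\<in>S. d s * f s x) = 0" for d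
      using independent independent_fun_family_iff[OF finite_S, of f] that by blast
    have "\<forall>s\<in>S. c (s, j) = 0" if "j \<le> k" for j
      by (rule coefficients_0[of "\<lambda>s. c (s, j)"]) (rule forms_0[OF that])
    then show ?thesis by auto
  qed
  then show ?thesis using finite_S by (subst independent_fun_family_iff) auto
qed

theorem siblings_span:
  assumes \<Gamma>_SU2: "\<Gamma> \<subseteq> SU2" and finite_S: "finite S" and span: "fs.span (f ` S) = invariant_forms \<Gamma> k"
  shows "fs.span (sibling f ` (S \<times> {..k})) = modes \<Gamma> k"
proof -
  have f_form: "f s \<in> binary_forms k" if "s \<in> S" for s
    using that span fs.span_base[of "f s" "f ` S"] by (auto simp: invariant_forms_def)
  note span_siblings = span_fun_family_eq[of "S \<times> {..k}" "sibling f"]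
  show ?thesis
  proof (intro set_eqI iffI)
    fix F assume "F \<in> modes \<Gamma> k"
    then obtain h where h_in_span: "\<And>j. h j \<in> fs.span (f ` S)" and F_eq: "F = sibling_sum k h"
      by (auto simp: modes_eq_sibling_sums[OF \<Gamma>_SU2] span)
    have "\<forall>j. \<exists>c. h j = (\<lambda>x. \<Sum>s\<in>S. c s * f s x)"
      using h_in_span unfolding span_fun_family_eq[OF finite_S] by auto
    from choice[OF this] obtain c where h_eq: "\<And>j. h j = (\<lambda>x. \<Sum>s\<in>S. c j s * f s x)" by blast
    have "h = (\<lambda>j x. \<Sum>s\<in>S. (\<lambda>(s, j). c j s) (s, j) * f s x)" by (simp add: fun_eq_iff h_eq)
    then have "F = (\<lambda>x. \<Sum>i\<in>S \<times> {..k}. (\<lambda>(s, j). c j s) i * sibling f i x)"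
      unfolding F_eq using sibling_sum_family[OF finite_S f_form, where c = "\<lambda>(s, j). c j s"] by simp
    then show "F \<in> fs.span (sibling f ` (S \<times> {..k}))" using span_siblings finite_S by auto
  next
    fix F assume "F \<in> fs.span (sibling f ` (S \<times> {..k}))"
    then obtain c where "F = (\<lambda>x. \<Sum>i\<in>S \<times> {..k}. c i * sibling f i x)"
      using span_siblings finite_S by auto
    then have "F = sibling_sum k (\<lambda>j x. \<Sum>s\<in>S. c (s, j) * f s x)"
      using sibling_sum_family[OF finite_S f_form, where c = c] by simp
    moreover have "(\<lambda>x. \<Sum>s\<in>S. c (s, j) * f s x) \<in> invariant_forms \<Gamma> k" for j
      unfolding span[symmetric] by (auto simp: span_fun_family_eq[OF finite_S])
    ultimately show "F \<in> modes \<Gamma> k" by (auto simp: modes_eq_sibling_sums[OF \<Gamma>_SU2])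
  qed
qed

section \<open>Binary dihedral invariants\<close>

lemma binary_dihedral_generators_SU2:
  "mat2 0 \<i> \<i> 0 \<in> SU2" "mat2 (cis t) 0 0 (cis (- t)) \<in> SU2"
  unfolding SU2_def
  by (intro CollectI exI[of _ 0] exI[of _ \<i>]; simp)
     (intro CollectI exI[of _ "cis t"] exI[of _ 0]; simp add: cis_cnj cis_mult)

lemma binary_dihedral_subset_SU2: "binary_dihedral m \<subseteq> SU2"
proof
  fix A assume "A \<in> binary_dihedral m"
  then show "A \<in> SU2"
  proof induction
    case one
    show ?case unfolding SU2_def mat2_one by (intro CollectI exI[of _ 1] exI[of _ 0]) simp
  qed (simp_all add: binary_dihedral_generators_SU2 SU2_mult)
qed

lemma binary_dihedral_invariant_iff:
  fixes m :: nat
  defines "w \<equiv> cis (pi / m)"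
  shows "(\<forall>\<gamma>\<in>binary_dihedral m. Ract \<gamma> f = f) \<longleftrightarrow>
    (\<forall>x. f (pt (\<i> * x$2) (\<i> * x$1)) = f x) \<and> (\<forall>x. f (pt (w * x$1) (cnj w * x$2)) = f x)"
    (is "?L \<longleftrightarrow> ?R")
proof -
  have "?L \<longleftrightarrow> (\<forall>\<gamma>\<in>binary_dihedral m. \<forall>x. f (\<gamma> *v x) = f x)"
    using binary_dihedral_subset_SU2 Ract_eq_iff by blast
  also have "\<dots> \<longleftrightarrow> ?R"
  proof
    assume "\<forall>\<gamma>\<in>binary_dihedral m. \<forall>x. f (\<gamma> *v x) = f x"
    from this[rule_format, OF binary_dihedral.gen1] this[rule_format, OF binary_dihedral.gen2]
    show ?R by (simp add: mat2_mult_vec w_def cis_cnj)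
  next
    assume coefficientwise: ?R
    have "f (\<gamma> *v x) = f x" if "\<gamma> \<in> binary_dihedral m" for \<gamma> x
      using that
    proof (induction arbitrary: x)
      case (mult g h)
      then show ?case by (simp flip: matrix_vector_mul_assoc)
    qed (use coefficientwise in \<open>simp_all add: mat2_mult_vec w_def cis_cnj\<close>)
    then show "\<forall>\<gamma>\<in>binary_dihedral m. \<forall>x. f (\<gamma> *v x) = f x" by blast
  qed
  finally show ?thesis .
qed

lemma binary_forms_cases:
  assumes "f \<in> binary_forms k"
  obtains d where "f = (\<lambda>x. \<Sum>i\<le>k. d i * (x$1 ^ i * x$2 ^ (k - i)))"
  using assms unfolding binary_forms_def span_fun_family_eq[OF finite_atMost] by auto

lemma binary_form_coeffs_unique:
  assumes "\<And>x :: complex^2. (\<Sum>i\<le>k. c i * (x$1 ^ i * x$2 ^ (k - i)))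
      = (\<Sum>i\<le>k. d i * (x$1 ^ i * x$2 ^ (k - i)))"
    and "i \<le> k"
  shows "c i = d i"
proof -
  have "\<forall>z. (\<Sum>i\<le>k. c i * z ^ i) = (\<Sum>i\<le>k. d i * z ^ i)"
    using assms(1)[of "pt z 1" for z] by simp
  then show ?thesis using assms(2) by (simp add: polyfun_eq_coeffs)
qed

lemma invariant_forms_odd:
  assumes "odd k"
  shows "invariant_forms (binary_dihedral m) k = {\<lambda>x. 0}"
proof -
  have "f x = 0" if f_invariant: "f \<in> invariant_forms (binary_dihedral m) k" for f x
  proof -
    have swap: "f (pt (\<i> * x$2) (\<i> * x$1)) = f x" for x
      using f_invariant by (simp add: invariant_forms_def binary_dihedral_invariant_iff)
    have "(-1) *s x = pt (\<i> * (\<i> * x$1)) (\<i> * (\<i> * x$2))" by (simp add: vec2_eq_iff)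
    then have "f ((-1) *s x) = f x" using swap[of "pt (\<i> * x$2) (\<i> * x$1)"] swap[of x] by simp
    moreover have "f ((-1) *s x) = - f x"
      using f_invariant assms bihom_smult[of f k 0 "-1" x]
      by (simp add: invariant_forms_def binary_forms_eq_bihom)
    ultimately show ?thesis by simp
  qed
  then show ?thesis using subspace_funD(1)[OF subspace_invariant_forms] by (auto simp: fun_eq_iff)
qed

lemma cis_eq_1D: "cis t = 1 \<Longrightarrow> \<exists>n::int. t = 2 * pi * n"
  using cos_one_2pi_int[of t] by (metis cis.sel(1) mult.commute mult.left_commute one_complex.sel(1))

lemma dihedral_rotation_weight:
  fixes m n i :: nat
  assumes "m \<ge> 1" "i \<le> 2 * n" and "cis (pi / m) ^ i * cnj (cis (pi / m)) ^ (2 * n - i) = 1"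
  shows "int m dvd int i - int n"
proof -
  have "cis (pi / m) ^ i * cnj (cis (pi / m)) ^ (2 * n - i) = cis (2 * pi * (real i - real n) / m)"
    using assms(2)
    by (simp add: cis_cnj Complex.DeMoivre cis_mult of_nat_diff diff_divide_distrib algebra_simps)
  then obtain j :: int where "2 * pi * (real i - real n) / m = 2 * pi * j"
    using assms(3) cis_eq_1D by metis
  then have "(2 * pi) * (real i - real n) = (2 * pi) * (of_int j * real m)"
    using assms(1) by (simp add: field_simps)
  then have "real i - real n = of_int j * real m" by (subst (asm) mult_left_cancel) auto
  then have "real_of_int (int i - int n) = real_of_int (int m * j)" by (simp add: mult.commute)
  then show ?thesis by (metis dvd_triv_left of_int_eq_iff)
qed

definition monomial_pair :: "nat \<Rightarrow> nat \<Rightarrow> complex^2 \<Rightarrow> complex" where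
  "monomial_pair n i x = x$1 ^ i * x$2 ^ (2 * n - i) + (-1) ^ n * (x$1 ^ (2 * n - i) * x$2 ^ i)"

lemma invariant_form_eq_sum_monomial_pairs:
  assumes m_pos: "m \<ge> 1" and f_invariant: "f \<in> invariant_forms (binary_dihedral m) (2 * n)"
  obtains c where "f = (\<lambda>x. \<Sum>i | i \<le> 2 * n \<and> int m dvd int i - int n. c i * monomial_pair n i x)"
proof -
  let ?w = "cis (pi / m)"
  let ?mon = "\<lambda>i (x :: complex^2). x$1 ^ i * x$2 ^ (2 * n - i)"
  have swap: "f (pt (\<i> * x$2) (\<i> * x$1)) = f x"
      and rotate: "f (pt (?w * x$1) (cnj ?w * x$2)) = f x" for x
    using f_invariant by (simp_all add: invariant_forms_def binary_dihedral_invariant_iff)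
  obtain d where f_expansion: "f = (\<lambda>x. \<Sum>i\<le>2 * n. d i * ?mon i x)"
    using f_invariant binary_forms_cases unfolding invariant_forms_def by blast
  have "(\<Sum>i\<le>2 * n. d i * (?w ^ i * cnj ?w ^ (2 * n - i)) * ?mon i x) = (\<Sum>i\<le>2 * n. d i * ?mon i x)"
      for x
    using rotate[of x] unfolding f_expansion by (simp add: power_mult_distrib mult_ac)
  then have "d i * (?w ^ i * cnj ?w ^ (2 * n - i)) = d i" if "i \<le> 2 * n" for i
    using that by (rule binary_form_coeffs_unique)
  then have weight: "int m dvd int i - int n" if "i \<le> 2 * n" "d i \<noteq> 0" for i
    using that by (intro dihedral_rotation_weight[OF m_pos]) auto
  have "2 * f x = (\<Sum>i\<le>2 * n. d i * monomial_pair n i x)" for x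
  proof -
    have "2 * f x = f x + f (pt (\<i> * x$2) (\<i> * x$1))" by (simp add: swap)
    also have "f (pt (\<i> * x$2) (\<i> * x$1))
        = (\<Sum>i\<le>2 * n. d i * ((-1) ^ n * (x$1 ^ (2 * n - i) * x$2 ^ i)))"
      unfolding f_expansion
    proof (intro sum.cong refl)
      fix i assume "i \<in> {..2 * n}"
      then have "\<i> ^ i * \<i> ^ (2 * n - i) = (-1) ^ n" by (simp add: power_mult flip: power_add)
      then show "d i * ?mon i (pt (\<i> * x$2) (\<i> * x$1))
          = d i * ((-1) ^ n * (x$1 ^ (2 * n - i) * x$2 ^ i))"
        by (simp add: power_mult_distrib mult_ac)
    qed
    finally show ?thesis
      by (simp add: f_expansion monomial_pair_def distrib_left sum.distrib)
  qed
  then have "f x = (\<Sum>i\<le>2 * n. d i / 2 * monomial_pair n i x)" for x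
    by (simp add: sum_divide_distrib[symmetric] field_simps)
  also have "(\<Sum>i\<le>2 * n. d i / 2 * monomial_pair n i x)
      = (\<Sum>i | i \<le> 2 * n \<and> int m dvd int i - int n. d i / 2 * monomial_pair n i x)" for x
    using weight by (intro sum.mono_neutral_right) auto
  finally show thesis by (intro that[of "\<lambda>i. d i / 2"]) (simp add: fun_eq_iff)
qed

lemma dihedral_poly_eq: "dihedral_poly m a b c x =
    (x$1 * x$2) ^ (2 * a) * (x$1 ^ (2*m) + (-1) ^ m * x$2 ^ (2*m)) ^ b
    * (x$1 * x$2 * (x$1 ^ (2*m) - (-1) ^ m * x$2 ^ (2*m))) ^ c"
  by (simp add: dihedral_poly_def Let_def power_mult power_mult_distrib)

definition dihedral_index :: "nat \<Rightarrow> nat \<Rightarrow> (nat \<times> nat \<times> nat) set" where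
  "dihedral_index m n = {(a, b, c). 2 * a + m * b + (m + 1) * c = n \<and> c \<le> 1}"

lemma dihedral_poly_binary_form:
  "dihedral_poly m a b c \<in> binary_forms (2 * (2 * a + m * b + (m + 1) * c))"
proof -
  have power1_form: "(\<lambda>x. x$1 ^ (2*m)) \<in> binary_forms (2*m)"
    using monomial_in_binary_forms[of "2*m" 0] by simp
  have power2_form: "(\<lambda>x. e * x$2 ^ (2*m)) \<in> binary_forms (2*m)" for e
    using binary_forms_closed(2)[OF monomial_in_binary_forms[of 0 "2*m"]] by simp
  have coord_product_form: "(\<lambda>x. x$1 * x$2) \<in> binary_forms 2"
    using monomial_in_binary_forms[of 1 1] by (simp add: numeral_2_eq_2)
  have "dihedral_poly m a b c \<in> binary_forms (2 * a * 2 + b * (2 * m) + c * (2 + 2 * m))"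
    unfolding dihedral_poly_eq[abs_def]
    by (intro binary_forms_mult binary_forms_power binary_forms_closed(3,4) power1_form power2_form
         coord_product_form)
  then show ?thesis by (simp add: algebra_simps)
qed

lemma dihedral_poly_swap: "dihedral_poly m a b c (pt (\<i> * x$2) (\<i> * x$1)) = dihedral_poly m a b c x"
proof -
  define e :: complex where "e = (-1) ^ m"
  have sign_squared: "e * e = 1" by (simp add: e_def flip: power_mult_distrib)
  have power: "(\<i> * y) ^ (2 * m) = e * y ^ (2 * m)" for y
    by (simp only: power_mult_distrib e_def) (simp add: power_mult)
  have sum: "(\<i> * x$2) ^ (2 * m) + e * (\<i> * x$1) ^ (2 * m) = x$1 ^ (2 * m) + e * x$2 ^ (2 * m)"
    unfolding power mult.assoc[symmetric] sign_squared by simp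
  have "\<i> * x$2 * (\<i> * x$1) * ((\<i> * x$2) ^ (2 * m) - e * (\<i> * x$1) ^ (2 * m))
      = - (x$1 * x$2) * (e * x$2 ^ (2 * m) - (e * e) * x$1 ^ (2 * m))"
    unfolding power by (simp add: algebra_simps)
  also have "\<dots> = x$1 * x$2 * (x$1 ^ (2 * m) - e * x$2 ^ (2 * m))" unfolding sign_squared
    by (simp add: algebra_simps)
  finally have difference: "\<i> * x$2 * (\<i> * x$1) * ((\<i> * x$2) ^ (2 * m) - e * (\<i> * x$1) ^ (2 * m))
      = \<dots>" .
  have "\<i> * x$2 * (\<i> * x$1) = - (x$1 * x$2)" by (simp add: mult_ac)
  then show ?thesis
    unfolding dihedral_poly_eq pt_nth e_def[symmetric] sum difference by simp
qed

lemma dihedral_poly_rotate: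
  fixes m :: nat
  assumes "m \<ge> 1"
  defines "w \<equiv> cis (pi / m)"
  shows "dihedral_poly m a b c (pt (w * x$1) (cnj w * x$2)) = dihedral_poly m a b c x"
proof -
  have power: "w ^ (2 * m) = 1" "cnj w ^ (2 * m) = 1"
    using assms by (simp_all add: w_def cis_cnj Complex.DeMoivre complex_eq_iff)
  have product: "w * y * (cnj w * z) = y * z" for y z
    using complex_norm_square[of w] by (simp add: w_def mult_ac)
  show ?thesis
    unfolding dihedral_poly_eq pt_nth product power_mult_distrib[of w]
        power_mult_distrib[of "cnj w"] power
    by simp
qed

lemma dihedral_poly_invariant:
  assumes "m \<ge> 1" "(a, b, c) \<in> dihedral_index m n"
  shows "dihedral_poly m a b c \<in> invariant_forms (binary_dihedral m) (2 * n)"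
proof -
  have "2 * a + m * b + (m + 1) * c = n" using assms(2) by (simp add: dihedral_index_def)
  then have "dihedral_poly m a b c \<in> binary_forms (2 * n)"
    using dihedral_poly_binary_form[of m a b c] by simp
  then show ?thesis
    using assms(1)
    by (simp add: invariant_forms_def binary_dihedral_invariant_iff dihedral_poly_swap
         dihedral_poly_rotate)
qed

definition dihedral_form :: "nat \<Rightarrow> nat \<times> nat \<times> nat \<Rightarrow> complex^2 \<Rightarrow> complex" where
  "dihedral_form m = (\<lambda>(a, b, c). dihedral_poly m a b c)"

definition dihedral_span :: "nat \<Rightarrow> nat \<Rightarrow> (complex^2 \<Rightarrow> complex) set" where
  "dihedral_span m n = fs.span (dihedral_form m ` dihedral_index m n)"

lemma subspace_dihedral_span: "fs.subspace (dihedral_span m n)"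
  by (simp add: dihedral_span_def)

lemmas dihedral_span_closed = subspace_funD[OF subspace_dihedral_span]

lemma dihedral_poly_in_span:
  "2 * a + m * b + (m + 1) * c = n \<Longrightarrow> c \<le> 1 \<Longrightarrow> dihedral_poly m a b c \<in> dihedral_span m n"
  unfolding dihedral_span_def
  by (rule fs.span_base) (auto simp: dihedral_index_def dihedral_form_def
      intro!: image_eqI[of _ _ "(a, b, c)"])

lemma dihedral_span_mult:
  assumes "f \<in> dihedral_span m n"
  shows "(\<lambda>x. (x$1 ^ (2*m) + (-1) ^ m * x$2 ^ (2*m)) * f x) \<in> dihedral_span m (n + m)"
  using assms unfolding dihedral_span_def[of m n]
proof (induction rule: span_fun_induct)
  case zero
  show ?case by (simp add: dihedral_span_closed)
next
  case (step r h f)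
  then obtain a b c where h_eq: "h = dihedral_poly m a b c"
      and abc: "2 * a + m * b + (m + 1) * c = n" "c \<le> 1"
    by (auto simp: dihedral_index_def dihedral_form_def)
  have "(\<lambda>x. (x$1 ^ (2*m) + (-1) ^ m * x$2 ^ (2*m)) * h x) = dihedral_poly m a (b + 1) c"
    by (simp add: h_eq fun_eq_iff dihedral_poly_eq mult_ac)
  also have "\<dots> \<in> dihedral_span m (n + m)"
    using abc by (intro dihedral_poly_in_span) auto
  finally have "(\<lambda>x. r * ((x$1 ^ (2*m) + (-1) ^ m * x$2 ^ (2*m)) * h x)
      + (x$1 ^ (2*m) + (-1) ^ m * x$2 ^ (2*m)) * f x) \<in> dihedral_span m (n + m)"
    by (intro dihedral_span_closed step.IH)
  then show ?case by (simp only: distrib_left mult.left_commute)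
qed

text \<open>Up to the factor \<open>(\<alpha>\<beta>)\<^sup>r\<close> these are the power sums \<open>X\<^sup>t \<plusminus> Y\<^sup>t\<close> with \<open>X = \<alpha>\<^sup>2\<^sup>m\<close> and
  \<open>Y = (-1)\<^sup>m \<beta>\<^sup>2\<^sup>m\<close>, which obey Newton's recursion.\<close>

definition dihedral_power_sum :: "nat \<Rightarrow> nat \<Rightarrow> nat \<Rightarrow> complex^2 \<Rightarrow> complex" where
  "dihedral_power_sum m r t x =
    (x$1 * x$2) ^ r * ((x$1 ^ (2*m)) ^ t + (-1) ^ r * ((-1) ^ m * x$2 ^ (2*m)) ^ t)"

lemma dihedral_power_sum_0:
  "dihedral_power_sum m r 0 = (if even r then (\<lambda>x. 2 * dihedral_poly m (r div 2) 0 0 x) else (\<lambda>x. 0))"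
  by (simp add: fun_eq_iff dihedral_power_sum_def dihedral_poly_eq)

lemma dihedral_power_sum_1:
  "dihedral_power_sum m r 1
      = (if even r then dihedral_poly m (r div 2) 1 0 else dihedral_poly m (r div 2) 0 1)"
  by (auto simp: fun_eq_iff dihedral_power_sum_def dihedral_poly_eq elim!: oddE)

lemma dihedral_power_sum_Suc_Suc:
  "dihedral_power_sum m r (Suc (Suc t)) x =
      (x$1 ^ (2*m) + (-1) ^ m * x$2 ^ (2*m)) * dihedral_power_sum m r (Suc t) x
    - (-1) ^ m * dihedral_power_sum m (r + 2 * m) t x"
proof -
  define X Y P where "X = x$1 ^ (2*m)" and "Y = x$2 ^ (2*m)" and "P = x$1 * x$2"
  have P_power_add: "P ^ (r + 2 * m) = P ^ r * (X * Y)"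
    by (simp add: X_def Y_def P_def power_add power_mult_distrib)
  have sign: "(-1 :: complex) ^ (r + 2 * m) = (-1) ^ r" by (simp add: power_add)
  show ?thesis
    unfolding dihedral_power_sum_def X_def[symmetric] Y_def[symmetric] P_def[symmetric] P_power_add
        sign
    by (simp add: algebra_simps)
qed

lemma dihedral_power_sum_in_span: "dihedral_power_sum m r t \<in> dihedral_span m (r + m * t)"
proof (induction t arbitrary: r rule: induct_nat_012)
  case 0
  show ?case
    unfolding dihedral_power_sum_0 using dihedral_poly_in_span[of "r div 2" m 0 0]
    by (auto intro!: dihedral_span_closed)
next
  case 1
  show ?case
    using dihedral_poly_in_span[of "r div 2" m 1 0] dihedral_poly_in_span[of "r div 2" m 0 1]
    by (cases "even r") (auto simp: dihedral_power_sum_1[simplified] elim!: oddE)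
next
  case (ge2 t)
  have "(\<lambda>x. (x$1 ^ (2*m) + (-1) ^ m * x$2 ^ (2*m)) * dihedral_power_sum m r (Suc t) x)
      \<in> dihedral_span m (r + m * Suc t + m)"
    by (rule dihedral_span_mult[OF ge2(2)])
  moreover have "dihedral_power_sum m (r + 2 * m) t \<in> dihedral_span m (r + 2 * m + m * t)"
    by (rule ge2(1))
  moreover have "r + m * Suc t + m = r + m * Suc (Suc t)" "r + 2 * m + m * t = r + m * Suc (Suc t)"
    by simp_all
  ultimately show ?case
    unfolding dihedral_power_sum_Suc_Suc[abs_def] by (simp only: dihedral_span_closed)
qed

lemma monomial_pair_reflect:
  assumes "i \<le> 2 * n"
  shows "monomial_pair n (2 * n - i) x = (-1) ^ n * monomial_pair n i x"
proof -
  have "(-1) ^ n * ((-1) ^ n * y) = y" for y :: complex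
    by (simp add: mult.assoc[symmetric] power_mult_distrib[symmetric])
  then show ?thesis using assms by (simp add: monomial_pair_def distrib_left)
qed

lemma monomial_pair_eq_power_sum:
  "monomial_pair (r + m * t) (r + 2 * m * t) = dihedral_power_sum m r t"
proof
  fix x :: "complex^2"
  have "(-1) ^ r * ((-1) ^ m * x$2 ^ (2*m)) ^ t = (-1) ^ (r + m * t) * x$2 ^ (2 * m * t)"
    by (simp add: power_mult_distrib power_add power_mult)
  then show "monomial_pair (r + m * t) (r + 2 * m * t) x = dihedral_power_sum m r t x"
    by (simp add: monomial_pair_def dihedral_power_sum_def power_mult_distrib power_add
         algebra_simps flip: power_mult)
qed

lemma monomial_pair_in_dihedral_span:
  assumes i_le: "i \<le> 2 * n" and dvd: "int m dvd int i - int n"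
  shows "monomial_pair n i \<in> dihedral_span m n"
proof -
  have upper: "monomial_pair n i \<in> dihedral_span m n" if i_bounds: "n \<le> i" "i \<le> 2 * n"
      and dvd: "m dvd i - n" for i
  proof -
    obtain t where i_eq: "i - n = m * t" using dvd by (elim dvdE)
    define r where "r = n - m * t"
    have "n = r + m * t" "i = r + 2 * m * t" using i_eq i_bounds by (simp_all add: r_def)
    then show ?thesis
      using dihedral_power_sum_in_span[of m r t] monomial_pair_eq_power_sum[of r m t] by simp
  qed
  show ?thesis
  proof (cases "n \<le> i")
    case True
    then have "m dvd i - n" using dvd by (simp add: of_nat_diff flip: int_dvd_int_iff)
    then show ?thesis using upper[OF True i_le] by blast
  next
    case False
    then have "int (n - i) = - (int i - int n)" by simp
    then have "m dvd n - i" using dvd by (metis dvd_minus_iff int_dvd_int_iff)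
    moreover have "2 * n - i - n = n - i" by simp
    ultimately have "monomial_pair n (2 * n - i) \<in> dihedral_span m n"
      using False by (intro upper) auto
    then have "(\<lambda>x. (-1) ^ n * monomial_pair n (2 * n - i) x) \<in> dihedral_span m n"
      by (rule dihedral_span_closed)
    moreover have "monomial_pair n i = (\<lambda>x. (-1) ^ n * monomial_pair n (2 * n - i) x)"
      using monomial_pair_reflect[of "2 * n - i" n] i_le by (simp add: fun_eq_iff)
    ultimately show ?thesis by simp
  qed
qed

theorem dihedral_span_eq_invariant_forms:
  assumes m_pos: "m \<ge> 1"
  shows "dihedral_span m n = invariant_forms (binary_dihedral m) (2 * n)"
proof
  show "dihedral_span m n \<subseteq> invariant_forms (binary_dihedral m) (2 * n)"
    unfolding dihedral_span_def
    by (intro fs.span_minimal subspace_invariant_forms)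
        (auto simp: dihedral_form_def intro: dihedral_poly_invariant[OF m_pos])
  show "invariant_forms (binary_dihedral m) (2 * n) \<subseteq> dihedral_span m n"
  proof
    fix f assume "f \<in> invariant_forms (binary_dihedral m) (2 * n)"
    then obtain c where "f =
        (\<lambda>x. \<Sum>i | i \<le> 2 * n \<and> int m dvd int i - int n. c i * monomial_pair n i x)"
      using invariant_form_eq_sum_monomial_pairs[OF m_pos] by blast
    then show "f \<in> dihedral_span m n"
      by (auto intro!: subspace_fun_sum[OF subspace_dihedral_span] dihedral_span_closed
          monomial_pair_in_dihedral_span)
  qed
qed

lemma finite_dihedral_index:
  assumes "m \<ge> 1"
  shows "finite (dihedral_index m n)"
proof (rule finite_subset)
  show "dihedral_index m n \<subseteq> {..n} \<times> {..n} \<times> {..n}"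
  proof
    fix s assume "s \<in> dihedral_index m n"
    then obtain a b c where s_eq: "s = (a, b, c)" and degree: "2 * a + m * b + (m + 1) * c = n"
      by (auto simp: dihedral_index_def)
    have "b \<le> m * b" "c \<le> (m + 1) * c" using assms by simp_all
    then have "a \<le> n" "b \<le> n" "c \<le> n" using degree by linarith+
    then show "s \<in> {..n} \<times> {..n} \<times> {..n}" by (simp add: s_eq)
  qed
qed auto

lemma dihedral_index_inj:
  assumes "m \<ge> 1"
  shows "inj_on (\<lambda>(a, b, c). 2 * a + c) (dihedral_index m n)"
proof (rule inj_onI)
  fix s s' assume index: "s \<in> dihedral_index m n" "s' \<in> dihedral_index m n"
    and ord_eq: "(\<lambda>(a, b, c). 2 * a + c) s = (\<lambda>(a, b, c). 2 * a + c) s'"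
  obtain a b c a' b' c' where s_eq: "s = (a, b, c)" "s' = (a', b', c')" by (cases s, cases s') auto
  have "c \<le> 1" "c' \<le> 1" using index by (auto simp: s_eq dihedral_index_def)
  then have "c = c'" "a = a'" using ord_eq unfolding s_eq by (simp_all, presburger+)
  moreover from this index have "m * b = m * b'" by (auto simp: s_eq dihedral_index_def)
  ultimately show "s = s'" using assms by (simp add: s_eq)
qed

lemma distinct_orders_independent:
  fixes U :: "'i \<Rightarrow> 'a::idom poly" and ord :: "'i \<Rightarrow> nat"
  assumes finite_S: "finite S" and inj: "inj_on ord S" and U_nonzero: "\<And>s. s \<in> S \<Longrightarrow> coeff (U s) 0 \<noteq> 0"
    and zero: "(\<Sum>s\<in>S. smult (c s) (monom 1 (ord s) * U s)) = 0" and "s \<in> S"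
  shows "c s = 0"
  using \<open>s \<in> S\<close>
proof (induction "ord s" arbitrary: s rule: less_induct)
  case less
  have "coeff (smult (c t) (monom 1 (ord t) * U t)) (ord s)
      = (if t = s then c s * coeff (U s) 0 else 0)"
    if t_in_S: "t \<in> S" for t
  proof (cases "ord t" "ord s" rule: linorder_cases)
    case equal
    then have "t = s" using inj t_in_S less.prems by (auto dest: inj_onD)
    then show ?thesis by (simp add: coeff_monom_mult)
  qed (use less.hyps t_in_S in \<open>auto simp: coeff_monom_mult\<close>)
  then have "(\<Sum>t\<in>S. if t = s then c s * coeff (U s) 0 else 0)
      = coeff (\<Sum>t\<in>S. smult (c t) (monom 1 (ord t) * U t)) (ord s)"
    by (simp add: coeff_sum)
  then have "c s * coeff (U s) 0 = 0" using finite_S less.prems by (simp add: zero)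
  then show "c s = 0" using U_nonzero[OF less.prems] by simp
qed

lemma dihedral_polys_independent:
  assumes m_pos: "m \<ge> 1"
  shows "inj_on (dihedral_form m) (dihedral_index m n) \<and>
    \<not> fs.dependent (dihedral_form m ` dihedral_index m n)"
proof -
  let ?S = "dihedral_index m n"
  define U :: "nat \<times> nat \<times> nat \<Rightarrow> complex poly" where
    "U = (\<lambda>(a, b, c). (monom 1 (2*m) + [:(-1) ^ m:]) ^ b * (monom 1 (2*m) - [:(-1) ^ m:]) ^ c)"
  let ?ord = "\<lambda>(a::nat, b::nat, c::nat). 2 * a + c"
  have restrict: "dihedral_form m s (pt z 1) = poly (monom 1 (?ord s) * U s) z" for s z
    by (cases s) (simp add: U_def dihedral_form_def dihedral_poly_eq poly_monom power_add
         power_mult_distrib mult_ac)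
  have "(0::complex) ^ (2 * m) = 0" using m_pos by simp
  then have U_nonzero: "coeff (U s) 0 \<noteq> 0" for s
    by (cases s) (simp add: U_def poly_0_coeff_0[symmetric] poly_monom \<open>0 ^ (2 * m) = 0\<close>)
  have "\<forall>s\<in>?S. c s = 0" if "\<forall>x. (\<Sum>s\<in>?S. c s * dihedral_form m s x) = 0" for c
  proof -
    have "poly (\<Sum>s\<in>?S. smult (c s) (monom 1 (?ord s) * U s)) z = 0" for z
      using that[rule_format, of "pt z 1"] by (simp only: restrict poly_sum poly_smult)
    then have "(\<Sum>s\<in>?S. smult (c s) (monom 1 (?ord s) * U s)) = 0"
      using poly_all_0_iff_0 by blast
    then show ?thesis
      by (intro ballI distinct_orders_independent[OF finite_dihedral_index[OF m_pos]
           dihedral_index_inj[OF m_pos] U_nonzero])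
  qed
  then show ?thesis by (subst independent_fun_family_iff[OF finite_dihedral_index[OF m_pos]]) blast
qed

text \<open>An index is determined by \<open>t = b + c\<close>, since \<open>2 a + c = n - m t\<close> with \<open>c \<le> 1\<close>; the value
  \<open>t = 0\<close> forces \<open>c = 0\<close>.\<close>

lemma card_dihedral_index:
  assumes m_pos: "m \<ge> 1"
  shows "card (dihedral_index m n) = n div m + (if even n then 1 else 0)"
proof -
  let ?T = "{t. t \<le> n div m \<and> (t = 0 \<longrightarrow> even n)}"
  let ?index = "\<lambda>t. ((n - m * t) div 2, t - (n - m * t) mod 2, (n - m * t) mod 2)"
  have bound: "t \<le> n div m \<longleftrightarrow> m * t \<le> n" for t
    using m_pos by (simp add: less_eq_div_iff_mult_less_eq mult.commute)
  have "bij_betw (\<lambda>(a, b, c). b + c) (dihedral_index m n) ?T"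
  proof (rule bij_betw_byWitness[where f' = ?index])
    have split: "n - m * (b + c) = 2 * a + c \<and> m * (b + c) \<le> n"
      if "(a, b, c) \<in> dihedral_index m n" for a b c
      using that by (auto simp: dihedral_index_def algebra_simps)
    then show "\<forall>s\<in>dihedral_index m n. ?index ((\<lambda>(a, b, c). b + c) s) = s"
      by (auto simp: dihedral_index_def)
    show "(\<lambda>(a, b, c). b + c) ` dihedral_index m n \<subseteq> ?T"
      using split by (auto simp: bound) (auto simp: dihedral_index_def)
    have odd: "(n - m * t) mod 2 \<le> t" if "t \<in> ?T" for t
      using that by (cases "t = 0") (auto simp: Suc_le_eq intro: order_trans[of _ 1])
    then show "\<forall>t\<in>?T. (\<lambda>(a, b, c). b + c) (?index t) = t" by simp
    show "?index ` ?T \<subseteq> dihedral_index m n"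
    proof clarify
      fix t assume "t \<le> n div m" "t = 0 \<longrightarrow> even n"
      then have t_bounds: "(n - m * t) mod 2 \<le> t" "m * t \<le> n" using odd bound by auto
      define r where "r = n - m * t"
      have "m * (t - c) + (m + 1) * c = m * t + c" if "c \<le> t" for c
        using that by (auto dest!: le_Suc_ex simp: algebra_simps)
      then have "2 * (r div 2) + m * (t - r mod 2) + (m + 1) * (r mod 2)
          = m * t + (2 * (r div 2) + r mod 2)"
        using t_bounds(1) by (simp add: r_def add.assoc)
      also have "\<dots> = n" using t_bounds(2) by (simp add: r_def)
      finally have "2 * (r div 2) + m * (t - r mod 2) + (m + 1) * (r mod 2) = n" .
      then show "?index t \<in> dihedral_index m n" by (simp add: dihedral_index_def r_def)
    qed
  qed
  then have "card (dihedral_index m n) = card ?T" by (rule bij_betw_same_card)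
  also have "?T = (if even n then {..n div m} else {1..n div m})" by (auto simp: Suc_le_eq)
  finally show ?thesis by simp
qed

lemma dihedral_dimension:
  assumes "m \<ge> 1" "k = 2 * n"
  shows "2 * real_of_int \<lfloor>(real k / 2) / 2\<rfloor> + real_of_int \<lfloor>(real k / 2) / real m\<rfloor> - real k / 2 + 1
    = card (dihedral_index m n)"
proof -
  have "real k / 2 = real n" using assms(2) by simp
  moreover have "\<lfloor>real n / 2\<rfloor> = int (n div 2)" using floor_divide_of_nat_eq[of n 2] by simp
  moreover have "\<lfloor>real n / real m\<rfloor> = int (n div m)" by (rule floor_divide_of_nat_eq)
  moreover have "2 * real (n div 2) - real n + 1 = (if even n then 1 else 0)"
    by (auto elim!: evenE oddE)
  ultimately have "2 * real_of_int \<lfloor>(real k / 2) / 2\<rfloor> + real_of_int \<lfloor>(real k / 2) / real m\<rfloor>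
      - real k / 2 + 1
      = real (n div m) + (if even n then 1 else 0)" by simp
  then show ?thesis by (simp add: card_dihedral_index[OF assms(1)])
qed

theorem dihedral_siblings_basis:
  fixes m n :: nat
  assumes m_pos: "m \<ge> 1"
  defines "g \<equiv> sibling (dihedral_form m)" and "I \<equiv> dihedral_index m n \<times> {..2 * n}"
  shows "inj_on g I" and "\<not> fs.dependent (g ` I)"
    and "fs.span (g ` I) = modes (binary_dihedral m) (2 * n)"
    and "fs.dim (modes (binary_dihedral m) (2 * n)) = card (dihedral_index m n) * (2 * n + 1)"
proof -
  note finite = finite_dihedral_index[OF m_pos, of n]
  have form: "dihedral_form m s \<in> binary_forms (2 * n)" if "s \<in> dihedral_index m n" for s
    using dihedral_poly_invariant[OF m_pos, of _ _ _ n] that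
    by (cases s) (simp add: invariant_forms_def dihedral_form_def)
  show inj: "inj_on g I" and indep: "\<not> fs.dependent (g ` I)"
    using siblings_independent[OF finite form] dihedral_polys_independent[OF m_pos, of n]
    by (simp_all add: g_def I_def)
  show span: "fs.span (g ` I) = modes (binary_dihedral m) (2 * n)"
    unfolding g_def I_def using dihedral_span_eq_invariant_forms[OF m_pos, of n]
    by (intro siblings_span[OF binary_dihedral_subset_SU2 finite]) (simp add: dihedral_span_def)
  show "fs.dim (modes (binary_dihedral m) (2 * n)) = card (dihedral_index m n) * (2 * n + 1)"
    unfolding span[symmetric] fs.dim_span_eq_card_independent[OF indep] card_image[OF inj]
    by (simp add: I_def card_cartesian_product)
qed

theorem modes_odd:
  assumes "odd k"
  shows "modes (binary_dihedral m) k = {\<lambda>x. 0}"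
proof -
  have "fs.span {} = invariant_forms (binary_dihedral m) k"
    using invariant_forms_odd[OF assms] by (simp add: zero_fun_def)
  then have "fs.span {} = modes (binary_dihedral m) k"
    using siblings_span[OF binary_dihedral_subset_SU2, of "{}"] by simp
  then show ?thesis by (simp add: zero_fun_def)
qed

theorem theorem13p4:
  fixes m k :: nat
  assumes "m \<ge> 1"
  shows "(odd k \<longrightarrow> modes (binary_dihedral m) k = {\<lambda>x. 0}) \<and>
         (even k \<longrightarrow>
           (let I = {(a, b, c, j). 4 * a + 2 * m * b + (2 * m + 2) * c = k \<and> c \<le> 1 \<and> j \<le> k};
                B = (\<lambda>(a, b, c, j). restrS3 ((twist_minus ^^ j) (dihedral_poly m a b c))) ` I
            in inj_on (\<lambda>(a, b, c, j). restrS3 ((twist_minus ^^ j) (dihedral_poly m a b c))) I \<and>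
               \<not> module.dependent fscale B \<and>
               module.span fscale B = modes (binary_dihedral m) k \<and>
               real (vector_space.dim fscale (modes (binary_dihedral m) k)) =
                 (2 * real_of_int \<lfloor>(real k / 2) / 2\<rfloor> + real_of_int \<lfloor>(real k / 2) / real m\<rfloor>
                   - real k / 2 + 1) * (real k + 1)))"
proof (cases "even k")
  case False
  then show ?thesis by (simp add: modes_odd)
next
  case True
  then obtain n where k_eq: "k = 2 * n" by (elim evenE)
  define assoc :: "nat \<times> nat \<times> nat \<times> nat \<Rightarrow> _" where "assoc = (\<lambda>(a, b, c, j). ((a, b, c), j))"
  define I where "I = {(a, b, c, j). 4 * a + 2 * m * b + (2 * m + 2) * c = k \<and> c \<le> 1 \<and> j \<le> k}"
  have "(4 * a + 2 * m * b + (2 * m + 2) * c = k) = (2 * a + m * b + (m + 1) * c = n)" for a b c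
    unfolding k_eq by (simp only: mult_2 distrib_right) presburger
  then have image: "assoc ` I = dihedral_index m n \<times> {..2 * n}"
    by (force simp: I_def assoc_def dihedral_index_def image_iff k_eq)
  have siblings: "(\<lambda>(a, b, c, j). restrS3 ((twist_minus ^^ j) (dihedral_poly m a b c)))
      = sibling (dihedral_form m) \<circ> assoc"
    by (auto simp: sibling_def dihedral_form_def assoc_def)
  have "inj_on assoc I" by (auto simp: assoc_def inj_on_def)
  then have "inj_on (sibling (dihedral_form m) \<circ> assoc) I"
    using dihedral_siblings_basis(1)[OF assms, of n] by (intro comp_inj_on) (simp_all add: image)
  then show ?thesis
    unfolding Let_def I_def[symmetric] dihedral_dimension[OF assms k_eq] siblings
        image_comp[symmetric] image
    using dihedral_siblings_basis(2-4)[OF assms, of n] by (simp add: k_eq algebra_simps)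
qed

end
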